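(* Let $\sigma\in\mathcal{S}_n$. Then for each $w\in\mathcal{W}_+$ there is a unique pair $(a,b)\in\mathcal{P}_n(\sigma)$ such that the function $$\varphi(z)=\frac12\,\frac{b_*(z)}{a_*(z)}$$ satisfies the interpolation conditions $$\frac{\varphi^{(k)}(z_j)}{k!}=w_{jk},\qquad j=0,1,\dots,m,\quad k=0,\dots,n_j-1,$$ and the positivity condition $$a(z)b(z^{-1})+b(z)a(z^{-1})=2\rho^2\sigma(z)\sigma(z^{-1})\quad\text{for some }\rho>0 .$$ In fact, the map sending $(a,b)\in\mathcal{P}_n(\sigma)$ to $w\in\mathcal{W}_+$ (i.e. to the interpolation data $w_{jk}=\varphi^{(k)}(z_j)/k!$ of the corresponding $\varphi$) is a diffeomorphism from $\mathcal{P}_n(\sigma)$ onto $\mathcal{W}_+$.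
   Context: **Interpolation points and data.** Fix distinct points $z_0=0,z_1,\dots,z_m$ in the open unit disc $\mathbb{D}$ and multiplicities $n_0,\dots,n_m\ge 1$, and put $n:=\sum_{j=0}^m n_j-1$. The family of points is closed under complex conjugation, with conjugate points having equal multiplicities. The data are complex numbers $w_{jk}$ ($0\le j\le m$, $0\le k\le n_j-1$) with $w_{00}=\tfrac12$, and they are conjugate-symmetric: if $z_{j'}=\bar z_j$ then $w_{j'k}=\overline{w_{jk}}$ (in particular $w_{jk}$ is real if $z_j$ is real). The data vector $w$ is the $n$-vector of all $w_{jk}$ except $w_{00}$ (ordered by $j$, then $k$). By conjugate symmetry, the set of such $w$ is a real vector space of real dimension $n$, identified with $\mathbb{R}^n$. **Matrices.** $W=\mathrm{diag}(W_0,\dots,W_m)$ and $Z=\mathrm{diag}(Z_0,\dots,Z_m)$ are $(n+1)\times(n+1)$ block diagonal matrices. $W_j$ is the $n_j\times n_j$ lower triangular Toeplitz matrix with first column $(w_{j0},w_{j1},\dots,w_{j,n_j-1})'$. $Z_j$ is the $n_j\times n_j$ matrix with $z_j$ on the diagonal, $1$ on the first subdiagonal and $0$ elsewhere. Here $'$ denotes transposition and $^*$ conjugate transposition. The vector $e=[e_1^{n_0},\dots,e_1^{n_m}]'\in\mathbb{R}^{n+1}$, where $e_1^{n_j}=[1,0,\dots,0]\in\mathbb{R}^{n_j}$. $E$ is the unique solution of $E=ZEZ^*+ee^*$. **The set $\mathcal{W}_+$.** $\mathcal{W}_+$ is the set of all data vectors $w$ for which the generalized Pick matrix $\Sigma=WE+EW^*$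 is positive definite. It is regarded as a subset of the real $n$-dimensional space above. **Polynomials.** $\mathcal{S}_n$ is the space of real monic Schur polynomials $\sigma(z)=z^n+\sigma_1z^{n-1}+\dots+\sigma_n$ (all roots in $\mathbb{D}$), identified with coefficient vectors in $\mathbb{R}^n$. For $a(z)=z^n+a_1z^{n-1}+\dots+a_n$, write $a_*(z)=z^na(z^{-1})=1+a_1z+\dots+a_nz^n$. $\mathcal{P}_n$ is the $2n$-dimensional space of pairs $(a,b)\in\mathcal{S}_n\times\mathcal{S}_n$ such that $b/a$ is strictly positive real, i.e. analytic with positive real part in $\{|z|>1\}$. For $\sigma\in\mathcal{S}_n$, $\mathcal{P}_n(\sigma)$ is the smooth submanifold of $\mathcal{P}_n$ consisting of the pairs $(a,b)$ for which there is a $\rho>0$ with $a(z)b(z^{-1})+b(z)a(z^{-1})=2\rho^2\sigma(z)\sigma(z^{-1})$. *)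

theory Defs
  imports
    "HOL-Analysis.Analysis"
    "HOL-Computational_Algebra.Computational_Algebra"
begin

section \<open>Smooth maps and diffeomorphisms between subsets of Euclidean spaces\<close>

text \<open>Continuous differentiability of order r, by recursion on the directional derivatives of
  the Frechet derivative. It is used only on open sets of finite-dimensional spaces, where it is
  the usual notion.\<close>

primrec Ck_on ::
  "nat \<Rightarrow> ('a::euclidean_space \<Rightarrow> 'b::euclidean_space) \<Rightarrow> 'a set \<Rightarrow> bool" where
  "Ck_on 0 f U \<longleftrightarrow> continuous_on U f"
| "Ck_on (Suc r) f U \<longleftrightarrow>
     (\<forall>x\<in>U. f differentiable (at x)) \<and>
     (\<forall>v. Ck_on r (\<lambda>x. frechet_derivative f (at x) v) U)"

definition smooth_on ::
  "('a::euclidean_space \<Rightarrow> 'b::euclidean_space) \<Rightarrow> 'a set \<Rightarrow> bool" where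
  "smooth_on f U \<longleftrightarrow> open U \<and> (\<forall>r. Ck_on r f U)"

text \<open>A map on an arbitrary subset S is smooth if it extends locally to smooth maps on open
  subsets of the ambient space. For embedded submanifolds this is smoothness with respect to the
  manifold structure; it depends neither on the choice of linear coordinates nor on enlarging
  the ambient space (for instance from a real affine subspace to the space containing it). If S
  is diffeomorphic in this sense to an open subset of an affine subspace, then S is an embedded
  submanifold of the same dimension.\<close>

definition smooth_map ::
  "'a::euclidean_space set \<Rightarrow> ('a \<Rightarrow> 'b::euclidean_space) \<Rightarrow> bool" where
  "smooth_map S f \<longleftrightarrow>
     (\<forall>x\<in>S. \<exists>U g. x \<in> U \<and> smooth_on g U \<and> (\<forall>y\<in>S \<inter> U. g y = f y))"

definition diffeomorphism ::
  "'a::euclidean_space set \<Rightarrow> 'b::euclidean_space set \<Rightarrow> ('a \<Rightarrow> 'b) \<Rightarrow> bool" where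
  "diffeomorphism S T f \<longleftrightarrow>
     bij_betw f S T \<and> smooth_map S f \<and> smooth_map T (inv_into S f)"


section \<open>Polynomials\<close>

definition cpoly :: "real poly \<Rightarrow> complex \<Rightarrow> complex" where
  "cpoly p \<zeta> = poly (map_poly complex_of_real p) \<zeta>"

definition schur_polys :: "nat \<Rightarrow> real poly set" where
  "schur_polys n =
     {p. degree p = n \<and> lead_coeff p = 1 \<and> (\<forall>\<zeta>. cpoly p \<zeta> = 0 \<longrightarrow> cmod \<zeta> < 1)}"

definition strictly_positive_real :: "(complex \<Rightarrow> complex) \<Rightarrow> bool" where
  "strictly_positive_real f \<longleftrightarrow>
     f analytic_on {\<zeta>. 1 < cmod \<zeta>} \<and> (\<forall>\<zeta>. 1 < cmod \<zeta> \<longrightarrow> 0 < Re (f \<zeta>))"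

definition P_space :: "nat \<Rightarrow> (real poly \<times> real poly) set" where
  "P_space n =
     {(a, b). a \<in> schur_polys n \<and> b \<in> schur_polys n \<and>
              strictly_positive_real (\<lambda>\<zeta>. cpoly b \<zeta> / cpoly a \<zeta>)}"

definition spectral_condition :: "real poly \<Rightarrow> real poly \<Rightarrow> real poly \<Rightarrow> bool" where
  "spectral_condition \<sigma> a b \<longleftrightarrow>
     (\<exists>\<rho>>0. \<forall>\<zeta>. \<zeta> \<noteq> 0 \<longrightarrow>
        cpoly a \<zeta> * cpoly b (inverse \<zeta>) + cpoly b \<zeta> * cpoly a (inverse \<zeta>)
        = 2 * (complex_of_real \<rho>)\<^sup>2 * cpoly \<sigma> \<zeta> * cpoly \<sigma> (inverse \<zeta>))"

definition P_sigma :: "nat \<Rightarrow> real poly \<Rightarrow> (real poly \<times> real poly) set" where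
  "P_sigma n \<sigma> = {(a, b). (a, b) \<in> P_space n \<and> spectral_condition \<sigma> a b}"

text \<open>The reflected polynomial is z to the power degree p, times p(1/z). For p in the space of
  monic Schur polynomials of degree n, this is the reversal of p with respect to n.\<close>

definition interpolant :: "real poly \<Rightarrow> real poly \<Rightarrow> complex \<Rightarrow> complex" where
  "interpolant a b \<zeta> = 1 / 2 * (cpoly (reflect_poly b) \<zeta> / cpoly (reflect_poly a) \<zeta>)"


section \<open>Interpolation data\<close>

text \<open>Vectors and matrices of size n + 1 are indexed by a finite type 'i, together with a
  bijection idx from 'i onto the pairs (j, k) with j at most m and k less than the multiplicity
  mu j. The pair (j, k) stands for the row number pos mu (j, k) in 0..n, which orders the pairs
  by j and then by k.

  A data vector carries the constant entry w_00 = 1/2 as an additional coordinate, and a monic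
  polynomial its leading coefficient 1. Thus the data vectors form an n-dimensional real affine
  subspace of the complex vectors over 'i, and the monic polynomials of degree n an
  n-dimensional affine subspace of the real ones. Having n + 1 rather than n coordinates also
  covers n = 0, as a finite index type is never empty.\<close>

definition index_set :: "nat \<Rightarrow> (nat \<Rightarrow> nat) \<Rightarrow> (nat \<times> nat) set" where
  "index_set m \<mu> = (SIGMA j:{..m}. {..<\<mu> j})"

fun pos :: "(nat \<Rightarrow> nat) \<Rightarrow> nat \<times> nat \<Rightarrow> nat" where
  "pos \<mu> (j, k) = (\<Sum>l<j. \<mu> l) + k"

definition entry :: "('i::finite \<Rightarrow> nat \<times> nat) \<Rightarrow> complex^'i \<Rightarrow> nat \<Rightarrow> nat \<Rightarrow> complex" where
  "entry idx w j k = w $ inv idx (j, k)"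

definition data_vectors ::
  "nat \<Rightarrow> (nat \<Rightarrow> complex) \<Rightarrow> (nat \<Rightarrow> nat) \<Rightarrow> ('i::finite \<Rightarrow> nat \<times> nat) \<Rightarrow> (complex^'i) set" where
  "data_vectors m z \<mu> idx =
     {w. entry idx w 0 0 = 1 / 2 \<and>
         (\<forall>j\<le>m. \<forall>j'\<le>m. z j' = cnj (z j) \<longrightarrow>
            (\<forall>k<\<mu> j. entry idx w j' k = cnj (entry idx w j k)))}"

definition W_mat :: "('i::finite \<Rightarrow> nat \<times> nat) \<Rightarrow> complex^'i \<Rightarrow> complex^'i^'i" where
  "W_mat idx w = (\<chi> p q.
     let (j, k) = idx p; (j', k') = idx q
     in if j = j' \<and> k' \<le> k then entry idx w j (k - k') else 0)"

definition Z_mat :: "(nat \<Rightarrow> complex) \<Rightarrow> ('i::finite \<Rightarrow> nat \<times> nat) \<Rightarrow> complex^'i^'i" where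
  "Z_mat z idx = (\<chi> p q.
     let (j, k) = idx p; (j', k') = idx q
     in if j = j' \<and> k = k' then z j else if j = j' \<and> k = Suc k' then 1 else 0)"

definition e_vec :: "('i::finite \<Rightarrow> nat \<times> nat) \<Rightarrow> complex^'i" where
  "e_vec idx = (\<chi> p. if snd (idx p) = 0 then 1 else 0)"

definition adjoint_mat :: "complex^'i^'i \<Rightarrow> complex^'i^'i" where
  "adjoint_mat A = (\<chi> p q. cnj (A $ q $ p))"

definition outer_self :: "complex^'i \<Rightarrow> complex^'i^'i" where
  "outer_self v = (\<chi> p q. v $ p * cnj (v $ q))"

definition E_mat :: "(nat \<Rightarrow> complex) \<Rightarrow> ('i::finite \<Rightarrow> nat \<times> nat) \<Rightarrow> complex^'i^'i" where
  "E_mat z idx =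
     (THE E. E = Z_mat z idx ** E ** adjoint_mat (Z_mat z idx) + outer_self (e_vec idx))"

definition positive_definite :: "complex^'i^'i \<Rightarrow> bool" where
  "positive_definite A \<longleftrightarrow>
     adjoint_mat A = A \<and>
     (\<forall>v. v \<noteq> 0 \<longrightarrow> 0 < Re (\<Sum>p\<in>UNIV. cnj (v $ p) * (A *v v) $ p))"

definition pick_matrix ::
  "(nat \<Rightarrow> complex) \<Rightarrow> ('i::finite \<Rightarrow> nat \<times> nat) \<Rightarrow> complex^'i \<Rightarrow> complex^'i^'i" where
  "pick_matrix z idx w =
     W_mat idx w ** E_mat z idx + E_mat z idx ** adjoint_mat (W_mat idx w)"

definition W_plus ::
  "nat \<Rightarrow> (nat \<Rightarrow> complex) \<Rightarrow> (nat \<Rightarrow> nat) \<Rightarrow> ('i::finite \<Rightarrow> nat \<times> nat) \<Rightarrow> (complex^'i) set" where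
  "W_plus m z \<mu> idx = {w \<in> data_vectors m z \<mu> idx. positive_definite (pick_matrix z idx w)}"

definition interpolates ::
  "nat \<Rightarrow> (nat \<Rightarrow> complex) \<Rightarrow> (nat \<Rightarrow> nat) \<Rightarrow> ('i::finite \<Rightarrow> nat \<times> nat) \<Rightarrow> complex^'i \<Rightarrow>
   (complex \<Rightarrow> complex) \<Rightarrow> bool" where
  "interpolates m z \<mu> idx w \<phi> \<longleftrightarrow>
     (\<forall>j\<le>m. \<forall>k<\<mu> j. (deriv ^^ k) \<phi> (z j) / fact k = entry idx w j k)"

definition data_of ::
  "(nat \<Rightarrow> complex) \<Rightarrow> ('i::finite \<Rightarrow> nat \<times> nat) \<Rightarrow> (complex \<Rightarrow> complex) \<Rightarrow> complex^'i" where
  "data_of z idx \<phi> = (\<chi> i. let (j, k) = idx i in (deriv ^^ k) \<phi> (z j) / fact k)"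


section \<open>Coefficient vectors\<close>

text \<open>The coordinate in position r is the coefficient of the power n - r, so a monic polynomial
  of degree n has coefficient vector (1, a_1, ..., a_n).\<close>

definition poly_of_vec ::
  "nat \<Rightarrow> (nat \<Rightarrow> nat) \<Rightarrow> ('i::finite \<Rightarrow> nat \<times> nat) \<Rightarrow> real^'i \<Rightarrow> real poly" where
  "poly_of_vec n \<mu> idx v = (\<Sum>i\<in>UNIV. monom (v $ i) (n - pos \<mu> (idx i)))"

definition P_sigma_vec ::
  "nat \<Rightarrow> (nat \<Rightarrow> nat) \<Rightarrow> ('i::finite \<Rightarrow> nat \<times> nat) \<Rightarrow> real poly \<Rightarrow> ((real^'i) \<times> (real^'i)) set" where
  "P_sigma_vec n \<mu> idx \<sigma> =
     {(u, v). (poly_of_vec n \<mu> idx u, poly_of_vec n \<mu> idx v) \<in> P_sigma n \<sigma>}"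

end

theory Submission
  imports Defs "HOL-Complex_Analysis.Complex_Analysis"
begin

text \<open>In the disc variable, write \<open>\<alpha>, \<beta>, s\<close> for the reversals of \<open>a, b, \<sigma>\<close>. Hermite
  interpolation turns the data into a real polynomial \<open>p\<close> of degree at most \<open>n\<close>, and the interpolation
  conditions say that \<open>\<beta>\<close> is the remainder of \<open>2 p \<alpha>\<close> modulo the nodal polynomial. So the problem is
  the equation \<open>Re (\<alpha> cnj \<beta>) = \<rho>\<^sup>2 |s|\<^sup>2\<close> on the unit circle, quadratic in \<open>\<alpha>\<close> for fixed \<open>p\<close>.

  The Pick matrix is the Gram matrix of the form with density \<open>2 Re p\<close> on the space of quotients
  \<open>g = G / \<tau>\<close>, where \<open>G\<close> has degree at most \<open>n\<close> and \<open>\<tau>\<close> is the product of the \<open>1 - cnj z\<^sub>j \<zeta>\<close>,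
  with multiplicities. If \<open>f\<close> is divisible by the nodal polynomial, then \<open>f g cnj g'\<close> has mean value 0 for all such \<open>g, g'\<close>. Applied to
  the difference of two solutions, this gives uniqueness: with \<open>d\<^sub>i = |\<alpha>\<^sub>i|\<^sup>2 / \<rho>\<^sub>i\<^sup>2\<close>, the mean of
  \<open>|s|\<^sup>2 (1/d\<^sub>1 - 1/d\<^sub>2) (d\<^sub>1 - d\<^sub>2) / |\<tau>|\<^sup>2\<close> vanishes. Applied infinitesimally, it shows that the
  derivative of the quadratic equation in \<open>\<alpha>\<close> is injective, so the implicit function theorem gives a
  smooth local inverse and the image is open in the set of positive data.

  The image is also closed: Schur polynomials are bounded, and in the limit either \<open>\<rho> > 0\<close>, which keeps
  \<open>\<alpha>\<close> from vanishing on the circle, or \<open>\<rho> = 0\<close>, which makes the Pick matrix degenerate. The set of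
  positive data is convex and the image contains the data of \<open>a = b = \<sigma>\<close>, hence the map is onto.\<close>

text \<open>The remainder \<beta> is bilinear in \<open>p\<close> and \<alpha>. For fixed \<alpha>
  without zeros at the nodes, \<open>p\<close> is recovered from \<beta> by a linear system, so the
  data map is given by a rational formula; the difficulty lies in solving for \<alpha> when
  \<open>p\<close> is given. There, the constant \<rho> and the constraint \<alpha>(0) = 1 are
  traded for each other: dividing \<alpha> and \<beta> by \<rho> leaves \<open>n + 1\<close>
  equations with a fixed right-hand side for \<open>n + 1\<close> free coefficients, and a final
  division restores the normalization. Then \<beta>(0) = 1 is automatic, as one node is 0 and the
  value prescribed there is 1/2. The denominator \<tau> enters because on the circle the nodal
  polynomial equals \<zeta>^(n+1) times the conjugate of \<tau>. Its product with the conjugate of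
  G/\<tau> is therefore \<zeta> times the conjugate reversal of G, a polynomial vanishing at 0 when
  G has degree at most n. Since \<alpha> obeys this degree bound, it may itself serve as G; this is
  how solutions become their own test functions.\<close>

unbundle no fps_syntax

section \<open>Calculus of smooth maps\<close>

lemma Ck_on_cong:
  assumes "open U" "\<And>x. x \<in> U \<Longrightarrow> f x = g x"
  shows "Ck_on r f U \<longleftrightarrow> Ck_on r g U"
  using assms(2)
proof (induction r arbitrary: f g)
  case 0
  then show ?case by (simp cong: continuous_on_cong)
next
  case (Suc r)
  have "f differentiable (at x) \<longleftrightarrow> g differentiable (at x)" if "x \<in> U" for x
    unfolding differentiable_def
    using has_derivative_transform_within_open[OF _ \<open>open U\<close> that] Suc.prems by metis
  moreover have "Ck_on r (\<lambda>x. frechet_derivative f (at x) v) U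
      \<longleftrightarrow> Ck_on r (\<lambda>x. frechet_derivative g (at x) v) U"
    if *: "\<forall>x\<in>U. f differentiable (at x)" for v
  proof (rule Suc.IH)
    fix x assume "x \<in> U"
    with * Suc.prems have "frechet_derivative f (at x) = frechet_derivative g (at x)"
      by (intro frechet_derivative_transform_within_open[OF _ \<open>open U\<close>]) auto
    then show "frechet_derivative f (at x) v = frechet_derivative g (at x) v" by simp
  qed
  ultimately show ?case by auto
qed

lemma Ck_on_subset: "Ck_on r f U \<Longrightarrow> V \<subseteq> U \<Longrightarrow> Ck_on r f V"
  by (induction r arbitrary: f) (auto intro: continuous_on_subset)

lemma Ck_on_SucD: "Ck_on (Suc r) f U \<Longrightarrow> Ck_on r f U"
proof (induction r arbitrary: f)
  case 0
  then show ?case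
    by (auto intro!: continuous_at_imp_continuous_on differentiable_imp_continuous_within)
next
  case (Suc r)
  then show ?case by (metis Ck_on.simps(2))
qed

text \<open>\<open>Ck_on\<close> refers to the chosen \<open>frechet_derivative\<close>; uniqueness
  of derivatives lets any explicit formula \<open>D\<close> take its place. Most closure properties
  below are inductions with this step.\<close>

lemma Ck_on_SucI:
  assumes "open U" "\<And>x. x \<in> U \<Longrightarrow> (f has_derivative D x) (at x)"
    and "\<And>v. Ck_on r (\<lambda>x. D x v) U"
  shows "Ck_on (Suc r) f U"
proof -
  have "Ck_on r (\<lambda>x. frechet_derivative f (at x) v) U" for v
    using assms(3)[of v] frechet_derivative_at[OF assms(2)]
    by (subst Ck_on_cong[OF assms(1), of _ "\<lambda>x. D x v"]) metis+
  then show ?thesis using assms(2) by (auto simp: differentiable_def)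
qed

lemma Ck_on_Suc_has_derivative:
  "Ck_on (Suc r) f U \<Longrightarrow> x \<in> U \<Longrightarrow> (f has_derivative frechet_derivative f (at x)) (at x)"
  using frechet_derivative_works by auto

lemma Ck_on_const: "open U \<Longrightarrow> Ck_on r (\<lambda>x. c) U"
proof (induction r arbitrary: c)
  case (Suc r)
  show ?case
    by (rule Ck_on_SucI[where D = "\<lambda>x v. 0"]) (use Suc in auto)
qed auto

lemma Ck_on_bounded_linear: "open U \<Longrightarrow> bounded_linear L \<Longrightarrow> Ck_on r L U"
proof (induction r)
  case 0
  then show ?case by (simp add: linear_continuous_on)
next
  case (Suc r)
  show ?case
    by (rule Ck_on_SucI[where D = "\<lambda>x. L"])
      (use Suc in \<open>auto intro: bounded_linear_imp_has_derivative Ck_on_const\<close>)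
qed

lemma Ck_on_add:
  "open U \<Longrightarrow> Ck_on r f U \<Longrightarrow> Ck_on r g U \<Longrightarrow> Ck_on r (\<lambda>x. f x + g x) U"
proof (induction r arbitrary: f g)
  case 0
  then show ?case by (simp add: continuous_on_add)
next
  case (Suc r)
  show ?case
  proof (rule Ck_on_SucI[OF Suc.prems(1)])
    show "((\<lambda>x. f x + g x) has_derivative
      (\<lambda>v. frechet_derivative f (at x) v + frechet_derivative g (at x) v)) (at x)" if "x \<in> U" for x
      using Suc.prems that by (intro has_derivative_add) (auto intro: Ck_on_Suc_has_derivative)
    show "Ck_on r (\<lambda>x. frechet_derivative f (at x) v + frechet_derivative g (at x) v) U" for v
      using Suc.prems by (intro Suc.IH) auto
  qed
qed

text \<open>Stated for an arbitrary bilinear map, so that it serves products and scalings here and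
  the maps \<open>spec\<close> and \<open>mult_mod\<close> later.\<close>

lemma Ck_on_bounded_bilinear:
  assumes "bounded_bilinear B"
  shows "open U \<Longrightarrow> Ck_on r f U \<Longrightarrow> Ck_on r g U \<Longrightarrow> Ck_on r (\<lambda>x. B (f x) (g x)) U"
proof (induction r arbitrary: f g)
  case 0
  then show ?case by (simp add: bounded_bilinear.continuous_on[OF assms])
next
  case (Suc r)
  show ?case
  proof (rule Ck_on_SucI[OF Suc.prems(1)])
    show "((\<lambda>x. B (f x) (g x)) has_derivative (\<lambda>v. B (f x) (frechet_derivative g (at x) v)
      + B (frechet_derivative f (at x) v) (g x))) (at x)" if "x \<in> U" for x
      using Suc.prems that
      by (intro bounded_bilinear.FDERIV[OF assms]) (auto intro: Ck_on_Suc_has_derivative)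
    show "Ck_on r (\<lambda>x. B (f x) (frechet_derivative g (at x) v)
      + B (frechet_derivative f (at x) v) (g x)) U" for v
      using Suc.prems Ck_on_SucD[of r f U] Ck_on_SucD[of r g U]
      by (intro Ck_on_add Suc.IH) auto
  qed
qed

lemmas Ck_on_mult = Ck_on_bounded_bilinear[OF bounded_bilinear_mult]
lemmas Ck_on_scaleR = Ck_on_bounded_bilinear[OF bounded_bilinear_scaleR]

lemma Ck_on_inverse:
  fixes f :: "'a::euclidean_space \<Rightarrow> real"
  assumes "open U" "\<And>x. x \<in> U \<Longrightarrow> f x \<noteq> 0"
  shows "Ck_on r f U \<Longrightarrow> Ck_on r (\<lambda>x. inverse (f x)) U"
proof (induction r)
  case 0
  then show ?case using assms by (auto intro: continuous_on_inverse)
next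
  case (Suc r)
  show ?case
  proof (rule Ck_on_SucI[OF assms(1)])
    \<comment> \<open>The sign is written as a factor, so that closure under products handles the
      whole derivative; it contains \<open>inverse (f x)\<close> again, at the lower order of the
      induction hypothesis.\<close>
    show "((\<lambda>x. inverse (f x)) has_derivative
      (\<lambda>v. (- 1) * (inverse (f x) * frechet_derivative f (at x) v * inverse (f x)))) (at x)"
      if "x \<in> U" for x
      using Deriv.has_derivative_inverse[OF assms(2)[OF that] Ck_on_Suc_has_derivative[OF Suc.prems that]]
      by simp
    show "Ck_on r (\<lambda>x. (- 1) * (inverse (f x) * frechet_derivative f (at x) v * inverse (f x))) U" for v
      using Suc.prems Ck_on_SucD[of r f U] Suc.IH
      by (intro Ck_on_mult Ck_on_const assms(1)) auto
  qed
qed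

lemma Ck_on_sum:
  "open U \<Longrightarrow> (\<And>i. i \<in> I \<Longrightarrow> Ck_on r (f i) U) \<Longrightarrow> Ck_on r (\<lambda>x. \<Sum>i\<in>I. f i x) U"
  by (induction I rule: infinite_finite_induct) (auto intro: Ck_on_add Ck_on_const)

lemma Ck_on_prod:
  fixes f :: "'i \<Rightarrow> 'a::euclidean_space \<Rightarrow> real"
  shows "open U \<Longrightarrow> (\<And>i. i \<in> I \<Longrightarrow> Ck_on r (f i) U) \<Longrightarrow> Ck_on r (\<lambda>x. \<Prod>i\<in>I. f i x) U"
  by (induction I rule: infinite_finite_induct) (auto intro: Ck_on_mult Ck_on_const)

lemma Ck_on_bounded_linear_compose:
  assumes "bounded_linear L"
  shows "open U \<Longrightarrow> Ck_on r f U \<Longrightarrow> Ck_on r (\<lambda>x. L (f x)) U"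
proof (induction r arbitrary: f)
  case 0
  then show ?case by (simp add: bounded_linear.continuous_on[OF assms])
next
  case (Suc r)
  show ?case
  proof (rule Ck_on_SucI[OF Suc.prems(1)])
    show "((\<lambda>x. L (f x)) has_derivative (\<lambda>v. L (frechet_derivative f (at x) v))) (at x)"
      if "x \<in> U" for x
      using Suc.prems that
      by (intro bounded_linear.has_derivative[OF assms]) (auto intro: Ck_on_Suc_has_derivative)
    show "Ck_on r (\<lambda>x. L (frechet_derivative f (at x) v)) U" for v
      using Suc.prems by (intro Suc.IH) auto
  qed
qed

lemma Ck_on_compose_bounded_linear:
  assumes "bounded_linear L" "open U" "open V" "L ` V \<subseteq> U"
  shows "Ck_on r f U \<Longrightarrow> Ck_on r (\<lambda>x. f (L x)) V"
proof (induction r arbitrary: f)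
  case 0
  then show ?case using assms
    by (auto intro: continuous_on_compose2[of U f V L] linear_continuous_on)
next
  case (Suc r)
  show ?case
  proof (rule Ck_on_SucI[OF assms(3)])
    show "((\<lambda>x. f (L x)) has_derivative (\<lambda>v. frechet_derivative f (at (L x)) (L v))) (at x)"
      if "x \<in> V" for x
    proof -
      have "(f has_derivative frechet_derivative f (at (L x))) (at (L x))"
        using Suc.prems that assms(4) by (intro Ck_on_Suc_has_derivative) auto
      from has_derivative_compose[OF bounded_linear_imp_has_derivative[OF assms(1)] this]
      show ?thesis .
    qed
    show "Ck_on r (\<lambda>x. frechet_derivative f (at (L x)) (L v)) V" for v
      using Suc.prems by (intro Suc.IH) auto
  qed
qed

lemma Ck_on_vec_nth:
  "open U \<Longrightarrow> Ck_on r f U \<Longrightarrow> Ck_on r (\<lambda>x. f x $ i) U"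
  by (rule Ck_on_bounded_linear_compose[OF bounded_linear_vec_nth])

lemma Ck_on_vec_lambda:
  fixes f :: "'i::finite \<Rightarrow> 'a::euclidean_space \<Rightarrow> real"
  assumes "open U" "\<And>i. Ck_on r (f i) U"
  shows "Ck_on r (\<lambda>x. \<chi> i. f i x) U"
proof -
  have "(\<lambda>x. \<chi> i. f i x) = (\<lambda>x. \<Sum>i\<in>UNIV. f i x *\<^sub>R axis i 1)"
    by (simp add: fun_eq_iff vec_eq_iff axis_def if_distrib sum.delta' cong: if_cong)
  then show ?thesis
    using assms by (auto intro!: Ck_on_sum Ck_on_scaleR Ck_on_const)
qed

lemma Ck_on_Pair:
  assumes "open U" "Ck_on r f U" "Ck_on r g U"
  shows "Ck_on r (\<lambda>x. (f x, g x)) U"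
proof -
  have "Ck_on r (\<lambda>x. (f x, 0) + (0, g x)) U"
    using assms
    by (intro Ck_on_add Ck_on_bounded_linear_compose[of "\<lambda>y. (y, 0)"]
        Ck_on_bounded_linear_compose[of "\<lambda>y. (0, y)"] bounded_linear_intros) auto
  then show ?thesis by simp
qed

lemma Ck_on_det:
  fixes A :: "'a::euclidean_space \<Rightarrow> real^'n^'n"
  assumes "open U" "\<And>i j. Ck_on r (\<lambda>x. A x $ i $ j) U"
  shows "Ck_on r (\<lambda>x. det (A x)) U"
  unfolding det_def using assms by (intro Ck_on_sum Ck_on_mult Ck_on_prod Ck_on_const) auto

text \<open>Cramer's rule: the solution is a quotient of determinants, hence inherits the smoothness
  of the coefficients without any regularity assumption on \<open>y\<close>.\<close>

lemma Ck_on_linear_system: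
  fixes A :: "'a::euclidean_space \<Rightarrow> real^'n^'n"
  assumes U: "open U" and A: "\<And>i j. Ck_on r (\<lambda>x. A x $ i $ j) U" and b: "Ck_on r b U"
    and nz: "\<And>x. x \<in> U \<Longrightarrow> det (A x) \<noteq> 0" and y: "\<And>x. x \<in> U \<Longrightarrow> A x *v y x = b x"
  shows "Ck_on r y U"
proof -
  have "Ck_on r (\<lambda>x. if j = k then b x $ i else A x $ i $ j) U" for i j k
    using A Ck_on_vec_nth[OF U b] by (cases "j = k") auto
  then have "Ck_on r (\<lambda>x. \<chi> k. det (\<chi> i j. if j = k then b x $ i else A x $ i $ j)
      * inverse (det (A x))) U"
    using U A nz by (intro Ck_on_vec_lambda Ck_on_mult Ck_on_inverse Ck_on_det) auto
  then show ?thesis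
    by (subst Ck_on_cong[OF U]) (use cramer[OF nz] y in \<open>simp add: divide_inverse\<close>)
qed

lemma smooth_onI: "open U \<Longrightarrow> (\<And>r. Ck_on r f U) \<Longrightarrow> smooth_on f U"
  by (simp add: smooth_on_def)

section \<open>Smooth implicit functions\<close>

lemma det_nonzero_iff_injective:
  fixes A :: "real^'n^'n"
  shows "det A \<noteq> 0 \<longleftrightarrow> (\<forall>h. A *v h = 0 \<longrightarrow> h = 0)"
  using det_nz_iff_inj[OF matrix_vector_mul_linear[of A]]
  by (simp add: linear_injective_0[OF matrix_vector_mul_linear])

text \<open>The inverse function theorem for \<open>(p, x) \<mapsto> (p, B x (M p x))\<close> yields
  a differentiable solution \<open>X\<close>. Higher orders come from differentiating the equation
  that \<open>X\<close> satisfies: its derivative solves a linear system whose coefficients are as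
  smooth as \<open>X\<close>, so \<open>Ck_on_linear_system\<close> raises the order by one each
  time.\<close>

theorem smooth_implicit_function:
  fixes B :: "real^'n \<Rightarrow> real^'n \<Rightarrow> real^'n" and M :: "'p::euclidean_space \<Rightarrow> real^'n \<Rightarrow> real^'n"
  assumes B: "bounded_bilinear B" and M: "bounded_bilinear M"
    and c: "B x0 (M p0 x0) = c"
    and inj: "\<And>h. B h (M p0 x0) + B x0 (M p0 h) = 0 \<Longrightarrow> h = 0"
  obtains U X where "open U" "p0 \<in> U" "X p0 = x0" "smooth_on X U"
    "\<And>p. p \<in> U \<Longrightarrow> B (X p) (M p (X p)) = c"
proof -
  interpret B: bounded_bilinear B by fact
  interpret M: bounded_bilinear M by fact
  define F where "F = (\<lambda>(p, x). (p, B x (M p x)))"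
  define DF where "DF = (\<lambda>(p, x) (q, h). (q, B h (M p x) + B x (M p h + M q x)))"
  define K where "K = (\<lambda>(p, x). matrix (\<lambda>h. B h (M p x) + B x (M p h)))"
  have K: "K (p, x) *v h = B h (M p x) + B x (M p h)" for p x h
  proof -
    have "linear (\<lambda>h. B h (M p x) + B x (M p h))"
      by (auto intro!: linearI simp: B.add_left B.add_right M.add_right algebra_simps
          B.scaleR_left B.scaleR_right M.scaleR_right)
    then show ?thesis
      unfolding K_def prod.case by (intro matrix_works) (simp add: linear_matrix_vector_mul_eq)
  qed
  have bl: "bounded_linear (DF y)" for y
    unfolding DF_def case_prod_unfold
    by (intro bounded_linear_Pair bounded_linear_add bounded_linear_fst bounded_linear_snd
        bounded_linear_compose[OF B.bounded_linear_left]
        bounded_linear_compose[OF B.bounded_linear_right]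
        bounded_linear_compose[OF M.bounded_linear_left]
        bounded_linear_compose[OF M.bounded_linear_right])
  have der: "(F has_derivative DF y) (at y)" for y
  proof -
    have "((\<lambda>y. (fst y, B (snd y) (M (fst y) (snd y)))) has_derivative
      (\<lambda>h. (fst h, B (snd y) (M (fst y) (snd h) + M (fst h) (snd y))
        + B (snd h) (M (fst y) (snd y))))) (at y)"
      by (intro has_derivative_Pair B.FDERIV M.FDERIV has_derivative_fst has_derivative_snd
          has_derivative_ident)
    then show ?thesis unfolding F_def DF_def case_prod_unfold by (simp add: add.commute)
  qed
  define F' where "F' = (\<lambda>y. Blinfun (DF y))"
  have F': "blinfun_apply (F' y) = DF y" for y
    unfolding F'_def by (simp add: bl bounded_linear_Blinfun_apply)
  have cont: "continuous_on UNIV F'"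
    by (intro continuous_on_blinfun_componentwise)
      (simp add: F' DF_def case_prod_unfold, intro continuous_intros B.continuous_on M.continuous_on)
  have "inj (DF (p0, x0))"
  proof (subst linear_injective_0[OF bounded_linear.linear[OF bl]], safe)
    fix q h assume "DF (p0, x0) (q, h) = 0"
    then show "(q, h) = 0" using inj[of h] by (auto simp: DF_def zero_prod_def M.zero_left)
  qed
  then obtain g where g: "linear g" "g \<circ> DF (p0, x0) = id"
    using linear_injective_left_inverse[OF bounded_linear.linear[OF bl]] by blast
  have "Blinfun g o\<^sub>L F' (p0, x0) = id_blinfun"
    using g by (intro blinfun_eqI)
      (auto simp: F' bounded_linear_Blinfun_apply linear_conv_bounded_linear fun_eq_iff)
  from inverse_function_theorem[OF open_UNIV _ cont _ this, of F]
  obtain U' V g g' where U': "open U'" "(p0, x0) \<in> U'" and V: "open V" "F (p0, x0) \<in> V"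
    and hom: "homeomorphism U' V F g"
    and g': "\<And>y. y \<in> V \<Longrightarrow> (g has_derivative (g' y)) (at y)"
    and bij: "\<And>y. y \<in> V \<Longrightarrow> bij (DF (g y))"
    using der[folded F'] unfolding F' by (metis UNIV_I)
  define X where "X = (\<lambda>p. snd (g (p, c)))"
  define U where "U = (\<lambda>p. (p, c)) -` V"
  have U: "open U" unfolding U_def
    by (intro open_vimage V continuous_intros)
  have gX: "g (p, c) = (p, X p)" "F (p, X p) = (p, c)" if "p \<in> U" for p
  proof -
    have "F (g (p, c)) = (p, c)"
      using hom that unfolding U_def by (auto simp: homeomorphism_def)
    then show "g (p, c) = (p, X p)" "F (p, X p) = (p, c)"
      by (auto simp: F_def X_def split: prod.splits)
  qed
  have eq: "B (X p) (M p (X p)) = c" if "p \<in> U" for p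
    using gX(2)[OF that] by (simp add: F_def)
  have p0: "p0 \<in> U" using V(2) c by (simp add: U_def F_def)
  have X0: "X p0 = x0"
    using hom U'(2) c unfolding X_def homeomorphism_def F_def by force
  \<comment> \<open>The inverse function theorem makes the derivative of \<open>F\<close> bijective
    along the whole graph of \<open>X\<close>, not only at the base point; in directions
    \<open>(0, h)\<close> this is invertibility of \<open>K\<close>.\<close>
  have Kdet: "det (K (p, X p)) \<noteq> 0" if "p \<in> U" for p
  proof (subst det_nonzero_iff_injective, safe)
    fix h assume "K (p, X p) *v h = 0"
    then have "DF (p, X p) (0, h) = DF (p, X p) (0, 0)"
      unfolding K DF_def by (simp add: M.zero_left M.zero_right B.zero_right B.zero_left)
    moreover have "inj (DF (p, X p))"
      using bij[of "(p, c)"] gX(1)[OF that] that by (auto simp: U_def bij_def)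
    ultimately show "h = 0" by (auto dest: injD)
  qed
  define DX where "DX = (\<lambda>p q. snd (g' (p, c) (q, 0)))"
  have DX: "(X has_derivative DX p) (at p)" if "p \<in> U" for p
    unfolding X_def DX_def
    using that g'[of "(p, c)"]
    by (intro has_derivative_snd has_derivative_compose[of "\<lambda>p. (p, c)" _ _ _ g])
      (auto simp: U_def intro!: derivative_eq_intros)
  have sys: "K (p, X p) *v DX p v = - B (X p) (M v (X p))" if "p \<in> U" for p v
  proof -
    have "((\<lambda>p. B (X p) (M p (X p))) has_derivative
      (\<lambda>v. B (X p) (M p (DX p v) + M v (X p)) + B (DX p v) (M p (X p)))) (at p)"
      using DX[OF that] by (auto intro!: B.FDERIV M.FDERIV)
    moreover have "((\<lambda>p. B (X p) (M p (X p))) has_derivative (\<lambda>v. 0)) (at p)"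
      by (rule has_derivative_transform_within_open[of "\<lambda>p. c", OF _ U that]) (auto simp: eq)
    ultimately have "B (X p) (M p (DX p v) + M v (X p)) + B (DX p v) (M p (X p)) = 0"
      using has_derivative_unique by (metis (no_types, lifting))
    then show ?thesis unfolding K by (simp add: B.add_right algebra_simps eq_neg_iff_add_eq_0)
  qed
  have "Ck_on r X U" for r
  proof (induction r)
    case 0
    show ?case unfolding Ck_on.simps
      by (rule continuous_at_imp_continuous_on) (blast intro: DX has_derivative_continuous)
  next
    case (Suc r)
    note ids = Ck_on_bounded_linear[OF U bounded_linear_ident]
    show ?case
    proof (rule Ck_on_SucI[OF U DX], assumption, rule Ck_on_linear_system[OF U _ _ Kdet sys])
      show "Ck_on r (\<lambda>x. - B (X x) (M v (X x))) U" for v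
        by (intro Ck_on_bounded_linear_compose[OF bounded_linear_minus[OF bounded_linear_ident]]
            Ck_on_bounded_bilinear[OF B] Ck_on_bounded_bilinear[OF M] U Suc Ck_on_const)
      show "Ck_on r (\<lambda>x. K (x, X x) $ i $ j) U" for i j
      proof -
        have "Ck_on r (\<lambda>x. (B (axis j 1) (M x (X x)) + B (X x) (M x (axis j 1))) $ i) U"
          by (intro Ck_on_vec_nth Ck_on_add Ck_on_bounded_bilinear[OF B] Ck_on_bounded_bilinear[OF M]
              U Suc Ck_on_const ids)
        then show ?thesis by (simp add: K_def matrix_def)
      qed
    qed auto
  qed
  then show ?thesis by (rule that[OF U p0 X0 smooth_onI[OF U] eq])
qed

section \<open>Means over the unit circle\<close>

text \<open>Mean with respect to normalized arc length. The general codomain lets real and complex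
  means share their lemmas.\<close>

definition cmean :: "(complex \<Rightarrow> 'a::euclidean_space) \<Rightarrow> 'a" where
  "cmean f = integral {0..1} (\<lambda>t. f (cis (2 * pi * t)))"

abbreviation circle :: "complex set" where "circle \<equiv> sphere 0 1"

lemma cis_in_circle: "cis t \<in> circle"
  by simp

lemma circle_cis:
  assumes "\<zeta> \<in> circle" obtains t where "0 \<le> t" "t \<le> 1" "\<zeta> = cis (2 * pi * t)"
proof -
  have n: "norm \<zeta> = 1" using assms by simp
  then have "\<zeta> = cis (Arg2pi \<zeta>)"
    using complex_norm_eq_1_exp[of \<zeta>] by (simp add: cis_conv_exp)
  moreover have "0 \<le> Arg2pi \<zeta> / (2 * pi)" "Arg2pi \<zeta> / (2 * pi) \<le> 1"
    using Arg2pi_ge_0[of \<zeta>] Arg2pi_lt_2pi[of \<zeta>] by (auto simp: field_simps)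
  ultimately show ?thesis using that[of "Arg2pi \<zeta> / (2 * pi)"] by simp
qed

lemma continuous_circle_param:
  assumes "continuous_on circle f"
  shows "continuous_on {0..1} (\<lambda>t. f (cis (2 * pi * t)))"
  by (rule continuous_on_compose2[OF assms]) (auto intro!: continuous_intros simp: cis_conv_exp)

lemma integrable_circle_param:
  fixes f :: "complex \<Rightarrow> 'a::euclidean_space"
  shows "continuous_on circle f \<Longrightarrow> (\<lambda>t. f (cis (2 * pi * t))) integrable_on {0..1}"
  using integrable_continuous_interval continuous_circle_param by blast

lemma cmean_cong: "(\<And>\<zeta>. \<zeta> \<in> circle \<Longrightarrow> f \<zeta> = g \<zeta>) \<Longrightarrow> cmean f = cmean g"
  unfolding cmean_def by (intro integral_cong) simp

lemma cmean_linear: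
  assumes "bounded_linear L" "continuous_on circle f"
  shows "cmean (\<lambda>\<zeta>. L (f \<zeta>)) = L (cmean f)"
  unfolding cmean_def using integral_linear[OF integrable_circle_param assms(1)] assms(2)
  by (simp add: o_def)

lemma cmean_add:
  "continuous_on circle f \<Longrightarrow> continuous_on circle g \<Longrightarrow>
    cmean (\<lambda>\<zeta>. f \<zeta> + g \<zeta>) = cmean f + cmean g"
  unfolding cmean_def by (intro integral_add integrable_circle_param)

lemma cmean_diff:
  "continuous_on circle f \<Longrightarrow> continuous_on circle g \<Longrightarrow>
    cmean (\<lambda>\<zeta>. f \<zeta> - g \<zeta>) = cmean f - cmean g"
  unfolding cmean_def by (intro integral_diff integrable_circle_param)

lemma cmean_sum:
  "finite I \<Longrightarrow> (\<And>i. i \<in> I \<Longrightarrow> continuous_on circle (f i)) \<Longrightarrow>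
    cmean (\<lambda>\<zeta>. \<Sum>i\<in>I. f i \<zeta>) = (\<Sum>i\<in>I. cmean (f i))"
  unfolding cmean_def by (intro integral_sum integrable_circle_param)

lemma cmean_const [simp]: "cmean (\<lambda>\<zeta>. c) = c"
  by (simp add: cmean_def)

lemma cmean_mult_left:
  fixes f :: "complex \<Rightarrow> complex"
  shows "continuous_on circle f \<Longrightarrow> cmean (\<lambda>\<zeta>. c * f \<zeta>) = c * cmean f"
  by (rule cmean_linear[OF bounded_linear_mult_right])

lemma cmean_cnj: "continuous_on circle f \<Longrightarrow> cmean (\<lambda>\<zeta>. cnj (f \<zeta>)) = cnj (cmean f)"
  by (rule cmean_linear[OF bounded_linear_cnj])

lemma cmean_Re: "continuous_on circle f \<Longrightarrow> cmean (\<lambda>\<zeta>. Re (f \<zeta>)) = Re (cmean f)"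
  by (rule cmean_linear[OF bounded_linear_Re])

lemma cmean_of_real:
  fixes f :: "complex \<Rightarrow> real"
  shows "continuous_on circle f \<Longrightarrow> cmean (\<lambda>\<zeta>. complex_of_real (f \<zeta>)) = of_real (cmean f)"
  by (rule cmean_linear[OF bounded_linear_of_real])

text \<open>No integrability is assumed: the integral of a non-integrable function is 0 by
  convention.\<close>

lemma cmean_nonneg:
  fixes f :: "complex \<Rightarrow> real"
  shows "(\<And>\<zeta>. \<zeta> \<in> circle \<Longrightarrow> 0 \<le> f \<zeta>) \<Longrightarrow> 0 \<le> cmean f"
  unfolding cmean_def
  by (cases "(\<lambda>t. f (cis (2 * pi * t))) integrable_on {0..1}")
    (auto intro!: Henstock_Kurzweil_Integration.integral_nonneg simp: not_integrable_integral)

lemma cmean_nonneg_eq_0: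
  fixes f :: "complex \<Rightarrow> real"
  assumes "continuous_on circle f" "\<And>\<zeta>. \<zeta> \<in> circle \<Longrightarrow> 0 \<le> f \<zeta>" "cmean f = 0" "\<zeta> \<in> circle"
  shows "f \<zeta> = 0"
proof -
  obtain t where t: "0 \<le> t" "t \<le> 1" "\<zeta> = cis (2 * pi * t)" using circle_cis[OF assms(4)] .
  have "f (cis (2 * pi * t)) = 0"
    using integral_eq_0_iff[OF continuous_circle_param[OF assms(1)]] assms(2,3) t
    by (auto simp: cmean_def)
  then show ?thesis by (simp add: t)
qed

text \<open>Cauchy's formula at the centre, since
  \<open>d\<zeta> / (2 * \<pi> * \<i> * \<zeta>)\<close> is normalized arc length on the
  circle.\<close>

lemma cmean_holomorphic:
  assumes "f holomorphic_on cball 0 1"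
  shows "cmean f = f 0"
proof -
  have "((\<lambda>u. f u / (u - 0)) has_contour_integral (2 * of_real pi * \<i> * f 0)) (circlepath 0 1)"
    by (rule Cauchy_integral_circlepath_simple[OF assms]) simp
  then have "((\<lambda>t. 2 * of_real pi * \<i> * f (cis (2 * pi * t))) has_integral
      (2 * of_real pi * \<i> * f 0)) {0..1}"
    unfolding has_contour_integral
    unfolding vector_derivative_circlepath
    by (rule has_integral_eq[rotated]) (simp add: circlepath cis_conv_exp mult_ac)
  then have "((\<lambda>t. inverse (2 * of_real pi * \<i>) * (2 * of_real pi * \<i> * f (cis (2 * pi * t))))
      has_integral inverse (2 * of_real pi * \<i>) * (2 * of_real pi * \<i> * f 0)) {0..1}"
    by (rule has_integral_mult_right)
  then show ?thesis unfolding cmean_def by (intro integral_unique) (simp add: field_simps)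
qed

lemma holomorphic_cball_continuous_circle: "f holomorphic_on cball 0 1 \<Longrightarrow> continuous_on circle f"
  by (meson holomorphic_on_imp_continuous_on continuous_on_subset sphere_cball)

lemma circle_mult_cnj: "\<zeta> \<in> circle \<Longrightarrow> \<zeta> * cnj \<zeta> = 1" "\<zeta> \<in> circle \<Longrightarrow> cnj \<zeta> * \<zeta> = 1"
  by (simp_all add: complex_norm_square[symmetric] mult.commute)

lemma circle_inverse: "\<zeta> \<in> circle \<Longrightarrow> inverse \<zeta> = cnj \<zeta>"
  by (rule inverse_unique) (rule circle_mult_cnj)

lemma circle_nonzero: "\<zeta> \<in> circle \<Longrightarrow> \<zeta> \<noteq> 0"
  by auto

text \<open>The minimum principle for \<open>Re f\<close>, obtained from the maximum modulus
  principle for \<open>exp (- f)\<close>, whose modulus is \<open>exp (- Re f)\<close>.\<close>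

lemma Re_pos_cball:
  assumes f: "f holomorphic_on cball 0 1" and pos: "\<And>\<zeta>. \<zeta> \<in> circle \<Longrightarrow> 0 < Re (f \<zeta>)"
    and z: "z \<in> cball 0 1"
  shows "0 < Re (f z)"
proof -
  have "compact circle" "circle \<noteq> {}" using cis_in_circle by (auto intro: compact_sphere)
  moreover have "continuous_on circle (\<lambda>\<zeta>. Re (f \<zeta>))"
    using holomorphic_cball_continuous_circle[OF f] by (intro continuous_intros)
  ultimately obtain \<zeta>0 where \<zeta>0: "\<zeta>0 \<in> circle" "\<And>\<zeta>. \<zeta> \<in> circle \<Longrightarrow> Re (f \<zeta>0) \<le> Re (f \<zeta>)"
    using continuous_attains_inf by (metis (no_types, lifting))
  have "cmod (exp (- f z)) \<le> exp (- Re (f \<zeta>0))"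
  proof (rule maximum_modulus_frontier[of "\<lambda>z. exp (- f z)" "cball 0 1"])
    have cont: "continuous_on (cball 0 1) f" using f by (rule holomorphic_on_imp_continuous_on)
    then show "continuous_on (closure (cball 0 1)) (\<lambda>z. exp (- f z))"
      by (auto intro!: continuous_intros)
    show "(\<lambda>z. exp (- f z)) holomorphic_on interior (cball 0 1)"
      using holomorphic_on_subset[OF f] by (intro holomorphic_intros) auto
  qed (use z \<zeta>0 in auto)
  then show ?thesis using pos[OF \<zeta>0(1)] by simp
qed

text \<open>The unimodularity constant \<open>c\<close> is forced to be 1 by the mean values of \<open>|g|\<^sup>2\<close> and
  \<open>|1/g|\<^sup>2\<close>; then \<open>g - 1\<close> has mean square 0.\<close>

lemma constant_modulus_eq_1:
  assumes g: "g holomorphic_on cball 0 1" and nz: "\<And>\<zeta>. \<zeta> \<in> cball 0 1 \<Longrightarrow> g \<zeta> \<noteq> 0"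
    and g0: "g 0 = 1" and c: "\<And>\<zeta>. \<zeta> \<in> circle \<Longrightarrow> (cmod (g \<zeta>))\<^sup>2 = c" and \<zeta>: "\<zeta> \<in> circle"
  shows "g \<zeta> = 1"
proof -
  have sq: "cmean (\<lambda>\<zeta>. (cmod (h \<zeta> - 1))\<^sup>2) = d - 1"
    if h: "h holomorphic_on cball 0 1" "h 0 = 1" "\<And>\<zeta>. \<zeta> \<in> circle \<Longrightarrow> (cmod (h \<zeta>))\<^sup>2 = d" for h d
  proof -
    note [continuous_intros] = holomorphic_cball_continuous_circle[OF h(1)]
    have "cmean (\<lambda>\<zeta>. (cmod (h \<zeta> - 1))\<^sup>2) = cmean (\<lambda>\<zeta>. (d + 1) - 2 * Re (h \<zeta>))"
    proof (rule cmean_cong)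
      fix \<zeta> assume "\<zeta> \<in> circle"
      then show "(cmod (h \<zeta> - 1))\<^sup>2 = (d + 1) - 2 * Re (h \<zeta>)"
        using h(3)[symmetric] unfolding cmod_power2 minus_complex.simps one_complex.simps
        by (simp add: power2_eq_square algebra_simps)
    qed
    also have "\<dots> = (d + 1) - 2 * cmean (\<lambda>\<zeta>. Re (h \<zeta>))"
      by (subst cmean_diff) (auto intro!: continuous_intros cmean_linear[OF bounded_linear_mult_right])
    also have "cmean (\<lambda>\<zeta>. Re (h \<zeta>)) = 1"
      using cmean_holomorphic[OF h(1)] h(2) by (subst cmean_Re) (auto intro!: continuous_intros)
    finally show ?thesis by simp
  qed
  have nn: "0 \<le> cmean (\<lambda>\<zeta>. (cmod (h \<zeta> - 1))\<^sup>2)" for h by (rule cmean_nonneg) simp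
  have "0 \<le> c - 1" using sq[OF g g0 c] nn[of g] by simp
  moreover have "(\<lambda>\<zeta>. inverse (g \<zeta>)) holomorphic_on cball 0 1"
    using g nz by (intro holomorphic_intros)
  then have "0 \<le> inverse c - 1"
    using sq[of "\<lambda>\<zeta>. inverse (g \<zeta>)" "inverse c"] nn[of "\<lambda>\<zeta>. inverse (g \<zeta>)"] g0 c
    by (auto simp: norm_inverse power_inverse)
  ultimately have "c = 1" by (simp add: field_simps split: if_splits)
  then have "(cmod (g \<zeta> - 1))\<^sup>2 = 0"
    using sq[OF g g0 c] \<zeta> holomorphic_cball_continuous_circle[OF g]
    by (intro cmean_nonneg_eq_0[of "\<lambda>\<zeta>. (cmod (g \<zeta> - 1))\<^sup>2"]) (auto intro!: continuous_intros)
  then show ?thesis by simp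
qed

text \<open>Where the real part vanishes, \<open>|g|^2 = - Re (g^2)\<close>. The mean of
  \<open>g^2\<close> is \<open>g(0)^2\<close>, which is nonnegative because \<open>g(0)\<close> is
  real, so the mean of \<open>|g|^2\<close> cannot be positive.\<close>

lemma Re_zero_on_circle_imp_zero:
  assumes g: "g holomorphic_on cball 0 1" and g0: "Im (g 0) = 0"
    and Re: "\<And>\<zeta>. \<zeta> \<in> circle \<Longrightarrow> Re (g \<zeta>) = 0" and \<zeta>: "\<zeta> \<in> circle"
  shows "g \<zeta> = 0"
proof -
  note [continuous_intros] = holomorphic_cball_continuous_circle[OF g]
  have "cmean (\<lambda>\<zeta>. (cmod (g \<zeta>))\<^sup>2) = - cmean (\<lambda>\<zeta>. Re (g \<zeta> * g \<zeta>))"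
  proof (subst cmean_linear[OF bounded_linear_minus[OF bounded_linear_ident], symmetric])
    show "continuous_on circle (\<lambda>\<zeta>. Re (g \<zeta> * g \<zeta>))" by (intro continuous_intros)
    show "cmean (\<lambda>\<zeta>. (cmod (g \<zeta>))\<^sup>2) = cmean (\<lambda>\<zeta>. - Re (g \<zeta> * g \<zeta>))"
      by (intro cmean_cong, subst cmod_power2) (simp add: Re power2_eq_square)
  qed
  also have "cmean (\<lambda>\<zeta>. Re (g \<zeta> * g \<zeta>)) = Re (g 0 * g 0)"
    by (subst cmean_Re, intro continuous_intros, subst cmean_holomorphic)
      (auto intro!: holomorphic_intros g)
  finally have "cmean (\<lambda>\<zeta>. (cmod (g \<zeta>))\<^sup>2) \<le> 0" using g0 by simp
  moreover have "0 \<le> cmean (\<lambda>\<zeta>. (cmod (g \<zeta>))\<^sup>2)" by (rule cmean_nonneg) simp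
  ultimately have "(cmod (g \<zeta>))\<^sup>2 = 0"
    using \<zeta> by (intro cmean_nonneg_eq_0[of "\<lambda>\<zeta>. (cmod (g \<zeta>))\<^sup>2"]) (auto intro!: continuous_intros)
  then show ?thesis by simp
qed

section \<open>Complex polynomials and Hermite interpolation\<close>

abbreviation cp :: "real poly \<Rightarrow> complex poly" where "cp \<equiv> map_poly complex_of_real"

lemma coeff_cp [simp]: "coeff (cp p) k = of_real (coeff p k)"
  by (simp add: coeff_map_poly)

lemma cp_0 [simp]: "cp 0 = 0" by (simp add: poly_eq_iff)

lemma cp_add: "cp (p + q) = cp p + cp q" by (simp add: poly_eq_iff)

lemma cp_smult: "cp (smult c p) = smult (of_real c) (cp p)" by (simp add: poly_eq_iff)

lemma cp_mult: "cp (p * q) = cp p * cp q" by (simp add: poly_eq_iff coeff_mult)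

lemma cp_monom: "cp (monom c k) = monom (of_real c) k" by (simp add: poly_eq_iff)

lemma cp_eq_iff [simp]: "cp p = cp q \<longleftrightarrow> p = q" by (simp add: poly_eq_iff)

lemma cp_eq_0_iff [simp]: "cp p = 0 \<longleftrightarrow> p = 0" by (simp add: poly_eq_iff)

lemma degree_cp [simp]: "degree (cp p) = degree p" by (simp add: degree_map_poly)

lemma cpoly_cnj: "cnj (cpoly p \<zeta>) = cpoly p (cnj \<zeta>)"
proof -
  have "map_poly cnj (cp p) = cp p" by (simp add: poly_eq_iff coeff_map_poly)
  then show ?thesis unfolding cpoly_def by (metis poly_cnj)
qed

lemma dvd_mult_linear_power:
  fixes p q :: "complex poly"
  assumes "[:-a, 1:] ^ k dvd p * q" "poly p a \<noteq> 0"
  shows "[:-a, 1:] ^ k dvd q"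
proof (cases "q = 0")
  case False
  with assms have "p * q \<noteq> 0" by auto
  moreover from assms(2) have "order a p = 0" by (simp add: order_0I)
  ultimately show ?thesis using assms(1) by (auto simp: order_divides order_mult)
qed simp

lemma prod_linear_power_dvd:
  fixes q :: "complex poly"
  assumes "finite J" "inj_on z J" "\<And>j. j \<in> J \<Longrightarrow> [:- z j, 1:] ^ \<mu> j dvd q"
  shows "(\<Prod>j\<in>J. [:- z j, 1:] ^ \<mu> j) dvd q"
  using assms
proof (induction J rule: finite_induct)
  case (insert l J)
  then obtain h where h: "q = (\<Prod>j\<in>J. [:- z j, 1:] ^ \<mu> j) * h" by (auto elim: dvdE)
  have "poly (\<Prod>j\<in>J. [:- z j, 1:] ^ \<mu> j) (z l) \<noteq> 0"
    using insert.hyps insert.prems(1) by (auto simp: poly_prod inj_on_def)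
  moreover have "[:- z l, 1:] ^ \<mu> l dvd q" using insert.prems by auto
  ultimately have "[:- z l, 1:] ^ \<mu> l dvd h" unfolding h by (metis dvd_mult_linear_power)
  then show ?case using insert.hyps by (simp add: h mult.commute mult_dvd_mono)
qed simp

lemma pcompose_power: "pcompose (p ^ k) q = pcompose p q ^ k" for p q :: "'a::comm_semiring_1 poly"
  by (induction k) (simp_all add: pcompose_mult one_pCons)

text \<open>\<open>pcompose q [:a, 1:]\<close> is q(x + a), so its coefficients are the Taylor
  coefficients of \<open>q\<close> at \<open>a\<close>. The shift moves the question to the origin,
  where divisibility by a power of x is vanishing of low coefficients.\<close>

lemma taylor_coeffs_zero_iff:
  fixes q :: "complex poly"
  shows "(\<forall>k<l. coeff (pcompose q [:a, 1:]) k = 0) \<longleftrightarrow> [:-a, 1:] ^ l dvd q"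
proof
  assume "\<forall>k<l. coeff (pcompose q [:a, 1:]) k = 0"
  then have "[:0, 1:] ^ l dvd pcompose q [:a, 1:]"
    by (simp add: monom_1_dvd_iff' monom_altdef[symmetric, of 1, simplified])
  then obtain h where "pcompose q [:a, 1:] = [:0, 1:] ^ l * h" ..
  then have "pcompose (pcompose q [:a, 1:]) [:-a, 1:] = [:-a, 1:] ^ l * pcompose h [:-a, 1:]"
    by (simp add: pcompose_mult pcompose_power pcompose_pCons)
  moreover have "pcompose (pcompose q [:a, 1:]) [:-a, 1:] = q"
    by (simp add: pcompose_assoc[symmetric] pcompose_pCons)
  ultimately show "[:-a, 1:] ^ l dvd q" by simp
next
  assume "[:-a, 1:] ^ l dvd q"
  then obtain h where "q = [:-a, 1:] ^ l * h" ..
  then have "pcompose q [:a, 1:] = [:0, 1:] ^ l * pcompose h [:a, 1:]"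
    by (simp add: pcompose_mult pcompose_power pcompose_pCons)
  then have "monom 1 l dvd pcompose q [:a, 1:]"
    by (simp add: monom_altdef)
  then show "\<forall>k<l. coeff (pcompose q [:a, 1:]) k = 0" by (simp add: monom_1_dvd_iff')
qed

lemma taylor_coeff_cnj:
  "coeff (pcompose (map_poly cnj q) [:cnj a, 1:]) k = cnj (coeff (pcompose q [:a, 1:]) k)"
proof -
  have "pcompose (map_poly cnj q) [:cnj a, 1:] = map_poly cnj (pcompose q [:a, 1:])"
    by (subst poly_eq_poly_eq_iff[symmetric]) (simp add: fun_eq_iff poly_pcompose)
  then show ?thesis by (simp add: coeff_map_poly)
qed

text \<open>Conjugate reversal with respect to a nominal degree \<open>n\<close>, which may exceed
  the actual one. On the circle it turns the conjugate of a polynomial into a polynomial, up to the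
  factor \<open>\<zeta> ^ n\<close>.\<close>

definition reverse_poly :: "nat \<Rightarrow> complex poly \<Rightarrow> complex poly" where
  "reverse_poly n p = (\<Sum>k\<le>n. monom (cnj (coeff p k)) (n - k))"

lemma poly_altdef_le: "degree p \<le> n \<Longrightarrow> poly p x = (\<Sum>k\<le>n. coeff p k * x ^ k)"
  for p :: "'a::comm_semiring_1 poly"
  unfolding poly_altdef by (rule sum.mono_neutral_left) (auto simp: coeff_eq_0)

lemma poly_reverse_poly:
  assumes "degree p \<le> n" "\<zeta> \<noteq> 0"
  shows "poly (reverse_poly n p) \<zeta> = \<zeta> ^ n * cnj (poly p (inverse (cnj \<zeta>)))"
  using assms
  by (auto simp: reverse_poly_def poly_sum poly_monom poly_altdef_le[OF assms(1)] sum_distrib_left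
      power_diff field_simps intro!: sum.cong)

lemma circle_reverse_poly:
  assumes "degree p \<le> n" "\<zeta> \<in> circle"
  shows "poly (reverse_poly n p) \<zeta> = \<zeta> ^ n * cnj (poly p \<zeta>)"
  using poly_reverse_poly[OF assms(1) circle_nonzero[OF assms(2)]] circle_inverse[of "cnj \<zeta>"] assms(2)
  by simp

lemma infinite_circle: "infinite circle"
proof
  assume "finite circle"
  moreover have "connected circle" by (intro connected_sphere) simp
  ultimately have "circle = {} \<or> (\<exists>a. circle = {a})" using connected_finite_iff_sing by blast
  moreover have "1 \<in> circle" "-1 \<in> circle" by auto
  ultimately show False by (metis empty_iff singletonD one_neq_neg_one)
qed

lemma poly_eq_on_circle:
  fixes p q :: "complex poly"
  assumes "\<And>\<zeta>. \<zeta> \<in> circle \<Longrightarrow> poly p \<zeta> = poly q \<zeta>"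
  shows "p = q"
proof (rule ccontr)
  assume "p \<noteq> q"
  then have "finite {\<zeta>. poly (p - q) \<zeta> = 0}" by (intro poly_roots_finite) simp
  moreover have "circle \<subseteq> {\<zeta>. poly (p - q) \<zeta> = 0}" using assms by auto
  ultimately show False using infinite_circle finite_subset by blast
qed

lemma continuous_cpoly [continuous_intros]: "continuous_on A (\<lambda>x. cpoly p x)"
  unfolding cpoly_def by (intro continuous_intros)

lemma holomorphic_poly [holomorphic_intros]: "(\<lambda>x. poly p x) holomorphic_on A"
  unfolding poly_altdef by (intro holomorphic_intros)

lemma holomorphic_cpoly [holomorphic_intros]: "(\<lambda>x. cpoly p x) holomorphic_on A"
  unfolding cpoly_def by (intro holomorphic_intros)

lemma cpoly_zero [simp]: "cpoly 0 \<zeta> = 0" by (simp add: cpoly_def)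

lemma cpoly_sum: "cpoly (\<Sum>i\<in>I. f i) \<zeta> = (\<Sum>i\<in>I. cpoly (f i) \<zeta>)"
  by (induction I rule: infinite_finite_induct) (simp_all add: cpoly_def cp_add)

lemma cpoly_monom: "cpoly (monom c k) \<zeta> = of_real c * \<zeta> ^ k"
  by (simp add: cpoly_def cp_monom poly_monom)

lemma cpoly_mult: "cpoly (p * q) \<zeta> = cpoly p \<zeta> * cpoly q \<zeta>"
  by (simp add: cpoly_def cp_mult)

lemma cpoly_add: "cpoly (p + q) \<zeta> = cpoly p \<zeta> + cpoly q \<zeta>"
  by (simp add: cpoly_def cp_add)

lemma coeff_reverse_poly: "k \<le> N \<Longrightarrow> coeff (reverse_poly N p) (N - k) = cnj (coeff p k)"
proof -
  assume k: "k \<le> N"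
  have "coeff (reverse_poly N p) (N - k) = (\<Sum>l\<le>N. if N - l = N - k then cnj (coeff p l) else 0)"
    by (simp add: reverse_poly_def coeff_sum)
  also have "\<dots> = (\<Sum>l\<le>N. if l = k then cnj (coeff p l) else 0)"
    using k by (intro sum.cong) auto
  also have "\<dots> = cnj (coeff p k)" using k by simp
  finally show ?thesis .
qed

section \<open>Index set, Hermite data and the nodal polynomial\<close>

locale pick_data =
  fixes m n :: nat and z :: "nat \<Rightarrow> complex" and \<mu> :: "nat \<Rightarrow> nat"
    and idx :: "'i::finite \<Rightarrow> nat \<times> nat"
  assumes z_0: "z 0 = 0"
    and z_inj: "inj_on z {..m}"
    and z_disc: "\<And>j. j \<le> m \<Longrightarrow> cmod (z j) < 1"
    and \<mu>_pos: "\<And>j. j \<le> m \<Longrightarrow> 1 \<le> \<mu> j"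
    and z_conj: "\<And>j. j \<le> m \<Longrightarrow> \<exists>j'\<le>m. z j' = cnj (z j) \<and> \<mu> j' = \<mu> j"
    and n_eq: "n = (\<Sum>j\<le>m. \<mu> j) - 1"
    and idx_bij: "bij_betw idx UNIV (index_set m \<mu>)"
begin

definition node :: "'i \<Rightarrow> complex" where "node i = z (fst (idx i))"

definition ordr :: "'i \<Rightarrow> nat" where "ordr i = snd (idx i)"

definition rank :: "'i \<Rightarrow> nat" where "rank i = pos \<mu> (idx i)"

text \<open>Since its rank is 0, this position carries both the normalized datum \<open>w_00\<close>
  and the leading coefficient of a monic polynomial, which is the constant term of its
  reversal.\<close>

definition i0 :: 'i where "i0 = inv idx (0, 0)"

lemma sum_\<mu>: "(\<Sum>j\<le>m. \<mu> j) = Suc n"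
proof -
  have "1 \<le> \<mu> 0" using \<mu>_pos by simp
  also have "\<mu> 0 \<le> (\<Sum>j\<le>m. \<mu> j)" by (rule member_le_sum) auto
  finally show ?thesis using n_eq by simp
qed

lemma idx_in: "fst (idx i) \<le> m" "ordr i < \<mu> (fst (idx i))"
proof -
  have "idx i \<in> index_set m \<mu>" using idx_bij by (auto simp: bij_betw_def)
  then show "fst (idx i) \<le> m" "ordr i < \<mu> (fst (idx i))"
    by (auto simp: index_set_def ordr_def)
qed

lemma idx_inj: "idx i = idx i' \<longleftrightarrow> i = i'"
  using idx_bij by (auto simp: bij_betw_def inj_on_def)

lemma idx_inv: "j \<le> m \<Longrightarrow> k < \<mu> j \<Longrightarrow> idx (inv idx (j, k)) = (j, k)"
  using idx_bij by (auto simp: bij_betw_def index_set_def intro!: f_inv_into_f)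

lemma inv_idx: "inv idx (idx i) = i"
  using idx_bij by (simp add: bij_betw_def)

lemma idx_i0 [simp]: "idx i0 = (0, 0)"
  unfolding i0_def using \<mu>_pos[of 0] by (intro idx_inv) auto

lemma norm_node: "cmod (node i) < 1"
  using z_disc idx_in by (simp add: node_def)

text \<open>Blocks occupy consecutive intervals of positions, which gives injectivity; surjectivity
  onto \<open>{..n}\<close> is a count of elements.\<close>

lemma rank_bij: "bij_betw rank UNIV {..n}"
proof -
  have less: "pos \<mu> (j, k) < pos \<mu> (j', k')" if "j < j'" "k < \<mu> j" for j j' k k'
  proof -
    have "(\<Sum>l<j. \<mu> l) + k < (\<Sum>l<Suc j. \<mu> l)" using that by simp
    also have "\<dots> \<le> (\<Sum>l<j'. \<mu> l)" using that by (intro sum_mono2) auto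
    finally show ?thesis by simp
  qed
  have "inj rank"
  proof (rule injI)
    fix i i' assume eq: "rank i = rank i'"
    obtain j k j' k' where jk: "idx i = (j, k)" "idx i' = (j', k')" by (metis surj_pair)
    then have "k < \<mu> j" "k' < \<mu> j'" using idx_in(2)[of i] idx_in(2)[of i'] by (auto simp: ordr_def)
    with less[of j j' k k'] less[of j' j k' k] eq have "j = j'"
      unfolding rank_def jk by (metis linorder_neqE_nat less_irrefl)
    with eq have "idx i = idx i'" by (simp add: rank_def jk)
    then show "i = i'" by (simp add: idx_inj)
  qed
  moreover have "range rank \<subseteq> {..n}"
  proof (rule image_subsetI)
    fix i
    obtain j k where jk: "idx i = (j, k)" by (metis surj_pair)
    then have "j \<le> m" "k < \<mu> j" using idx_in[of i] by (auto simp: ordr_def)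
    then have "rank i < (\<Sum>l<Suc m. \<mu> l)"
      using less[of j "Suc m" k 0] by (simp add: rank_def jk)
    then show "rank i \<in> {..n}" using sum_\<mu> by (simp add: lessThan_Suc_atMost)
  qed
  moreover have "card (UNIV :: 'i set) = Suc n"
    using bij_betw_same_card[OF idx_bij] sum_\<mu> by (simp add: index_set_def)
  ultimately show ?thesis
    by (metis bij_betw_def card_atMost card_image card_subset_eq finite_atMost)
qed

lemma rank_le: "rank i \<le> n" using rank_bij by (auto simp: bij_betw_def)

lemma rank_eq_iff [simp]: "rank i = rank i' \<longleftrightarrow> i = i'"
  using rank_bij by (auto simp: bij_betw_def inj_on_def)

lemma rank_surj: "k \<le> n \<Longrightarrow> \<exists>i. rank i = k"
  by (metis rank_bij atMost_iff bij_betw_def imageE)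

lemma rank_i0 [simp]: "rank i0 = 0" by (simp add: rank_def)

text \<open>Ascending coefficients: for the coefficient vector of a monic polynomial this is the
  reversal, that is, the polynomial in the disc variable. The polynomial itself is
  \<open>rpoly\<close> below.\<close>

definition vpoly :: "'b::comm_ring_1 ^ 'i \<Rightarrow> 'b poly" where
  "vpoly u = (\<Sum>i\<in>UNIV. monom (u $ i) (rank i))"

lemma coeff_vpoly [simp]: "coeff (vpoly u) (rank i) = u $ i"
  by (simp add: vpoly_def coeff_sum if_distrib cong: if_cong)

lemma degree_vpoly: "degree (vpoly u) \<le> n"
  unfolding vpoly_def by (intro degree_sum_le) (auto intro: order_trans[OF degree_monom_le] rank_le)

lemma vpoly_coeffs: "degree p \<le> n \<Longrightarrow> vpoly (\<chi> i. coeff p (rank i)) = p"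
proof (rule poly_eqI)
  fix k assume p: "degree p \<le> n"
  show "coeff (vpoly (\<chi> i. coeff p (rank i))) k = coeff p k"
  proof (cases "k \<le> n")
    case True
    then obtain i where "rank i = k" using rank_surj by blast
    then show ?thesis by auto
  next
    case False
    then show ?thesis using p degree_vpoly by (metis coeff_eq_0 leI order_le_less_trans)
  qed
qed

lemma vpoly_eq_iff [simp]: "vpoly u = vpoly v \<longleftrightarrow> u = v"
  by (metis coeff_vpoly vec_eq_iff)

lemma vpoly_0 [simp]: "vpoly 0 = 0" by (simp add: vpoly_def)

lemma vpoly_eq_0_iff [simp]: "vpoly u = 0 \<longleftrightarrow> u = 0"
  by (metis vpoly_0 vpoly_eq_iff)

lemma vpoly_add: "vpoly (u + v) = vpoly u + vpoly v"
  by (simp add: vpoly_def add_monom[symmetric] sum.distrib)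

lemma vpoly_scaleR: "vpoly (c *\<^sub>R u) = smult c (vpoly u)"
  by (simp add: vpoly_def poly_eq_iff coeff_sum sum_distrib_left if_distrib cong: if_cong)

lemma vpoly_scaleR_complex: "vpoly (c *\<^sub>R u) = smult (of_real c) (vpoly u)" for u :: "complex ^ 'i"

  by (simp add: vpoly_def poly_eq_iff coeff_sum sum_distrib_left if_distrib
      scaleR_conv_of_real[where 'a = complex] cong: if_cong)

definition hdata :: "complex poly \<Rightarrow> complex ^ 'i" where
  "hdata q = (\<chi> i. coeff (pcompose q [:node i, 1:]) (ordr i))"

definition nodal :: "complex poly" where
  "nodal = (\<Prod>j\<le>m. [:- z j, 1:] ^ \<mu> j)"

lemma degree_nodal: "degree nodal = Suc n"
  unfolding nodal_def sum_\<mu>[symmetric]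
  by (subst degree_prod_eq_sum_degree) (auto simp: degree_linear_power)

lemma hdata_add: "hdata (p + q) = hdata p + hdata q"
  by (simp add: hdata_def vec_eq_iff pcompose_add)

lemma hdata_diff: "hdata (p - q) = hdata p - hdata q"
  by (simp add: hdata_def vec_eq_iff pcompose_diff)

lemma hdata_smult: "hdata (smult (of_real c) p) = c *\<^sub>R hdata p"
  by (simp add: hdata_def vec_eq_iff pcompose_smult scaleR_conv_of_real[where 'a = complex])

lemma hdata_eq_0_iff: "hdata q = 0 \<longleftrightarrow> nodal dvd q"
proof -
  have "hdata q = 0 \<longleftrightarrow> (\<forall>j\<le>m. \<forall>k<\<mu> j. coeff (pcompose q [:z j, 1:]) k = 0)"
    (is "_ \<longleftrightarrow> ?R")
  proof
    assume *: "hdata q = 0"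
    show ?R
    proof safe
      fix j k assume "j \<le> m" "k < \<mu> j"
      then show "coeff (pcompose q [:z j, 1:]) k = 0"
        using * idx_inv[of j k] unfolding hdata_def vec_eq_iff
        by (auto simp: node_def ordr_def dest: spec[of _ "inv idx (j, k)"])
    qed
  next
    assume ?R then show "hdata q = 0"
      using idx_in by (auto simp: hdata_def vec_eq_iff node_def)
  qed
  also have "\<dots> \<longleftrightarrow> (\<forall>j\<le>m. [:- z j, 1:] ^ \<mu> j dvd q)" by (simp add: taylor_coeffs_zero_iff)
  also have "\<dots> \<longleftrightarrow> nodal dvd q"
  proof (intro iffI allI impI)
    assume "\<forall>j\<le>m. [:- z j, 1:] ^ \<mu> j dvd q"
    then show "nodal dvd q" unfolding nodal_def by (intro prod_linear_power_dvd z_inj) auto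
  next
    fix j assume "nodal dvd q" "j \<le> m"
    moreover from this have "[:- z j, 1:] ^ \<mu> j dvd nodal" unfolding nodal_def by (intro dvd_prodI) auto
    ultimately show "[:- z j, 1:] ^ \<mu> j dvd q" using dvd_trans by blast
  qed
  finally show ?thesis .
qed

lemma hdata_inj: "degree q \<le> n \<Longrightarrow> hdata q = 0 \<Longrightarrow> q = 0"
  using dvd_imp_degree_le[of nodal q] degree_nodal by (auto simp: hdata_eq_0_iff)

text \<open>Hermite interpolation by dimension count: polynomials of degree at most \<open>n\<close>
  and data vectors have the same dimension, and a polynomial with zero data is divisible by
  \<open>nodal\<close>, of degree \<open>n + 1\<close>.\<close>

lemma hermite_surj: obtains c :: "complex ^ 'i" where "hdata (vpoly c) = w"
proof -
  have lin: "linear (\<lambda>c :: complex ^ 'i. hdata (vpoly c))"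
    by (intro linearI) (simp_all add: vpoly_add hdata_add vpoly_scaleR_complex hdata_smult)
  moreover have "inj (\<lambda>c :: complex ^ 'i. hdata (vpoly c))"
    using hdata_inj[OF degree_vpoly] by (subst linear_injective_0[OF lin]) (metis vpoly_eq_iff vpoly_0)
  ultimately have "surj (\<lambda>c :: complex ^ 'i. hdata (vpoly c))"
    by (rule linear_injective_imp_surjective) simp
  then show ?thesis using that by (metis surjD)
qed

definition vdata :: "real ^ 'i \<Rightarrow> complex ^ 'i" where
  "vdata u = hdata (cp (vpoly u))"

lemma linear_vdata: "linear vdata"
  unfolding vdata_def
  by (intro linearI) (simp_all add: vpoly_add cp_add hdata_add vpoly_scaleR cp_smult hdata_smult)

lemma inj_vdata: "inj vdata"
proof (subst linear_injective_0[OF linear_vdata], safe)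
  fix u assume "vdata u = 0"
  then have "cp (vpoly u) = 0" unfolding vdata_def
    using hdata_inj[of "cp (vpoly u)"] degree_vpoly[of u] by simp
  then show "u = 0" by simp
qed

text \<open>A linear left inverse on the whole complex space, not only on the conjugate-symmetric
  data: it carries smooth maps over to open subsets of the ambient space, as
  \<open>smooth_map\<close> requires.\<close>

definition vdata_inv :: "complex ^ 'i \<Rightarrow> real ^ 'i" where
  "vdata_inv = (SOME g. linear g \<and> g \<circ> vdata = id)"

lemma vdata_inv: "linear vdata_inv" "vdata_inv (vdata u) = u"
proof -
  have "linear vdata_inv \<and> vdata_inv \<circ> vdata = id"
    unfolding vdata_inv_def
    using someI_ex[OF linear_injective_left_inverse[OF linear_vdata inj_vdata]] by auto
  then show "linear vdata_inv" "vdata_inv (vdata u) = u" by (auto simp: fun_eq_iff)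
qed

definition conj_sym :: "complex ^ 'i \<Rightarrow> bool" where
  "conj_sym w \<longleftrightarrow> (\<forall>j\<le>m. \<forall>j'\<le>m. z j' = cnj (z j) \<longrightarrow>
     (\<forall>k<\<mu> j. entry idx w j' k = cnj (entry idx w j k)))"

lemma entry_hdata:
  "j \<le> m \<Longrightarrow> k < \<mu> j \<Longrightarrow> entry idx (hdata q) j k = coeff (pcompose q [:z j, 1:]) k"
  by (simp add: entry_def hdata_def node_def ordr_def idx_inv)

lemma \<mu>_conj: "j \<le> m \<Longrightarrow> j' \<le> m \<Longrightarrow> z j' = cnj (z j) \<Longrightarrow> \<mu> j' = \<mu> j"
proof -
  assume *: "j \<le> m" "j' \<le> m" "z j' = cnj (z j)"
  obtain l where l: "l \<le> m" "z l = cnj (z j)" "\<mu> l = \<mu> j" using z_conj[OF *(1)] by blast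
  then have "l = j'" using * by (intro inj_onD[OF z_inj]) auto
  with l show ?thesis by simp
qed

lemma conj_sym_hdata_cp: "conj_sym (hdata (cp p))"
  unfolding conj_sym_def
proof (intro allI impI)
  fix j j' k assume *: "j \<le> m" "j' \<le> m" "z j' = cnj (z j)" "k < \<mu> j"
  have "map_poly cnj (cp p) = cp p" by (simp add: poly_eq_iff coeff_map_poly)
  then have "coeff (pcompose (cp p) [:z j', 1:]) k = cnj (coeff (pcompose (cp p) [:z j, 1:]) k)"
    using taylor_coeff_cnj[of "cp p" "z j" k] unfolding *(3) by (simp only:)
  moreover have "k < \<mu> j'" using *(4) \<mu>_conj[OF *(1-3)] by (simp only:)
  ultimately show "entry idx (hdata (cp p)) j' k = cnj (entry idx (hdata (cp p)) j k)"
    by (simp only: entry_hdata[OF *(1,4)] entry_hdata[OF *(2)])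
qed

lemma vec_eq_entryI:
  assumes "\<And>j k. j \<le> m \<Longrightarrow> k < \<mu> j \<Longrightarrow> entry idx v j k = entry idx w j k"
  shows "v = w"
  unfolding vec_eq_iff
proof
  fix i
  show "v $ i = w $ i"
    using assms[OF idx_in[of i]] unfolding entry_def ordr_def prod.collapse inv_idx .
qed

text \<open>Conjugating the coefficients of the interpolant of symmetric data gives an interpolant
  of the same data. By uniqueness the coefficients are real, so symmetric data lie in the range of
  \<open>vdata\<close>.\<close>

lemma vdata_vdata_inv:
  assumes w: "conj_sym w" shows "vdata (vdata_inv w) = w"
proof -
  obtain c where c: "hdata (vpoly c) = w" using hermite_surj .
  define c' :: "complex ^ 'i" where "c' = (\<chi> i. cnj (c $ i))"
  have c': "vpoly c' = map_poly cnj (vpoly c)"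
    by (simp add: vpoly_def c'_def poly_eq_iff coeff_map_poly coeff_sum if_distrib cong: if_cong)
  have "hdata (vpoly c') = w"
  proof (rule vec_eq_entryI)
    fix j k assume jk: "j \<le> m" "k < \<mu> j"
    obtain j' where j': "j' \<le> m" "z j' = cnj (z j)" "\<mu> j' = \<mu> j" using z_conj[OF jk(1)] by blast
    have "entry idx (hdata (vpoly c')) j k = coeff (pcompose (map_poly cnj (vpoly c)) [:cnj (z j'), 1:]) k"
      using jk j' by (simp add: entry_hdata c')
    also have "\<dots> = cnj (entry idx w j' k)"
      using j' jk by (subst taylor_coeff_cnj) (simp add: c[symmetric] entry_hdata)
    also have "entry idx w j' k = cnj (entry idx w j k)"
      using w j' jk unfolding conj_sym_def by blast
    also have "cnj (cnj (entry idx w j k)) = entry idx w j k" by simp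
    finally show "entry idx (hdata (vpoly c')) j k = entry idx w j k" .
  qed
  then have "hdata (vpoly c' - vpoly c) = 0" by (simp add: hdata_diff c)
  then have "vpoly c' - vpoly c = 0"
    using degree_vpoly by (intro hdata_inj degree_diff_le) auto
  then have "c' = c" by simp
  then have "cnj (c $ i) = c $ i" for i
    by (simp add: c'_def vec_eq_iff)
  then have re: "complex_of_real (Re (c $ i)) = c $ i" for i
    by (simp add: Reals_cnj_iff)
  define u :: "real ^ 'i" where "u = (\<chi> i. Re (c $ i))"
  have "cp (vpoly u) = vpoly c"
    by (simp add: vpoly_def u_def poly_eq_iff coeff_sum if_distrib re cong: if_cong)
  then have "vdata u = w" by (simp add: vdata_def c)
  then show ?thesis using vdata_inv(2) by metis
qed

end

section \<open>The generalized Pick matrix\<close>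

text \<open>The Cauchy kernel for the \<open>k\<close>-th Taylor coefficient at \<open>a\<close>:
  the mean of \<open>q * cker a k\<close> over the circle is that coefficient of the polynomial
  \<open>q\<close>.\<close>

definition cker :: "complex \<Rightarrow> nat \<Rightarrow> complex \<Rightarrow> complex" where
  "cker a k \<zeta> = \<zeta> / (\<zeta> - a) ^ Suc k"

text \<open>The conjugate of \<open>cker\<close> on the circle, continued holomorphically to the
  disc: the Hardy space kernel that reproduces the \<open>k\<close>-th Taylor coefficient at
  \<open>a\<close>.\<close>

definition dker :: "complex \<Rightarrow> nat \<Rightarrow> complex \<Rightarrow> complex" where
  "dker a k \<zeta> = \<zeta> ^ k / (1 - cnj a * \<zeta>) ^ Suc k"

lemma one_minus_cnj_mult_nonzero: "cmod a < 1 \<Longrightarrow> \<zeta> \<in> cball 0 1 \<Longrightarrow> 1 - cnj a * \<zeta> \<noteq> 0"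
proof
  assume *: "cmod a < 1" "\<zeta> \<in> cball 0 1" "1 - cnj a * \<zeta> = 0"
  then have "1 = cmod a * cmod \<zeta>" by (metis complex_mod_cnj eq_iff_diff_eq_0 norm_mult norm_one)
  moreover have "cmod a * cmod \<zeta> \<le> cmod a * 1" using * by (intro mult_left_mono) auto
  ultimately show False using *(1) by simp
qed

lemma circle_minus_eq:
  "\<zeta> \<in> circle \<Longrightarrow> \<zeta> - a = \<zeta> * cnj (1 - cnj a * \<zeta>)"
  using circle_mult_cnj(1)[of \<zeta>] by (simp add: algebra_simps)

lemma circle_minus_nonzero: "cmod a < 1 \<Longrightarrow> \<zeta> \<in> circle \<Longrightarrow> \<zeta> - a \<noteq> 0"
  by auto

lemma holomorphic_dker [holomorphic_intros]: "cmod a < 1 \<Longrightarrow> dker a k holomorphic_on cball 0 1"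
  unfolding dker_def using one_minus_cnj_mult_nonzero[of a] by (intro holomorphic_intros) auto

lemma cnj_dker: "cmod a < 1 \<Longrightarrow> \<zeta> \<in> circle \<Longrightarrow> cnj (dker a k \<zeta>) = cker a k \<zeta>"
proof -
  assume *: "cmod a < 1" "\<zeta> \<in> circle"
  define d where "d = cnj (1 - cnj a * \<zeta>)"
  have d: "d \<noteq> 0" using one_minus_cnj_mult_nonzero[of a \<zeta>] * unfolding d_def complex_cnj_zero_iff by auto
  have "cnj \<zeta> ^ k * \<zeta> ^ k = 1" using circle_mult_cnj(2)[OF *(2)] by (simp flip: power_mult_distrib)
  then have "cnj \<zeta> ^ k / d ^ Suc k = \<zeta> / (\<zeta> * d) ^ Suc k"
    using d circle_nonzero[OF *(2)] by (simp add: field_simps power_mult_distrib)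
  then show ?thesis
    unfolding cker_def dker_def circle_minus_eq[OF *(2), of a] d_def[symmetric]
    by (simp add: d_def)
qed

lemma continuous_cker [continuous_intros]: "cmod a < 1 \<Longrightarrow> continuous_on circle (cker a k)"
  unfolding cker_def using circle_minus_nonzero[of a] by (intro continuous_intros) auto

lemma cmean_cker: "cmod a < 1 \<Longrightarrow> cmean (cker a k) = (if k = 0 then 1 else 0)"
proof -
  assume a: "cmod a < 1"
  have "cmean (cker a k) = cmean (\<lambda>\<zeta>. cnj (dker a k \<zeta>))"
    by (rule cmean_cong) (simp only: cnj_dker[OF a])
  also have "\<dots> = cnj (dker a k 0)"
    by (subst cmean_cnj) (simp_all add: cmean_holomorphic holomorphic_dker a
        holomorphic_cball_continuous_circle)
  finally show ?thesis by (simp add: dker_def)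
qed

lemma taylor_remainder:
  fixes q :: "complex poly"
  obtains h where "\<And>x. poly q x = (\<Sum>l\<le>k. coeff (pcompose q [:a, 1:]) l * (x - a) ^ l)
      + (x - a) ^ Suc k * poly h x"
proof -
  define t where "t = (\<Sum>l\<le>k. smult (coeff (pcompose q [:a, 1:]) l) ([:-a, 1:] ^ l))"
  have sm: "pcompose (sum f A) r = (\<Sum>x\<in>A. pcompose (f x) r)"
    for f :: "nat \<Rightarrow> complex poly" and A r by (rule pcompose_sum)
  have "pcompose t [:a, 1:] = (\<Sum>l\<le>k. monom (coeff (pcompose q [:a, 1:]) l) l)"
    unfolding t_def sm
    by (intro sum.cong refl) (simp add: pcompose_smult pcompose_power pcompose_pCons monom_altdef)
  then have "\<forall>l<Suc k. coeff (pcompose (q - t) [:a, 1:]) l = 0"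
    by (simp add: pcompose_diff coeff_sum less_Suc_eq_le)
  then have "[:-a, 1:] ^ Suc k dvd q - t" using taylor_coeffs_zero_iff by blast
  then obtain h where "q - t = [:-a, 1:] ^ Suc k * h" ..
  then have "q = t + [:-a, 1:] ^ Suc k * h" by (simp add: algebra_simps)
  then have "poly q x = (\<Sum>l\<le>k. coeff (pcompose q [:a, 1:]) l * (x - a) ^ l)
      + (x - a) ^ Suc k * poly h x" for x
  proof -
    have "poly q x = poly t x + poly ([:-a, 1:] ^ Suc k) x * poly h x"
      by (metis \<open>q = t + [:-a, 1:] ^ Suc k * h\<close> poly_add poly_mult)
    then show ?thesis by (simp add: t_def poly_sum del: power_Suc)
  qed
  then show ?thesis by (rule that)
qed

text \<open>Multiplication by \<open>q\<close> acts on the kernels at \<open>a\<close> through the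
  lower triangular Toeplitz matrix of Taylor coefficients, the shape of a block of
  \<open>W_mat\<close>. The remainder keeps its factor \<open>\<zeta>\<close> so that its mean
  against holomorphic functions is 0.\<close>

lemma poly_mult_cker:
  assumes "cmod a < 1"
  obtains h where "\<And>\<zeta>. \<zeta> \<in> circle \<Longrightarrow> poly q \<zeta> * cker a k \<zeta> =
    (\<Sum>l\<le>k. coeff (pcompose q [:a, 1:]) (k - l) * cker a l \<zeta>) + \<zeta> * poly h \<zeta>"
proof -
  obtain h where h: "\<And>x. poly q x = (\<Sum>l\<le>k. coeff (pcompose q [:a, 1:]) l * (x - a) ^ l)
      + (x - a) ^ Suc k * poly h x" using taylor_remainder by blast
  show ?thesis
  proof (rule that)
    fix \<zeta> assume "\<zeta> \<in> circle"
    then have nz: "\<zeta> - a \<noteq> 0" using circle_minus_nonzero assms by blast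
    have "poly q \<zeta> * cker a k \<zeta> =
      (\<Sum>l\<le>k. coeff (pcompose q [:a, 1:]) l * ((\<zeta> - a) ^ l * cker a k \<zeta>)) + \<zeta> * poly h \<zeta>"
    proof -
      have "(\<zeta> - a) ^ Suc k * cker a k \<zeta> = \<zeta>" using nz by (simp add: cker_def)
      then have "((\<zeta> - a) ^ Suc k * poly h \<zeta>) * cker a k \<zeta> = \<zeta> * poly h \<zeta>"
        by (metis mult.assoc mult.commute)
      then show ?thesis
        unfolding h distrib_right sum_distrib_right by (simp only: mult.assoc)
    qed
    also have "(\<Sum>l\<le>k. coeff (pcompose q [:a, 1:]) l * ((\<zeta> - a) ^ l * cker a k \<zeta>)) =
      (\<Sum>l\<le>k. coeff (pcompose q [:a, 1:]) (k - l) * ((\<zeta> - a) ^ (k - l) * cker a k \<zeta>))"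
      by (rule sum.reindex_bij_witness[of _ "\<lambda>l. k - l" "\<lambda>l. k - l"]) auto
    also have "\<dots> = (\<Sum>l\<le>k. coeff (pcompose q [:a, 1:]) (k - l) * cker a l \<zeta>)"
    proof (rule sum.cong)
      fix l assume "l \<in> {..k}"
      then have "Suc k = (k - l) + Suc l" by simp
      then have "(\<zeta> - a) ^ Suc k = (\<zeta> - a) ^ (k - l) * (\<zeta> - a) ^ Suc l" by (metis power_add)
      then show "coeff (pcompose q [:a, 1:]) (k - l) * ((\<zeta> - a) ^ (k - l) * cker a k \<zeta>) =
          coeff (pcompose q [:a, 1:]) (k - l) * cker a l \<zeta>"
        unfolding cker_def using nz by simp
    qed simp
    finally show "poly q \<zeta> * cker a k \<zeta> =
      (\<Sum>l\<le>k. coeff (pcompose q [:a, 1:]) (k - l) * cker a l \<zeta>) + \<zeta> * poly h \<zeta>" .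
  qed
qed

section \<open>Quotients over \<open>tau\<close>, the Stein equation and the Pick form\<close>

context pick_data
begin

definition tau_poly :: "complex poly" where
  "tau_poly = (\<Prod>j\<le>m. [:1, - cnj (z j):] ^ \<mu> j)"

abbreviation tau :: "complex \<Rightarrow> complex" where "tau \<zeta> \<equiv> poly tau_poly \<zeta>"

lemma tau_eq: "tau \<zeta> = (\<Prod>j\<le>m. (1 - cnj (z j) * \<zeta>) ^ \<mu> j)"
  by (simp add: tau_poly_def poly_prod mult.commute)

lemma tau_nonzero: "\<zeta> \<in> cball 0 1 \<Longrightarrow> tau \<zeta> \<noteq> 0"
  unfolding tau_eq using one_minus_cnj_mult_nonzero z_disc by auto

lemma nodal_circle: "\<zeta> \<in> circle \<Longrightarrow> poly nodal \<zeta> = \<zeta> ^ Suc n * cnj (tau \<zeta>)"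
proof -
  assume *: "\<zeta> \<in> circle"
  have "poly nodal \<zeta> = (\<Prod>j\<le>m. (\<zeta> - z j) ^ \<mu> j)"
    by (simp add: nodal_def poly_prod)
  also have "\<dots> = (\<Prod>j\<le>m. \<zeta> ^ \<mu> j * cnj (1 - cnj (z j) * \<zeta>) ^ \<mu> j)"
    unfolding circle_minus_eq[OF *] power_mult_distrib ..
  also have "\<dots> = \<zeta> ^ Suc n * cnj (tau \<zeta>)"
    unfolding tau_eq prod.distrib sum_\<mu>[symmetric] power_sum by simp
  finally show ?thesis .
qed

text \<open>On the circle, \<open>cnj (G / tau)\<close> is \<open>\<zeta>\<close> times a polynomial divided by \<open>nodal\<close>,
  so the integrand is holomorphic in the disc and vanishes at 0.\<close>

lemma cmean_nodal_orthogonal: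
  assumes f: "f holomorphic_on cball 0 1" and G: "degree G \<le> n"
  shows "cmean (\<lambda>\<zeta>. poly nodal \<zeta> * f \<zeta> * cnj (poly G \<zeta> / tau \<zeta>)) = 0"
proof -
  have "cmean (\<lambda>\<zeta>. poly nodal \<zeta> * f \<zeta> * cnj (poly G \<zeta> / tau \<zeta>)) =
      cmean (\<lambda>\<zeta>. \<zeta> * f \<zeta> * poly (reverse_poly n G) \<zeta>)"
  proof (rule cmean_cong)
    fix \<zeta> assume "\<zeta> \<in> circle"
    then show "poly nodal \<zeta> * f \<zeta> * cnj (poly G \<zeta> / tau \<zeta>) = \<zeta> * f \<zeta> * poly (reverse_poly n G) \<zeta>"
      using tau_nonzero[of \<zeta>] by (simp add: nodal_circle circle_reverse_poly[OF G])
  qed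
  also have "\<dots> = 0" using f by (subst cmean_holomorphic) (auto intro!: holomorphic_intros)
  finally show ?thesis .
qed

text \<open>Vectors on which the Pick matrix acts are read as coefficients with respect to the
  kernels \<open>dker\<close>. The span of these kernels is the space of quotients
  \<open>G / tau\<close> with \<open>degree G \<le> n\<close>, by \<open>gen_eq\<close> and
  \<open>gen_surj\<close>.\<close>

definition gen :: "complex ^ 'i \<Rightarrow> complex \<Rightarrow> complex" where
  "gen v \<zeta> = (\<Sum>i\<in>UNIV. v $ i * dker (node i) (ordr i) \<zeta>)"

lemma holomorphic_gen: "gen v holomorphic_on cball 0 1"
  unfolding gen_def by (intro holomorphic_intros norm_node)

lemma cnj_gen: "\<zeta> \<in> circle \<Longrightarrow> cnj (gen v \<zeta>) = (\<Sum>i\<in>UNIV. cnj (v $ i) * cker (node i) (ordr i) \<zeta>)"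
  by (simp add: gen_def cnj_dker norm_node)

lemma cmean_poly_cker:
  "cmean (\<lambda>\<zeta>. poly q \<zeta> * cker (node i) (ordr i) \<zeta>) = hdata q $ i"
proof -
  define a k where "a = node i" and "k = ordr i"
  have a: "cmod a < 1" by (simp add: a_def norm_node)
  obtain h where h: "\<And>\<zeta>. \<zeta> \<in> circle \<Longrightarrow> poly q \<zeta> * cker a k \<zeta> =
    (\<Sum>l\<le>k. coeff (pcompose q [:a, 1:]) (k - l) * cker a l \<zeta>) + \<zeta> * poly h \<zeta>"
    using poly_mult_cker[OF a] by blast
  have "cmean (\<lambda>\<zeta>. poly q \<zeta> * cker a k \<zeta>) =
    cmean (\<lambda>\<zeta>. (\<Sum>l\<le>k. coeff (pcompose q [:a, 1:]) (k - l) * cker a l \<zeta>) + \<zeta> * poly h \<zeta>)"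
    by (rule cmean_cong) (rule h)
  also have "\<dots> = (\<Sum>l\<le>k. cmean (\<lambda>\<zeta>. coeff (pcompose q [:a, 1:]) (k - l) * cker a l \<zeta>))
      + cmean (\<lambda>\<zeta>. \<zeta> * poly h \<zeta>)"
    by (subst cmean_add, (intro continuous_intros a)+, subst cmean_sum)
      (auto intro!: continuous_intros a)
  also have "cmean (\<lambda>\<zeta>. \<zeta> * poly h \<zeta>) = 0"
    by (subst cmean_holomorphic) (auto intro!: holomorphic_intros)
  also have "(\<Sum>l\<le>k. cmean (\<lambda>\<zeta>. coeff (pcompose q [:a, 1:]) (k - l) * cker a l \<zeta>)) =
      (\<Sum>l\<le>k. coeff (pcompose q [:a, 1:]) (k - l) * (if l = 0 then 1 else 0))"
    by (intro sum.cong refl, subst cmean_mult_left) (simp_all add: cmean_cker a continuous_cker)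
  also have "\<dots> = coeff (pcompose q [:a, 1:]) k" by (simp add: if_distrib cong: if_cong)
  finally show ?thesis by (simp add: hdata_def a_def k_def)
qed

text \<open>Linear independence of the kernels: pairing \<open>gen v\<close> with a polynomial whose
  Hermite data are \<open>v\<close> itself produces the squared norm of \<open>v\<close>.\<close>

lemma gen_eq_0:
  assumes "\<And>\<zeta>. \<zeta> \<in> circle \<Longrightarrow> gen v \<zeta> = 0"
  shows "v = 0"
proof -
  obtain c where c: "hdata (vpoly c) = v" using hermite_surj .
  let ?q = "vpoly c"
  have "(\<Sum>i\<in>UNIV. cnj (v $ i) * hdata ?q $ i) =
      (\<Sum>i\<in>UNIV. cmean (\<lambda>\<zeta>. cnj (v $ i) * (poly ?q \<zeta> * cker (node i) (ordr i) \<zeta>)))"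
    by (intro sum.cong refl, subst cmean_mult_left)
      (auto intro!: continuous_intros norm_node simp: cmean_poly_cker)
  also have "\<dots> = cmean (\<lambda>\<zeta>. \<Sum>i\<in>UNIV. cnj (v $ i) * (poly ?q \<zeta> * cker (node i) (ordr i) \<zeta>))"
    by (rule cmean_sum[symmetric]) (auto intro!: continuous_intros norm_node)
  also have "\<dots> = cmean (\<lambda>\<zeta>. poly ?q \<zeta> * cnj (gen v \<zeta>))"
    by (rule cmean_cong) (simp add: cnj_gen sum_distrib_left mult_ac)
  also have "\<dots> = cmean (\<lambda>\<zeta>. 0)"
    by (rule cmean_cong) (simp add: assms)
  finally have "(\<Sum>i\<in>UNIV. cnj (v $ i) * v $ i) = 0" by (simp add: c)
  then have "complex_of_real (\<Sum>i\<in>UNIV. (cmod (v $ i))\<^sup>2) = 0"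
    unfolding of_real_sum complex_norm_square by (simp only: mult.commute)
  then have "(\<Sum>i\<in>UNIV. (cmod (v $ i))\<^sup>2) = 0" by (simp only: of_real_eq_0_iff)
  then show "v = 0" by (simp add: sum_nonneg_eq_0_iff vec_eq_iff)
qed

text \<open>The numerator of \<open>gen v\<close> over the common denominator \<open>tau\<close>:
  each kernel contributes its own numerator times the complementary factors of
  \<open>tau\<close>.\<close>

definition gen_poly :: "complex ^ 'i \<Rightarrow> complex poly" where
  "gen_poly v = (\<Sum>i\<in>UNIV. smult (v $ i) (monom 1 (ordr i)
     * [:1, - cnj (node i):] ^ (\<mu> (fst (idx i)) - Suc (ordr i))
     * (\<Prod>l\<in>{..m} - {fst (idx i)}. [:1, - cnj (z l):] ^ \<mu> l)))"

lemma degree_gen_poly: "degree (gen_poly v) \<le> n"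
  unfolding gen_poly_def
proof (intro degree_sum_le order_trans[OF degree_smult_le])
  fix i
  let ?j = "fst (idx i)"
  have 1: "degree ([:1, - cnj c:] ^ k) \<le> k" for c k
    by (rule order_trans[OF degree_power_le]) auto
  have "degree (\<Prod>l\<in>{..m} - {?j}. [:1, - cnj (z l):] ^ \<mu> l) \<le> (\<Sum>l\<in>{..m} - {?j}. \<mu> l)"
    by (rule order_trans[OF degree_prod_sum_le]) (auto intro: sum_mono 1)
  then have "degree (monom 1 (ordr i) * [:1, - cnj (node i):] ^ (\<mu> ?j - Suc (ordr i))
     * (\<Prod>l\<in>{..m} - {?j}. [:1, - cnj (z l):] ^ \<mu> l))
     \<le> (ordr i + (\<mu> ?j - Suc (ordr i))) + (\<Sum>l\<in>{..m} - {?j}. \<mu> l)"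
    by (intro order_trans[OF degree_mult_le] add_mono degree_monom_le 1)
  also have "\<dots> \<le> n"
    using idx_in[of i] sum_\<mu> sum.remove[of "{..m}" ?j \<mu>] by simp
  finally show "degree (monom 1 (ordr i) * [:1, - cnj (node i):] ^ (\<mu> ?j - Suc (ordr i))
     * (\<Prod>l\<in>{..m} - {?j}. [:1, - cnj (z l):] ^ \<mu> l)) \<le> n" .
qed simp

lemma gen_eq: "\<zeta> \<in> cball 0 1 \<Longrightarrow> gen v \<zeta> = poly (gen_poly v) \<zeta> / tau \<zeta>"
proof -
  assume \<zeta>: "\<zeta> \<in> cball 0 1"
  have "dker (node i) (ordr i) \<zeta> * tau \<zeta> = poly (monom 1 (ordr i)
     * [:1, - cnj (node i):] ^ (\<mu> (fst (idx i)) - Suc (ordr i))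
     * (\<Prod>l\<in>{..m} - {fst (idx i)}. [:1, - cnj (z l):] ^ \<mu> l)) \<zeta>" for i
  proof -
    let ?j = "fst (idx i)" let ?d = "1 - cnj (node i) * \<zeta>"
    have d: "?d \<noteq> 0" using one_minus_cnj_mult_nonzero \<zeta> norm_node by blast
    have "tau \<zeta> = ?d ^ \<mu> ?j * (\<Prod>l\<in>{..m} - {?j}. (1 - cnj (z l) * \<zeta>) ^ \<mu> l)"
      unfolding tau_eq node_def using idx_in(1)[of i] by (intro prod.remove) auto
    moreover have "\<mu> ?j = Suc (ordr i) + (\<mu> ?j - Suc (ordr i))" using idx_in(2)[of i] by simp
    then have "?d ^ \<mu> ?j = ?d ^ Suc (ordr i) * ?d ^ (\<mu> ?j - Suc (ordr i))" by (metis power_add)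
    ultimately show ?thesis
      using d by (simp add: dker_def poly_monom poly_prod mult_ac)
  qed
  then have "gen v \<zeta> * tau \<zeta> = poly (gen_poly v) \<zeta>"
    by (simp add: gen_def gen_poly_def poly_sum sum_distrib_right mult.assoc)
  then show ?thesis using tau_nonzero[OF \<zeta>] by (simp add: field_simps)
qed

text \<open>Numerators of degree at most \<open>n\<close> form a space of the same dimension as the
  coefficient vectors, so the independence shown in \<open>gen_eq_0\<close> suffices.\<close>

lemma gen_surj:
  assumes "degree p \<le> n"
  obtains v where "\<And>\<zeta>. \<zeta> \<in> cball 0 1 \<Longrightarrow> gen v \<zeta> = poly p \<zeta> / tau \<zeta>"
proof -
  define T where "T v = (\<chi> i. coeff (gen_poly v) (rank i))" for v
  have vT: "vpoly (T v) = gen_poly v" for v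
    unfolding T_def by (rule vpoly_coeffs[OF degree_gen_poly])
  have lin: "linear T"
    by (rule linearI) (simp_all add: T_def gen_poly_def vec_eq_iff coeff_sum algebra_simps
        sum.distrib sum_distrib_left scaleR_conv_of_real[where 'a = complex])
  have "inj T"
  proof (subst linear_injective_0[OF lin], safe)
    fix v assume "T v = 0"
    then have "gen_poly v = 0" using vT[of v] by simp
    then have "gen v \<zeta> = 0" if "\<zeta> \<in> circle" for \<zeta> using that by (subst gen_eq) auto
    then show "v = 0" by (rule gen_eq_0)
  qed
  with lin have "surj T" by (rule linear_injective_imp_surjective) simp
  then obtain v where "T v = (\<chi> i. coeff p (rank i))" by (metis surjD)
  then have "gen_poly v = p" using vT[of v] vpoly_coeffs[OF assms] by simp
  then show ?thesis using gen_eq that by metis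
qed

text \<open>The predecessor in the same block, where the subdiagonal of \<open>Z_mat\<close> has its
  1. For \<open>ordr p = 0\<close> truncated subtraction returns \<open>p\<close> itself, and the
  lemmas below exclude that case.\<close>

definition prev :: "'i \<Rightarrow> 'i" where "prev p = inv idx (fst (idx p), ordr p - 1)"

lemma idx_prev: "ordr p \<noteq> 0 \<Longrightarrow> idx (prev p) = (fst (idx p), ordr p - 1)"
  unfolding prev_def using idx_in[of p] by (intro idx_inv) auto

lemma ordr_prev: "ordr p \<noteq> 0 \<Longrightarrow> ordr (prev p) = ordr p - 1"
  by (simp add: ordr_def[of "prev p"] idx_prev)

lemma node_prev: "ordr p \<noteq> 0 \<Longrightarrow> node (prev p) = node p"
  by (simp add: node_def idx_prev)

lemma Z_mat_row:
  "(\<Sum>q\<in>UNIV. Z_mat z idx $ p $ q * f q) = node p * f p + (if ordr p = 0 then 0 else f (prev p))"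
proof -
  have "Z_mat z idx $ p $ q = (if q = p then node p else 0)
      + (if ordr p \<noteq> 0 \<and> q = prev p then 1 else 0)" for q
  proof -
    have "q = prev p \<longleftrightarrow> idx q = (fst (idx p), ordr p - 1)" if "ordr p \<noteq> 0"
      using idx_prev[OF that] idx_inj[of q "prev p"] by auto
    moreover have "q = p \<longleftrightarrow> idx q = idx p" using idx_inj by auto
    ultimately show ?thesis
      by (cases "idx p"; cases "idx q") (auto simp: Z_mat_def node_def ordr_def)
  qed
  then have "(\<Sum>q\<in>UNIV. Z_mat z idx $ p $ q * f q) = (\<Sum>q\<in>UNIV. (if q = p then node p * f q else 0))
      + (\<Sum>q\<in>UNIV. (if ordr p \<noteq> 0 \<and> q = prev p then f q else 0))"
    by (simp add: distrib_right sum.distrib if_distrib[of "\<lambda>x. x * _"] cong: if_cong)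
  then show ?thesis by (cases "ordr p = 0") simp_all
qed

lemma stein_entry:
  "(Z_mat z idx ** X ** adjoint_mat (Z_mat z idx)) $ p $ q =
    (\<Sum>q'\<in>UNIV. cnj (Z_mat z idx $ q $ q') * (\<Sum>p'\<in>UNIV. Z_mat z idx $ p $ p' * X $ p' $ q'))"
  by (simp add: matrix_matrix_mult_def adjoint_mat_def mult.commute)

lemma Z_mat_row_cnj:
  "(\<Sum>q\<in>UNIV. cnj (Z_mat z idx $ p $ q) * f q) =
     cnj (node p) * f p + (if ordr p = 0 then 0 else f (prev p))"
  using arg_cong[OF Z_mat_row[of p "\<lambda>q. cnj (f q)"], of cnj] by (simp split: if_splits)

text \<open>By induction on \<open>ordr p + ordr q\<close> the subdiagonal contributions vanish,
  leaving \<open>X $ p $ q\<close> equal to itself times \<open>cnj (node q) * node p\<close>, a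
  number of modulus below 1.\<close>

lemma stein_unique:
  assumes X: "X = Z_mat z idx ** X ** adjoint_mat (Z_mat z idx)"
  shows "X = 0"
proof -
  have "X $ p $ q = 0" for p q
  proof (induction "ordr p + ordr q" arbitrary: p q rule: less_induct)
    case less
    have "X $ p $ q = cnj (node q) * (\<Sum>p'\<in>UNIV. Z_mat z idx $ p $ p' * X $ p' $ q)
       + (if ordr q = 0 then 0 else (\<Sum>p'\<in>UNIV. Z_mat z idx $ p $ p' * X $ p' $ prev q))"
      by (subst X, subst stein_entry, subst Z_mat_row_cnj) simp
    moreover have "(\<Sum>p'\<in>UNIV. Z_mat z idx $ p $ p' * X $ p' $ q) = node p * X $ p $ q"
      using less[of "prev p" q] by (auto simp: Z_mat_row ordr_prev)
    moreover have "(\<Sum>p'\<in>UNIV. Z_mat z idx $ p $ p' * X $ p' $ prev q) = 0" if "ordr q \<noteq> 0"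
      using that less[of p "prev q"] less[of "prev p" "prev q"] by (auto simp: Z_mat_row ordr_prev)
    ultimately have "X $ p $ q = cnj (node q) * (node p * X $ p $ q)"
      by (cases "ordr q = 0") (simp_all only: simp_thms if_True if_False add_0_right)
    then have "(1 - cnj (node q) * node p) * X $ p $ q = 0"
      by (simp add: algebra_simps)
    moreover have "1 - cnj (node q) * node p \<noteq> 0"
      using norm_node[of p] norm_node[of q] by (intro one_minus_cnj_mult_nonzero) auto
    ultimately show ?case by simp
  qed
  then show ?thesis by (simp add: vec_eq_iff)
qed

abbreviation ck :: "'i \<Rightarrow> complex \<Rightarrow> complex" where "ck i \<equiv> cker (node i) (ordr i)"

lemma continuous_ck [continuous_intros]: "continuous_on circle (\<lambda>\<zeta>. ck i \<zeta>)"
  by (rule continuous_cker[OF norm_node])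

lemma e_vec_eq: "e_vec idx $ p = (if ordr p = 0 then 1 else 0)"
  by (simp add: e_vec_def ordr_def)

lemma cmean_ck: "cmean (\<lambda>\<zeta>. ck p \<zeta>) = e_vec idx $ p"
  by (simp add: cmean_cker norm_node e_vec_eq)

definition gram :: "complex ^ 'i ^ 'i" where
  "gram = (\<chi> p q. cmean (\<lambda>\<zeta>. ck p \<zeta> * cnj (ck q \<zeta>)))"

lemma Z_mat_ck:
  assumes "\<zeta> \<in> circle"
  shows "(\<Sum>q\<in>UNIV. Z_mat z idx $ p $ q * ck q \<zeta>) = \<zeta> * (ck p \<zeta> - e_vec idx $ p)"
proof -
  have nz: "\<zeta> - node p \<noteq> 0" using circle_minus_nonzero norm_node assms by blast
  show ?thesis
  proof (cases "ordr p")
    case 0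
    have "node p * ck p \<zeta> = \<zeta> * (ck p \<zeta> - 1)"
      using nz 0 by (simp add: cker_def field_simps)
    then show ?thesis unfolding Z_mat_row by (simp add: e_vec_eq 0)
  next
    case (Suc k)
    then have "node p * ck p \<zeta> + ck (prev p) \<zeta> = \<zeta> * ck p \<zeta>"
      using nz by (simp add: cker_def ordr_prev node_prev divide_simps) (simp add: algebra_simps)
    then show ?thesis unfolding Z_mat_row using Suc by (simp add: e_vec_eq)
  qed
qed

text \<open>By \<open>Z_mat_ck\<close>, applying \<open>Z_mat\<close> to the vector of kernels gives
  \<open>\<zeta>\<close> times (kernels minus \<open>e_vec\<close>). In the Gram matrix the
  unimodular factor cancels, and since the kernels have mean \<open>e_vec\<close>, expanding the
  product leaves \<open>gram\<close> minus the outer product.\<close>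

lemma gram_stein:
  "gram = Z_mat z idx ** gram ** adjoint_mat (Z_mat z idx) + outer_self (e_vec idx)"
proof -
  have "(Z_mat z idx ** gram ** adjoint_mat (Z_mat z idx)) $ p $ q
      = gram $ p $ q - e_vec idx $ p * cnj (e_vec idx $ q)" for p q
  proof -
    let ?e = "e_vec idx"
    have "(Z_mat z idx ** gram ** adjoint_mat (Z_mat z idx)) $ p $ q =
      (\<Sum>q'\<in>UNIV. \<Sum>p'\<in>UNIV. cmean (\<lambda>\<zeta>. cnj (Z_mat z idx $ q $ q') * Z_mat z idx $ p $ p'
          * (ck p' \<zeta> * cnj (ck q' \<zeta>))))"
      unfolding stein_entry
      by (subst cmean_mult_left) (auto intro!: continuous_intros simp: gram_def sum_distrib_left mult_ac)
    also have "\<dots> = cmean (\<lambda>\<zeta>. \<Sum>q'\<in>UNIV. \<Sum>p'\<in>UNIV. cnj (Z_mat z idx $ q $ q') * Z_mat z idx $ p $ p'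
          * (ck p' \<zeta> * cnj (ck q' \<zeta>)))"
      by (subst cmean_sum, simp, intro continuous_intros, subst cmean_sum)
        (auto intro!: continuous_intros)
    also have "\<dots> = cmean (\<lambda>\<zeta>. (\<Sum>p'\<in>UNIV. Z_mat z idx $ p $ p' * ck p' \<zeta>)
        * cnj (\<Sum>q'\<in>UNIV. Z_mat z idx $ q $ q' * ck q' \<zeta>))"
      unfolding cnj_sum sum_product complex_cnj_mult
      by (intro cmean_cong, subst sum.swap) (simp add: mult_ac)
    also have "\<dots> = cmean (\<lambda>\<zeta>. (ck p \<zeta> - ?e $ p) * cnj (ck q \<zeta> - ?e $ q))"
    proof (rule cmean_cong)
      fix \<zeta> assume \<zeta>: "\<zeta> \<in> circle"
      have "(\<zeta> * (ck p \<zeta> - ?e $ p)) * cnj (\<zeta> * (ck q \<zeta> - ?e $ q))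
         = (\<zeta> * cnj \<zeta>) * ((ck p \<zeta> - ?e $ p) * cnj (ck q \<zeta> - ?e $ q))" by (simp add: mult_ac)
      then show "(\<Sum>p'\<in>UNIV. Z_mat z idx $ p $ p' * ck p' \<zeta>)
        * cnj (\<Sum>q'\<in>UNIV. Z_mat z idx $ q $ q' * ck q' \<zeta>) = (ck p \<zeta> - ?e $ p) * cnj (ck q \<zeta> - ?e $ q)"
        unfolding Z_mat_ck[OF \<zeta>] circle_mult_cnj(1)[OF \<zeta>] by simp
    qed
    also have "\<dots> = cmean (\<lambda>\<zeta>. (ck p \<zeta> * cnj (ck q \<zeta>) - cnj (?e $ q) * ck p \<zeta>)
        - (?e $ p * cnj (ck q \<zeta>) - ?e $ p * cnj (?e $ q)))"
      by (rule cmean_cong) (simp add: algebra_simps)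
    also have "\<dots> = (cmean (\<lambda>\<zeta>. ck p \<zeta> * cnj (ck q \<zeta>)) - cmean (\<lambda>\<zeta>. cnj (?e $ q) * ck p \<zeta>))
        - (cmean (\<lambda>\<zeta>. ?e $ p * cnj (ck q \<zeta>)) - cmean (\<lambda>\<zeta>. ?e $ p * cnj (?e $ q)))"
      by (simp only: cmean_diff continuous_intros)
    also have "cmean (\<lambda>\<zeta>. cnj (?e $ q) * ck p \<zeta>) = cnj (?e $ q) * ?e $ p"
      by (subst cmean_mult_left) (intro continuous_intros, simp only: cmean_ck)
    also have "cmean (\<lambda>\<zeta>. ?e $ p * cnj (ck q \<zeta>)) = ?e $ p * cnj (?e $ q)"
      by (subst cmean_mult_left, intro continuous_intros, subst cmean_cnj)
        (intro continuous_intros, simp only: cmean_ck)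
    finally show ?thesis by (simp add: gram_def)
  qed
  then show ?thesis by (simp add: vec_eq_iff outer_self_def)
qed

lemma E_mat_eq: "E_mat z idx = gram"
  unfolding E_mat_def
proof (rule the_equality)
  show "gram = Z_mat z idx ** gram ** adjoint_mat (Z_mat z idx) + outer_self (e_vec idx)"
    by (rule gram_stein)
next
  fix X assume X: "X = Z_mat z idx ** X ** adjoint_mat (Z_mat z idx) + outer_self (e_vec idx)"
  have "X - gram = Z_mat z idx ** (X - gram) ** adjoint_mat (Z_mat z idx)"
  proof -
    have "(Z_mat z idx ** (X - gram) ** adjoint_mat (Z_mat z idx)) $ p $ q =
        (Z_mat z idx ** X ** adjoint_mat (Z_mat z idx)) $ p $ q
        - (Z_mat z idx ** gram ** adjoint_mat (Z_mat z idx)) $ p $ q" for p q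
      unfolding stein_entry by (simp add: algebra_simps sum_subtractf)
    then have "Z_mat z idx ** (X - gram) ** adjoint_mat (Z_mat z idx) =
        Z_mat z idx ** X ** adjoint_mat (Z_mat z idx) - Z_mat z idx ** gram ** adjoint_mat (Z_mat z idx)"
      by (simp add: vec_eq_iff)
    also have "\<dots> = X - gram"
      using X gram_stein by (metis add_diff_cancel_right)
    finally show ?thesis by (rule sym)
  qed
  then show "X = gram" using stein_unique by fastforce
qed

lemma W_mat_row:
  assumes "w = hdata q"
  shows "(\<Sum>p'\<in>UNIV. W_mat idx w $ p $ p' * f (node p') (ordr p')) =
    (\<Sum>l\<le>ordr p. coeff (pcompose q [:node p, 1:]) (ordr p - l) * f (node p) l)"
proof -
  let ?j = "fst (idx p)"
  let ?A = "{p'. fst (idx p') = ?j \<and> ordr p' \<le> ordr p}"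
  have jm: "?j \<le> m" using idx_in by blast
  have "(\<Sum>p'\<in>UNIV. W_mat idx w $ p $ p' * f (node p') (ordr p')) =
    (\<Sum>p'\<in>?A. entry idx w ?j (ordr p - ordr p') * f (node p') (ordr p'))"
    by (rule sum.mono_neutral_cong_right) (auto simp: W_mat_def ordr_def case_prod_unfold Let_def)
  also have "\<dots> = (\<Sum>l\<le>ordr p. coeff (pcompose q [:node p, 1:]) (ordr p - l) * f (node p) l)"
  proof (rule sum.reindex_bij_witness[of _ "\<lambda>l. inv idx (?j, l)" ordr])
    fix p' assume "p' \<in> ?A"
    then have *: "fst (idx p') = ?j" "ordr p' \<le> ordr p" by auto
    then have "idx p' = (?j, ordr p')" by (metis ordr_def prod.collapse)
    then show "inv idx (?j, ordr p') = p'" using inv_idx by metis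
    show "ordr p' \<in> {..ordr p}" using * by simp
    have "ordr p - ordr p' < \<mu> ?j" using idx_in(2)[of p] by linarith
    then show "coeff (pcompose q [:node p, 1:]) (ordr p - ordr p') * f (node p) (ordr p') =
        entry idx w ?j (ordr p - ordr p') * f (node p') (ordr p')"
      using * jm by (simp add: assms entry_hdata node_def)
  next
    fix l assume "l \<in> {..ordr p}"
    then have "idx (inv idx (?j, l)) = (?j, l)" using idx_in[of p] jm by (intro idx_inv) auto
    then show "ordr (inv idx (?j, l)) = l" "inv idx (?j, l) \<in> ?A"
      using \<open>l \<in> {..ordr p}\<close> by (auto simp: ordr_def[of "inv idx _"])
  qed
  finally show ?thesis .
qed

text \<open>\<open>W_mat\<close> acts on the kernels as multiplication by \<open>q\<close>, up to
  \<open>\<zeta>\<close> times a polynomial. That error is multiplied by \<open>cnj (ck r)\<close>,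
  which is the holomorphic \<open>dker\<close>, so its mean is its value at 0.\<close>

lemma W_gram_entry:
  assumes w: "w = hdata q"
  shows "(W_mat idx w ** gram) $ p $ r = cmean (\<lambda>\<zeta>. poly q \<zeta> * ck p \<zeta> * cnj (ck r \<zeta>))"
proof -
  obtain h where h: "\<And>\<zeta>. \<zeta> \<in> circle \<Longrightarrow> poly q \<zeta> * ck p \<zeta> = (\<Sum>l\<le>ordr p.
      coeff (pcompose q [:node p, 1:]) (ordr p - l) * cker (node p) l \<zeta>) + \<zeta> * poly h \<zeta>"
    using poly_mult_cker[OF norm_node[of p], of q "ordr p"] by blast
  have dk: "continuous_on circle (\<lambda>\<zeta>. dker (node r) (ordr r) \<zeta>)"
    by (rule holomorphic_cball_continuous_circle[OF holomorphic_dker[OF norm_node]])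
  have "(W_mat idx w ** gram) $ p $ r =
      (\<Sum>p'\<in>UNIV. cmean (\<lambda>\<zeta>. W_mat idx w $ p $ p' * (ck p' \<zeta> * cnj (ck r \<zeta>))))"
    unfolding matrix_matrix_mult_def
    by (subst cmean_mult_left) (auto intro!: continuous_intros simp: gram_def)
  also have "\<dots> = cmean (\<lambda>\<zeta>. \<Sum>p'\<in>UNIV. W_mat idx w $ p $ p' * (ck p' \<zeta> * cnj (ck r \<zeta>)))"
    by (rule cmean_sum[symmetric]) (auto intro!: continuous_intros)
  also have "\<dots> = cmean (\<lambda>\<zeta>. poly q \<zeta> * ck p \<zeta> * cnj (ck r \<zeta>)
      - \<zeta> * poly h \<zeta> * dker (node r) (ordr r) \<zeta>)"
  proof (rule cmean_cong)
    fix \<zeta> assume \<zeta>: "\<zeta> \<in> circle"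
    have "(\<Sum>p'\<in>UNIV. W_mat idx w $ p $ p' * (ck p' \<zeta> * cnj (ck r \<zeta>))) =
        (poly q \<zeta> * ck p \<zeta> - \<zeta> * poly h \<zeta>) * cnj (ck r \<zeta>)"
      unfolding h[OF \<zeta>] mult.assoc[symmetric] sum_distrib_right[symmetric]
      using W_mat_row[OF w, of p "\<lambda>a l. cker a l \<zeta>"] by simp
    also have "cnj (ck r \<zeta>) = dker (node r) (ordr r) \<zeta>"
      using cnj_dker[OF norm_node \<zeta>] by (metis complex_cnj_cnj)
    finally show "(\<Sum>p'\<in>UNIV. W_mat idx w $ p $ p' * (ck p' \<zeta> * cnj (ck r \<zeta>))) =
        poly q \<zeta> * ck p \<zeta> * cnj (ck r \<zeta>) - \<zeta> * poly h \<zeta> * dker (node r) (ordr r) \<zeta>"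
      unfolding cnj_dker[OF norm_node \<zeta>, symmetric] complex_cnj_cnj by (simp add: algebra_simps)
  qed
  also have "\<dots> = cmean (\<lambda>\<zeta>. poly q \<zeta> * ck p \<zeta> * cnj (ck r \<zeta>))
      - cmean (\<lambda>\<zeta>. \<zeta> * poly h \<zeta> * dker (node r) (ordr r) \<zeta>)"
    by (intro cmean_diff continuous_intros dk)
  also have "cmean (\<lambda>\<zeta>. \<zeta> * poly h \<zeta> * dker (node r) (ordr r) \<zeta>) = 0"
    by (subst cmean_holomorphic) (auto intro!: holomorphic_intros norm_node)
  finally show ?thesis by simp
qed

text \<open>As \<open>gram\<close> is Hermitian, the second summand of the Pick matrix is the
  adjoint of the first, so \<open>q\<close> and its conjugate add up to
  \<open>2 * Re q\<close>.\<close>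

lemma pick_matrix_entry:
  assumes w: "w = hdata q"
  shows "pick_matrix z idx w $ p $ r =
    cmean (\<lambda>\<zeta>. complex_of_real (2 * Re (poly q \<zeta>)) * (ck p \<zeta> * cnj (ck r \<zeta>)))"
proof -
  have herm: "gram $ p $ q' = cnj (gram $ q' $ p)" for p q'
    unfolding gram_def vec_lambda_beta
    by (subst cmean_cnj[symmetric]) (auto intro!: continuous_intros simp: mult.commute)
  have "(gram ** adjoint_mat (W_mat idx w)) $ p $ r = (\<Sum>k\<in>UNIV. gram $ p $ k * cnj (W_mat idx w $ r $ k))"
    by (simp add: matrix_matrix_mult_def adjoint_mat_def)
  also have "\<dots> = (\<Sum>k\<in>UNIV. cnj (gram $ k $ p) * cnj (W_mat idx w $ r $ k))"
    by (intro sum.cong refl arg_cong2[of _ _ _ _ "(*)"] herm)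
  also have "\<dots> = cnj ((W_mat idx w ** gram) $ r $ p)"
    by (simp add: matrix_matrix_mult_def mult.commute)
  also have "\<dots> = cmean (\<lambda>\<zeta>. cnj (poly q \<zeta> * ck r \<zeta> * cnj (ck p \<zeta>)))"
    unfolding W_gram_entry[OF w] by (subst cmean_cnj) (auto intro!: continuous_intros)
  finally have "pick_matrix z idx w $ p $ r = cmean (\<lambda>\<zeta>. poly q \<zeta> * ck p \<zeta> * cnj (ck r \<zeta>)
      + cnj (poly q \<zeta> * ck r \<zeta> * cnj (ck p \<zeta>)))"
    unfolding pick_matrix_def E_mat_eq
    by (subst cmean_add) (auto intro!: continuous_intros simp: W_gram_entry[OF w])
  also have "\<dots> = cmean (\<lambda>\<zeta>. complex_of_real (2 * Re (poly q \<zeta>)) * (ck p \<zeta> * cnj (ck r \<zeta>)))"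
    by (rule cmean_cong) (simp only: complex_add_cnj[symmetric], simp add: algebra_simps)
  finally show ?thesis .
qed

lemma pick_matrix_hermitian:
  assumes w: "w = hdata q"
  shows "adjoint_mat (pick_matrix z idx w) = pick_matrix z idx w"
  unfolding vec_eq_iff adjoint_mat_def vec_lambda_beta pick_matrix_entry[OF w]
  by (subst cmean_cnj[symmetric]) (auto intro!: continuous_intros cmean_cong)

lemma pick_quadratic:
  assumes w: "w = hdata q"
  shows "Re (\<Sum>p\<in>UNIV. cnj (v $ p) * (pick_matrix z idx w *v v) $ p) =
    cmean (\<lambda>\<zeta>. 2 * Re (poly q \<zeta>) * (cmod (gen v \<zeta>))\<^sup>2)"
proof -
  note [continuous_intros] = holomorphic_cball_continuous_circle[OF holomorphic_gen]
  let ?R = "\<lambda>\<zeta>. complex_of_real (2 * Re (poly q \<zeta>))"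
  have "(\<Sum>p\<in>UNIV. cnj (v $ p) * (pick_matrix z idx w *v v) $ p) =
    (\<Sum>p\<in>UNIV. \<Sum>r\<in>UNIV. cmean (\<lambda>\<zeta>. (cnj (v $ p) * v $ r) * (?R \<zeta> * (ck p \<zeta> * cnj (ck r \<zeta>)))))"
    unfolding matrix_vector_mult_def vec_lambda_beta pick_matrix_entry[OF w]
    by (subst cmean_mult_left) (auto intro!: continuous_intros simp: sum_distrib_left mult_ac)
  also have "\<dots> = cmean (\<lambda>\<zeta>. \<Sum>p\<in>UNIV. \<Sum>r\<in>UNIV. (cnj (v $ p) * v $ r) * (?R \<zeta> * (ck p \<zeta> * cnj (ck r \<zeta>))))"
    by (subst cmean_sum, simp, intro continuous_intros, subst cmean_sum)
      (auto intro!: continuous_intros)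
  also have "\<dots> = cmean (\<lambda>\<zeta>. complex_of_real (2 * Re (poly q \<zeta>) * (cmod (gen v \<zeta>))\<^sup>2))"
  proof (rule cmean_cong)
    fix \<zeta> assume \<zeta>: "\<zeta> \<in> circle"
    have "(\<Sum>p\<in>UNIV. \<Sum>r\<in>UNIV. (cnj (v $ p) * v $ r) * (?R \<zeta> * (ck p \<zeta> * cnj (ck r \<zeta>)))) =
       ?R \<zeta> * ((\<Sum>p\<in>UNIV. cnj (v $ p) * ck p \<zeta>) * (\<Sum>r\<in>UNIV. v $ r * cnj (ck r \<zeta>)))"
      by (simp add: sum_product sum_distrib_left mult_ac)
    also have "(\<Sum>r\<in>UNIV. v $ r * cnj (ck r \<zeta>)) = cnj (\<Sum>r\<in>UNIV. cnj (v $ r) * ck r \<zeta>)" by simp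
    finally show "(\<Sum>p\<in>UNIV. \<Sum>r\<in>UNIV. (cnj (v $ p) * v $ r) * (?R \<zeta> * (ck p \<zeta> * cnj (ck r \<zeta>)))) =
        complex_of_real (2 * Re (poly q \<zeta>) * (cmod (gen v \<zeta>))\<^sup>2)"
      unfolding cnj_gen[OF \<zeta>, symmetric] of_real_mult[of _ "(cmod (gen v \<zeta>))\<^sup>2"] complex_norm_square
      by (simp add: mult_ac)
  qed
  also have "\<dots> = complex_of_real (cmean (\<lambda>\<zeta>. 2 * Re (poly q \<zeta>) * (cmod (gen v \<zeta>))\<^sup>2))"
    by (rule cmean_of_real) (intro continuous_intros)
  finally show ?thesis by simp
qed

section \<open>The interpolation and spectral equations as bilinear equations\<close>

abbreviation ev :: "real ^ 'i \<Rightarrow> complex \<Rightarrow> complex" where "ev u \<equiv> cpoly (vpoly u)"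

lemma ev_0: "ev u 0 = of_real (u $ i0)"
  using coeff_vpoly[of u i0] by (simp add: cpoly_def poly_0_coeff_0)

lemma ev_eq_on_circle: "(\<And>\<zeta>. \<zeta> \<in> circle \<Longrightarrow> ev u \<zeta> = ev v \<zeta>) \<Longrightarrow> u = v"
  using poly_eq_on_circle[of "cp (vpoly u)" "cp (vpoly v)"] by (simp add: cpoly_def)

lemma ev_scaleR: "ev (c *\<^sub>R u) \<zeta> = of_real c * ev u \<zeta>"
  by (simp add: cpoly_def vpoly_scaleR cp_smult)

text \<open>The remainder of \<open>2 p u\<close> modulo \<open>nodal\<close>, computed by Hermite
  interpolation instead of division, which makes it real and bilinear by construction.\<close>

definition mult_mod :: "real ^ 'i \<Rightarrow> real ^ 'i \<Rightarrow> real ^ 'i" where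
  "mult_mod p u = vdata_inv (hdata (cp (smult 2 (vpoly p * vpoly u))))"

lemma vdata_mult_mod: "vdata (mult_mod p u) = hdata (cp (smult 2 (vpoly p * vpoly u)))"
  unfolding mult_mod_def by (rule vdata_vdata_inv[OF conj_sym_hdata_cp])

lemma mult_mod_iff: "v = mult_mod p u \<longleftrightarrow>
    nodal dvd cp (vpoly v) - smult 2 (cp (vpoly p) * cp (vpoly u))"
proof -
  have "v = mult_mod p u \<longleftrightarrow> vdata v = vdata (mult_mod p u)" using inj_vdata by (auto dest: injD)
  also have "\<dots> \<longleftrightarrow> hdata (cp (vpoly v) - smult 2 (cp (vpoly p) * cp (vpoly u))) = 0"
    unfolding vdata_mult_mod by (simp add: vdata_def hdata_diff cp_smult cp_mult)
  finally show ?thesis by (simp add: hdata_eq_0_iff)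
qed

lemma mult_mod_remainder:
  obtains h where "\<And>\<zeta>. ev (mult_mod p u) \<zeta> = 2 * ev p \<zeta> * ev u \<zeta> + poly nodal \<zeta> * poly h \<zeta>"
proof -
  obtain h where h: "cp (vpoly (mult_mod p u)) - smult 2 (cp (vpoly p) * cp (vpoly u)) = nodal * h"
    using mult_mod_iff by (metis dvdE)
  then have "cp (vpoly (mult_mod p u)) = smult 2 (cp (vpoly p) * cp (vpoly u)) + nodal * h"
    by (simp add: algebra_simps)
  then have "ev (mult_mod p u) \<zeta> = 2 * ev p \<zeta> * ev u \<zeta> + poly nodal \<zeta> * poly h \<zeta>" for \<zeta>
    by (simp add: cpoly_def)
  then show ?thesis by (rule that)
qed

lemma bounded_bilinear_mult_mod: "bounded_bilinear mult_mod"
proof -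
  have "bilinear mult_mod"
    unfolding bilinear_def mult_mod_def
    by (intro conjI allI linear_compose[OF _ vdata_inv(1), unfolded o_def] linearI)
      (simp_all add: vpoly_add vpoly_scaleR ring_distribs smult_add_right cp_add hdata_add
        cp_smult hdata_smult[symmetric] mult.commute)
  then show ?thesis by (simp add: bilinear_conv_bounded_bilinear)
qed

definition rpoly :: "real ^ 'i \<Rightarrow> real poly" where
  "rpoly u = (\<Sum>i\<in>UNIV. monom (u $ i) (n - rank i))"

lemma degree_rpoly: "degree (rpoly u) \<le> n"
  unfolding rpoly_def by (intro degree_sum_le) (auto intro: order_trans[OF degree_monom_le])

lemma ev_eq_sum: "ev u \<zeta> = (\<Sum>i\<in>UNIV. of_real (u $ i) * \<zeta> ^ rank i)"
  by (simp add: vpoly_def cpoly_sum cpoly_monom)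

lemma cpoly_rpoly:
  assumes "\<zeta> \<noteq> 0" shows "cpoly (rpoly u) \<zeta> = \<zeta> ^ n * ev u (inverse \<zeta>)"
proof -
  have "\<zeta> ^ (n - rank i) = \<zeta> ^ n * inverse \<zeta> ^ rank i" for i
    using assms rank_le[of i] by (simp add: power_diff power_inverse field_simps)
  then show ?thesis
    by (simp add: rpoly_def ev_eq_sum cpoly_sum cpoly_monom sum_distrib_left mult_ac)
qed

lemma cpoly_rpoly_circle: "\<zeta> \<in> circle \<Longrightarrow> cpoly (rpoly u) \<zeta> = \<zeta> ^ n * cnj (ev u \<zeta>)"
  using cpoly_rpoly[OF circle_nonzero] circle_inverse by (simp add: cpoly_cnj)

definition spec_poly :: "real ^ 'i \<Rightarrow> real ^ 'i \<Rightarrow> real poly" where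
  "spec_poly u v = vpoly u * rpoly v + vpoly v * rpoly u"

text \<open>\<open>spec_poly u v\<close> is self-reciprocal about degree \<open>n\<close>, so its
  upper half determines it. Keeping only these \<open>n + 1\<close> coefficients gives a square
  system.\<close>

definition spec :: "real ^ 'i \<Rightarrow> real ^ 'i \<Rightarrow> real ^ 'i" where
  "spec u v = (\<chi> i. coeff (spec_poly u v) (n + rank i))"

lemma cpoly_spec_poly_circle:
  assumes "\<zeta> \<in> circle"
  shows "cpoly (spec_poly u v) \<zeta> = \<zeta> ^ n * of_real (2 * Re (ev u \<zeta> * cnj (ev v \<zeta>)))"
  unfolding spec_poly_def cpoly_add cpoly_mult cpoly_rpoly_circle[OF assms]
    complex_add_cnj[symmetric] by (simp add: algebra_simps)

lemma degree_spec_poly: "degree (spec_poly u v) \<le> 2 * n"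
  unfolding spec_poly_def using degree_vpoly[of u] degree_vpoly[of v] degree_rpoly[of u] degree_rpoly[of v]
  by (intro degree_add_le order_trans[OF degree_mult_le]) auto

text \<open>A real multiple of \<open>\<zeta> ^ n\<close> on the circle is fixed by conjugate
  reversal with respect to \<open>2 * n\<close>, so the lower coefficients mirror the upper
  ones.\<close>

lemma self_reciprocal:
  assumes deg: "degree P \<le> 2 * n" and r: "\<And>\<zeta>. \<zeta> \<in> circle \<Longrightarrow> cpoly P \<zeta> = \<zeta> ^ n * of_real (r \<zeta>)"
    and 0: "\<And>k. k \<le> n \<Longrightarrow> coeff P (n + k) = 0"
  shows "P = 0"
proof -
  have "reverse_poly (2 * n) (cp P) = cp P"
  proof (rule poly_eq_on_circle)
    fix \<zeta> assume \<zeta>: "\<zeta> \<in> circle"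
    have "poly (reverse_poly (2 * n) (cp P)) \<zeta> = \<zeta> ^ (2 * n) * cnj (\<zeta> ^ n * of_real (r \<zeta>))"
      using circle_reverse_poly[of "cp P" "2 * n" \<zeta>] r[OF \<zeta>] deg \<zeta> by (simp add: cpoly_def)
    also have "\<zeta> ^ (2 * n) = \<zeta> ^ n * \<zeta> ^ n" by (metis mult_2 power_add)
    also have "\<zeta> ^ n * \<zeta> ^ n * cnj (\<zeta> ^ n * of_real (r \<zeta>)) = (\<zeta> * cnj \<zeta>) ^ n * (\<zeta> ^ n * of_real (r \<zeta>))"
      by (simp add: power_mult_distrib)
    finally show "poly (reverse_poly (2 * n) (cp P)) \<zeta> = poly (cp P) \<zeta>"
      unfolding circle_mult_cnj(1)[OF \<zeta>] using r[OF \<zeta>] by (simp add: cpoly_def)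
  qed
  then have sym: "coeff P (2 * n - k) = coeff P k" if "k \<le> 2 * n" for k
    using coeff_reverse_poly[OF that, of "cp P"] by simp
  show "P = 0"
  proof (rule poly_eqI)
    fix k
    consider "2 * n < k" | "n \<le> k" "k \<le> 2 * n" | "k < n" by linarith
    then show "coeff P k = coeff 0 k"
    proof cases
      case 1 then show ?thesis using deg by (simp add: coeff_eq_0)
    next
      case 2 then show ?thesis using 0[of "k - n"] by simp
    next
      case 3 then show ?thesis using 0[of "n - k"] sym[of k] by (simp add: mult_2)
    qed
  qed
qed

text \<open>Two unrelated summands are allowed because the linearized equation has this form; the
  equation with right-hand side \<open>c *\<^sub>R spec s s\<close> is the case of
  \<open>(- c) *\<^sub>R s\<close> and \<open>s\<close> in the second summand.\<close>

lemma spec_sum_eq_0_iff: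
  "spec a b + spec a' b' = 0 \<longleftrightarrow>
    (\<forall>\<zeta>\<in>circle. Re (ev a \<zeta> * cnj (ev b \<zeta>)) + Re (ev a' \<zeta> * cnj (ev b' \<zeta>)) = 0)"
proof -
  define P where "P = spec_poly a b + spec_poly a' b'"
  have P: "cpoly P \<zeta> = \<zeta> ^ n *
      of_real (2 * (Re (ev a \<zeta> * cnj (ev b \<zeta>)) + Re (ev a' \<zeta> * cnj (ev b' \<zeta>))))" if "\<zeta> \<in> circle" for \<zeta>
    unfolding P_def cpoly_add cpoly_spec_poly_circle[OF that] by (simp add: algebra_simps)
  have "spec a b + spec a' b' = 0 \<longleftrightarrow> (\<forall>i. coeff P (n + rank i) = 0)"
    by (simp add: spec_def P_def vec_eq_iff)
  also have "\<dots> \<longleftrightarrow> P = 0"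
  proof
    assume *: "\<forall>i. coeff P (n + rank i) = 0"
    show "P = 0"
    proof (rule self_reciprocal[OF _ P])
      show "degree P \<le> 2 * n" unfolding P_def by (intro degree_add_le degree_spec_poly)
      show "coeff P (n + k) = 0" if "k \<le> n" for k using rank_surj[OF that] * by auto
    qed
  qed simp
  also have "\<dots> \<longleftrightarrow> (\<forall>\<zeta>\<in>circle. cpoly P \<zeta> = 0)"
    using poly_eq_on_circle[of "cp P" 0] by (auto simp: cpoly_def)
  also have "\<dots> \<longleftrightarrow> (\<forall>\<zeta>\<in>circle. Re (ev a \<zeta> * cnj (ev b \<zeta>)) + Re (ev a' \<zeta> * cnj (ev b' \<zeta>)) = 0)"
    using circle_nonzero by (intro ball_cong refl) (auto simp: P simp del: of_real_add)
  finally show ?thesis .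
qed

lemma bounded_bilinear_spec: "bounded_bilinear spec"
proof -
  have r: "rpoly (u + v) = rpoly u + rpoly v" "rpoly (c *\<^sub>R u) = smult c (rpoly u)" for u v c
    by (simp_all add: rpoly_def add_monom[symmetric] sum.distrib poly_eq_iff coeff_sum
        sum_distrib_left if_distrib cong: if_cong)
  have "bilinear spec"
    unfolding bilinear_def
    by (intro conjI allI linearI)
      (simp_all add: spec_def spec_poly_def vec_eq_iff vpoly_add r vpoly_scaleR algebra_simps)
  then show ?thesis by (simp add: bilinear_conv_bounded_bilinear)
qed

lemma spec_scaleR: "spec (c *\<^sub>R u) v = c *\<^sub>R spec u v" "spec u (c *\<^sub>R v) = c *\<^sub>R spec u v"
  using bounded_bilinear.scaleR_left[OF bounded_bilinear_spec]
    bounded_bilinear.scaleR_right[OF bounded_bilinear_spec] by auto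

lemma spec_eq_scaled_iff:
  "spec u v = c *\<^sub>R spec s s \<longleftrightarrow>
    (\<forall>\<zeta>\<in>circle. Re (ev u \<zeta> * cnj (ev v \<zeta>)) = c * (cmod (ev s \<zeta>))\<^sup>2)"
proof -
  have "spec u v = c *\<^sub>R spec s s \<longleftrightarrow> spec u v + spec ((- c) *\<^sub>R s) s = 0"
    unfolding spec_scaleR by (simp add: eq_neg_iff_add_eq_0[symmetric])
  also have "\<dots> \<longleftrightarrow> (\<forall>\<zeta>\<in>circle. Re (ev u \<zeta> * cnj (ev v \<zeta>)) = c * (cmod (ev s \<zeta>))\<^sup>2)"
    unfolding spec_sum_eq_0_iff
  proof (intro ball_cong refl)
    fix \<zeta>
    have "Re (ev ((- c) *\<^sub>R s) \<zeta> * cnj (ev s \<zeta>)) = - (c * (cmod (ev s \<zeta>))\<^sup>2)"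
      unfolding ev_scaleR mult.assoc complex_norm_square[symmetric] by simp
    then show "(Re (ev u \<zeta> * cnj (ev v \<zeta>)) + Re (ev ((- c) *\<^sub>R s) \<zeta> * cnj (ev s \<zeta>)) = 0) =
      (Re (ev u \<zeta> * cnj (ev v \<zeta>)) = c * (cmod (ev s \<zeta>))\<^sup>2)" by auto
  qed
  finally show ?thesis .
qed

text \<open>Since \<open>2 * Re N * Re c = Re (N * c) + Re (N * cnj c)\<close>, the mean splits into
  two instances of \<open>cmean_nodal_orthogonal\<close>: one of \<open>u\<close>, \<open>u'\<close>
  joins the holomorphic factor, the other is the conjugated numerator.\<close>

lemma cmean_Re_nodal_orthogonal:
  assumes g: "g holomorphic_on cball 0 1"
  shows "cmean (\<lambda>\<zeta>. Re (poly nodal \<zeta> * g \<zeta>) * Re (ev u \<zeta> * cnj (ev u' \<zeta>)) / (cmod (tau \<zeta>))\<^sup>2) = 0"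
proof -
  note [continuous_intros] = holomorphic_cball_continuous_circle[OF g]
  have tnz: "tau \<zeta> \<noteq> 0" if "\<zeta> \<in> circle" for \<zeta> using tau_nonzero that by auto
  have half: "cmean (\<lambda>\<zeta>. Re (poly nodal \<zeta> * (g \<zeta> * ev u \<zeta> / tau \<zeta>) * cnj (poly (cp (vpoly u')) \<zeta> / tau \<zeta>))) = 0"
    for u u'
  proof (subst cmean_Re)
    show "continuous_on circle (\<lambda>\<zeta>. poly nodal \<zeta> * (g \<zeta> * ev u \<zeta> / tau \<zeta>)
        * cnj (poly (cp (vpoly u')) \<zeta> / tau \<zeta>))"
      using tnz by (intro continuous_intros) auto
    show "Re (cmean (\<lambda>\<zeta>. poly nodal \<zeta> * (g \<zeta> * ev u \<zeta> / tau \<zeta>)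
        * cnj (poly (cp (vpoly u')) \<zeta> / tau \<zeta>))) = 0"
      using tau_nonzero degree_vpoly[of u']
      by (subst cmean_nodal_orthogonal) (auto intro!: holomorphic_intros g)
  qed
  have co: "continuous_on circle (\<lambda>\<zeta>. Re (poly nodal \<zeta> * (g \<zeta> * ev u \<zeta> / tau \<zeta>) * cnj (poly (cp (vpoly u')) \<zeta> / tau \<zeta>)))"
    for u u' using tnz by (intro continuous_intros) auto
  have "cmean (\<lambda>\<zeta>. Re (poly nodal \<zeta> * g \<zeta>) * Re (ev u \<zeta> * cnj (ev u' \<zeta>)) / (cmod (tau \<zeta>))\<^sup>2) =
    cmean (\<lambda>\<zeta>. (1 / 2) *\<^sub>R (Re (poly nodal \<zeta> * (g \<zeta> * ev u \<zeta> / tau \<zeta>) * cnj (poly (cp (vpoly u')) \<zeta> / tau \<zeta>))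
      + Re (poly nodal \<zeta> * (g \<zeta> * ev u' \<zeta> / tau \<zeta>) * cnj (poly (cp (vpoly u)) \<zeta> / tau \<zeta>))))"
  proof (rule cmean_cong)
    fix \<zeta> assume "\<zeta> \<in> circle"
    define N where "N = poly nodal \<zeta> * g \<zeta>"
    have cd: "x / (t :: complex) * cnj (y / t) = x * cnj y / of_real ((cmod t)\<^sup>2)" for x y t
      unfolding complex_norm_square by simp
    have "Re N * Re c = (Re (N * c) + Re (N * cnj c)) / 2" for c by simp
    then have ReN: "Re N * Re (ev u \<zeta> * cnj (ev u' \<zeta>)) =
      (Re (N * ev u \<zeta> * cnj (ev u' \<zeta>)) + Re (N * ev u' \<zeta> * cnj (ev u \<zeta>))) / 2"
      by (simp add: algebra_simps)
    have T: "poly nodal \<zeta> * (g \<zeta> * ev a \<zeta> / tau \<zeta>) * cnj (poly (cp (vpoly b)) \<zeta> / tau \<zeta>) =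
      N * ev a \<zeta> * cnj (ev b \<zeta>) / of_real ((cmod (tau \<zeta>))\<^sup>2)" for a b
      unfolding cpoly_def[of "vpoly b", symmetric] times_divide_eq_right cd N_def
      by (simp add: mult_ac)
    have TR: "Re (poly nodal \<zeta> * (g \<zeta> * ev a \<zeta> / tau \<zeta>) * cnj (poly (cp (vpoly b)) \<zeta> / tau \<zeta>)) =
      Re (N * ev a \<zeta> * cnj (ev b \<zeta>)) / (cmod (tau \<zeta>))\<^sup>2" for a b
      unfolding T by (rule Re_divide_of_real)
    have half: "(A + B) / 2 / t = (1 / 2) *\<^sub>R (A / t + B / t)" for A B t :: real
      by (cases "t = 0") (simp_all add: field_simps)
    show "Re (poly nodal \<zeta> * g \<zeta>) * Re (ev u \<zeta> * cnj (ev u' \<zeta>)) / (cmod (tau \<zeta>))\<^sup>2 =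
      (1 / 2) *\<^sub>R (Re (poly nodal \<zeta> * (g \<zeta> * ev u \<zeta> / tau \<zeta>) * cnj (poly (cp (vpoly u')) \<zeta> / tau \<zeta>))
      + Re (poly nodal \<zeta> * (g \<zeta> * ev u' \<zeta> / tau \<zeta>) * cnj (poly (cp (vpoly u)) \<zeta> / tau \<zeta>)))"
      unfolding N_def[symmetric] ReN half TR ..
  qed
  also have "\<dots> = 0"
    by (subst cmean_linear[OF bounded_linear_scaleR_right], intro continuous_on_add co)
      (simp only: cmean_add[OF co co] half add_0_right scaleR_zero_right)
  finally show ?thesis .
qed

text \<open>In the difference of the quotients \<open>mult_mod p u / u\<close> the term
  \<open>2 p\<close> cancels, leaving \<open>nodal\<close> times a holomorphic \<open>g\<close> with
  real part \<open>|s|^2 * (1/d1 - 1/d2)\<close>. Testing with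
  \<open>|u2|^2 / c2 - |u1|^2 / c1\<close> makes the integrand \<open>I\<close> nonnegative. So
  \<open>d1 = d2\<close> on the circle, \<open>u1 / u2\<close> has constant modulus there, and its
  value 1 at the origin decides.\<close>

lemma solution_unique:
  assumes nz: "\<And>\<zeta>. \<zeta> \<in> cball 0 1 \<Longrightarrow> ev u1 \<zeta> \<noteq> 0" "\<And>\<zeta>. \<zeta> \<in> cball 0 1 \<Longrightarrow> ev u2 \<zeta> \<noteq> 0"
    and u0: "u1 $ i0 = 1" "u2 $ i0 = 1" and c: "c1 > 0" "c2 > 0"
    and s: "\<And>\<zeta>. \<zeta> \<in> circle \<Longrightarrow> ev s \<zeta> \<noteq> 0"
    and eq: "spec u1 (mult_mod p u1) = c1 *\<^sub>R spec s s" "spec u2 (mult_mod p u2) = c2 *\<^sub>R spec s s"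
  shows "u1 = u2"
proof -
  let ?v1 = "mult_mod p u1" let ?v2 = "mult_mod p u2"
  obtain h1 where h1: "\<And>\<zeta>. ev ?v1 \<zeta> = 2 * ev p \<zeta> * ev u1 \<zeta> + poly nodal \<zeta> * poly h1 \<zeta>"
    using mult_mod_remainder by blast
  obtain h2 where h2: "\<And>\<zeta>. ev ?v2 \<zeta> = 2 * ev p \<zeta> * ev u2 \<zeta> + poly nodal \<zeta> * poly h2 \<zeta>"
    using mult_mod_remainder by blast
  define g where "g \<zeta> = poly h1 \<zeta> / ev u1 \<zeta> - poly h2 \<zeta> / ev u2 \<zeta>" for \<zeta>
  have g: "g holomorphic_on cball 0 1" unfolding g_def using nz by (intro holomorphic_intros) auto
  define d1 where "d1 \<zeta> = (cmod (ev u1 \<zeta>))\<^sup>2 / c1" for \<zeta>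
  define d2 where "d2 \<zeta> = (cmod (ev u2 \<zeta>))\<^sup>2 / c2" for \<zeta>
  have d: "d1 \<zeta> > 0" "d2 \<zeta> > 0" if "\<zeta> \<in> circle" for \<zeta>
    unfolding d1_def d2_def using nz[of \<zeta>] c that by auto
  have Reg: "Re (poly nodal \<zeta> * g \<zeta>) = (cmod (ev s \<zeta>))\<^sup>2 * (1 / d1 \<zeta> - 1 / d2 \<zeta>)" if \<zeta>: "\<zeta> \<in> circle" for \<zeta>
  proof -
    have nz': "ev u1 \<zeta> \<noteq> 0" "ev u2 \<zeta> \<noteq> 0" using nz[of \<zeta>] \<zeta> by auto
    then have "poly nodal \<zeta> * g \<zeta> = ev ?v1 \<zeta> / ev u1 \<zeta> - ev ?v2 \<zeta> / ev u2 \<zeta>"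
      unfolding g_def h1 h2 by (simp add: field_simps)
    moreover have "Re (ev ?v1 \<zeta> / ev u1 \<zeta>) = (cmod (ev s \<zeta>))\<^sup>2 / d1 \<zeta>"
      using eq(1) \<zeta> c nz' unfolding spec_eq_scaled_iff complex_div_cnj[of "ev ?v1 \<zeta>"] Re_divide_of_real d1_def
      by (auto simp: field_simps)
    moreover have "Re (ev ?v2 \<zeta> / ev u2 \<zeta>) = (cmod (ev s \<zeta>))\<^sup>2 / d2 \<zeta>"
      using eq(2) \<zeta> c nz' unfolding spec_eq_scaled_iff complex_div_cnj[of "ev ?v2 \<zeta>"] Re_divide_of_real d2_def
      by (auto simp: field_simps)
    ultimately show ?thesis
      by (simp only: minus_complex.simps right_diff_distrib times_divide_eq_right mult_1_right)
  qed
  define G where "G \<zeta> = Re (poly nodal \<zeta> * g \<zeta>)" for \<zeta>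
  define I where "I \<zeta> = (cmod (ev s \<zeta>))\<^sup>2 * (d1 \<zeta> - d2 \<zeta>)\<^sup>2 / (d1 \<zeta> * d2 \<zeta> * (cmod (tau \<zeta>))\<^sup>2)" for \<zeta>
  have tnz: "tau \<zeta> \<noteq> 0" if "\<zeta> \<in> circle" for \<zeta> using tau_nonzero that by auto
  note [continuous_intros] = holomorphic_cball_continuous_circle[OF g]
  have cI: "continuous_on circle I"
    unfolding I_def d1_def d2_def using tnz nz c by (intro continuous_intros) auto
  have o: "cmean (\<lambda>\<zeta>. G \<zeta> * Re (ev u \<zeta> * cnj (ev u \<zeta>)) / (cmod (tau \<zeta>))\<^sup>2) = 0" for u
    unfolding G_def by (rule cmean_Re_nodal_orthogonal[OF g])
  have co: "continuous_on circle (\<lambda>\<zeta>. G \<zeta> * Re (ev u \<zeta> * cnj (ev u \<zeta>)) / (cmod (tau \<zeta>))\<^sup>2)" for u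
    unfolding G_def using tnz by (intro continuous_intros) auto
  have "cmean I = cmean (\<lambda>\<zeta>. (1 / c2) *\<^sub>R (G \<zeta> * Re (ev u2 \<zeta> * cnj (ev u2 \<zeta>)) / (cmod (tau \<zeta>))\<^sup>2)
      - (1 / c1) *\<^sub>R (G \<zeta> * Re (ev u1 \<zeta> * cnj (ev u1 \<zeta>)) / (cmod (tau \<zeta>))\<^sup>2))"
  proof (rule cmean_cong)
    fix \<zeta> assume \<zeta>: "\<zeta> \<in> circle"
    have e: "Re (x * cnj x) = (cmod x)\<^sup>2" for x unfolding complex_norm_square[symmetric] by simp
    have "(1 / c2) *\<^sub>R (G \<zeta> * Re (ev u2 \<zeta> * cnj (ev u2 \<zeta>)) / (cmod (tau \<zeta>))\<^sup>2)
      - (1 / c1) *\<^sub>R (G \<zeta> * Re (ev u1 \<zeta> * cnj (ev u1 \<zeta>)) / (cmod (tau \<zeta>))\<^sup>2)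
      = G \<zeta> * (d2 \<zeta> - d1 \<zeta>) / (cmod (tau \<zeta>))\<^sup>2"
      unfolding e d1_def d2_def by (simp add: algebra_simps diff_divide_distrib)
    also have "\<dots> = I \<zeta>"
      unfolding G_def Reg[OF \<zeta>] I_def using d[OF \<zeta>] tnz[OF \<zeta>]
      by (simp add: divide_simps) (simp add: power2_eq_square algebra_simps)
    finally show "I \<zeta> = (1 / c2) *\<^sub>R (G \<zeta> * Re (ev u2 \<zeta> * cnj (ev u2 \<zeta>)) / (cmod (tau \<zeta>))\<^sup>2)
      - (1 / c1) *\<^sub>R (G \<zeta> * Re (ev u1 \<zeta> * cnj (ev u1 \<zeta>)) / (cmod (tau \<zeta>))\<^sup>2)" by simp
  qed
  also have "\<dots> = 0"
    by (subst cmean_diff, (intro continuous_intros co)+,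
      (subst cmean_linear[OF bounded_linear_scaleR_right], rule co)+) (simp only: o scaleR_zero_right diff_0_right)
  finally have I0: "cmean I = 0" .
  have deq: "d1 \<zeta> = d2 \<zeta>" if \<zeta>: "\<zeta> \<in> circle" for \<zeta>
  proof -
    have "I \<zeta> = 0"
    proof (rule cmean_nonneg_eq_0[OF cI _ I0 \<zeta>])
      fix x assume "x \<in> circle"
      from d[OF this] show "0 \<le> I x"
        unfolding I_def by (intro divide_nonneg_nonneg mult_nonneg_nonneg) auto
    qed
    then show ?thesis using d[OF \<zeta>] tnz[OF \<zeta>] s[OF \<zeta>] by (simp add: I_def)
  qed
  have "ev u1 \<zeta> / ev u2 \<zeta> = 1" if \<zeta>: "\<zeta> \<in> circle" for \<zeta>
  proof (rule constant_modulus_eq_1[OF _ _ _ _ \<zeta>])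
    show "(\<lambda>\<zeta>. ev u1 \<zeta> / ev u2 \<zeta>) holomorphic_on cball 0 1" using nz by (intro holomorphic_intros) auto
    show "ev u1 \<zeta> / ev u2 \<zeta> \<noteq> 0" if "\<zeta> \<in> cball 0 1" for \<zeta> using nz that by auto
    show "ev u1 0 / ev u2 0 = 1" by (simp add: ev_0 u0)
    show "(cmod (ev u1 \<zeta> / ev u2 \<zeta>))\<^sup>2 = c1 / c2" if "\<zeta> \<in> circle" for \<zeta>
      using deq[OF that] nz(2)[of \<zeta>] that c
      by (simp add: d1_def d2_def norm_divide power_divide field_simps)
  qed
  then have "ev u1 \<zeta> = ev u2 \<zeta>" if "\<zeta> \<in> circle" for \<zeta> using that by fastforce
  then show ?thesis by (rule ev_eq_on_circle)
qed

text \<open>Put \<open>x = h / u\<close>, \<open>y = mult_mod p u / u\<close> and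
  \<open>k = mult_mod p h / u\<close>. The variation of the quotient \<open>y\<close> is
  \<open>k - y * x\<close>, which equals \<open>nodal * g\<close>. The linearized equation says
  \<open>Re k = - Re (x * cnj y)\<close>, so \<open>Re (nodal * g) = - 2 * Re x * Re y\<close>.
  Testing with \<open>Re (h * cnj u)\<close>, that is \<open>|u|^2 * Re x\<close>, gives an
  integrand of one sign. Hence \<open>Re x\<close> vanishes on the circle, and \<open>x\<close> is
  real at 0.\<close>

lemma linearized_solution_zero:
  assumes nz: "\<And>\<zeta>. \<zeta> \<in> cball 0 1 \<Longrightarrow> ev u \<zeta> \<noteq> 0"
    and pos: "\<And>\<zeta>. \<zeta> \<in> circle \<Longrightarrow> 0 < Re (ev u \<zeta> * cnj (ev (mult_mod p u) \<zeta>))"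
    and eq: "spec h (mult_mod p u) + spec u (mult_mod p h) = 0"
  shows "h = 0"
proof -
  let ?v = "mult_mod p u" let ?k = "mult_mod p h"
  obtain q1 where q1: "\<And>\<zeta>. ev ?v \<zeta> = 2 * ev p \<zeta> * ev u \<zeta> + poly nodal \<zeta> * poly q1 \<zeta>"
    using mult_mod_remainder by blast
  obtain q2 where q2: "\<And>\<zeta>. ev ?k \<zeta> = 2 * ev p \<zeta> * ev h \<zeta> + poly nodal \<zeta> * poly q2 \<zeta>"
    using mult_mod_remainder by blast
  define g where "g \<zeta> = (ev u \<zeta> * poly q2 \<zeta> - poly q1 \<zeta> * ev h \<zeta>) / (ev u \<zeta>)\<^sup>2" for \<zeta>
  have g: "g holomorphic_on cball 0 1" unfolding g_def using nz by (intro holomorphic_intros) auto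
  have tnz: "tau \<zeta> \<noteq> 0" if "\<zeta> \<in> circle" for \<zeta> using tau_nonzero that by auto
  define I where "I \<zeta> = (Re (ev h \<zeta> / ev u \<zeta>))\<^sup>2 * Re (ev u \<zeta> * cnj (ev ?v \<zeta>)) / (cmod (tau \<zeta>))\<^sup>2" for \<zeta>
  have cI: "continuous_on circle I"
    unfolding I_def using tnz nz by (intro continuous_intros) auto
  have "cmean (\<lambda>\<zeta>. (- 2) *\<^sub>R I \<zeta>) =
      cmean (\<lambda>\<zeta>. Re (poly nodal \<zeta> * g \<zeta>) * Re (ev h \<zeta> * cnj (ev u \<zeta>)) / (cmod (tau \<zeta>))\<^sup>2)"
  proof (rule cmean_cong)
    fix \<zeta> assume \<zeta>: "\<zeta> \<in> circle"
    define U where "U = (cmod (ev u \<zeta>))\<^sup>2"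
    have nz': "ev u \<zeta> \<noteq> 0" using nz[of \<zeta>] \<zeta> by auto
    then have U: "U > 0" by (simp add: U_def)
    have UU: "of_real U = ev u \<zeta> * cnj (ev u \<zeta>)" unfolding U_def by (rule complex_norm_square)
    define x where "x = ev h \<zeta> / ev u \<zeta>"
    define y where "y = ev ?v \<zeta> / ev u \<zeta>"
    define k where "k = ev ?k \<zeta> / ev u \<zeta>"
    have hvk: "ev h \<zeta> = x * ev u \<zeta>" "ev ?v \<zeta> = y * ev u \<zeta>" "ev ?k \<zeta> = k * ev u \<zeta>"
      using nz' by (simp_all add: x_def y_def k_def)
    have "poly nodal \<zeta> * g \<zeta> = (ev u \<zeta> * ev ?k \<zeta> - ev ?v \<zeta> * ev h \<zeta>) / (ev u \<zeta>)\<^sup>2"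
      unfolding g_def q1 q2 using nz' by (simp add: algebra_simps)
    also have "\<dots> = k - y * x"
      unfolding hvk using nz' by (simp add: power2_eq_square field_simps)
    finally have N: "poly nodal \<zeta> * g \<zeta> = k - y * x" .
    have e: "ev h \<zeta> * cnj (ev ?v \<zeta>) = of_real U * (x * cnj y)"
      "ev u \<zeta> * cnj (ev ?k \<zeta>) = of_real U * cnj k"
      "ev h \<zeta> * cnj (ev u \<zeta>) = of_real U * x" "ev u \<zeta> * cnj (ev ?v \<zeta>) = of_real U * cnj y"
      unfolding hvk UU by (simp_all add: mult_ac)
    have R: "Re (of_real U * c) = U * Re c" for c by simp
    have "Re (ev h \<zeta> * cnj (ev ?v \<zeta>)) + Re (ev u \<zeta> * cnj (ev ?k \<zeta>)) = 0"
      using eq \<zeta> unfolding spec_sum_eq_0_iff by blast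
    then have "U * (Re (x * cnj y) + Re k) = 0"
      unfolding e R by (simp only: distrib_left complex_cnj cnj.simps)
    then have "Re k = - Re (x * cnj y)" using U by (simp only: mult_eq_0_iff) linarith
    then have ReN: "Re (poly nodal \<zeta> * g \<zeta>) = - 2 * Re x * Re y" unfolding N by simp
    show "(- 2) *\<^sub>R I \<zeta> =
      Re (poly nodal \<zeta> * g \<zeta>) * Re (ev h \<zeta> * cnj (ev u \<zeta>)) / (cmod (tau \<zeta>))\<^sup>2"
      unfolding ReN I_def x_def[symmetric] e R by (simp add: power2_eq_square)
  qed
  also have "\<dots> = 0" by (rule cmean_Re_nodal_orthogonal[OF g])
  also have "cmean (\<lambda>\<zeta>. (- 2) *\<^sub>R I \<zeta>) = (- 2) *\<^sub>R cmean I"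
    by (rule cmean_linear[OF bounded_linear_scaleR_right cI])
  finally have I0: "cmean I = 0" by simp
  have "ev h \<zeta> = ev 0 \<zeta>" if \<zeta>: "\<zeta> \<in> circle" for \<zeta>
  proof -
    have "ev h \<zeta> / ev u \<zeta> = 0"
    proof (rule Re_zero_on_circle_imp_zero[OF _ _ _ \<zeta>])
      show "(\<lambda>\<zeta>. ev h \<zeta> / ev u \<zeta>) holomorphic_on cball 0 1" using nz by (intro holomorphic_intros) auto
      show "Im (ev h 0 / ev u 0) = 0" by (simp add: ev_0 flip: of_real_divide)
      show "Re (ev h \<zeta> / ev u \<zeta>) = 0" if \<zeta>: "\<zeta> \<in> circle" for \<zeta>
      proof -
        have "I \<zeta> = 0"
        proof (rule cmean_nonneg_eq_0[OF cI _ I0 \<zeta>])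
          fix x assume "x \<in> circle"
          from less_imp_le[OF pos[OF this]] show "0 \<le> I x"
            unfolding I_def by (intro divide_nonneg_nonneg mult_nonneg_nonneg zero_le_power2)
        qed
        then show ?thesis using pos[OF \<zeta>] tnz[OF \<zeta>] unfolding I_def by (simp del: times_complex.simps)
      qed
    qed
    then show ?thesis using nz[of \<zeta>] \<zeta> by auto
  qed
  then show ?thesis by (rule ev_eq_on_circle)
qed

section \<open>Positivity and degeneracy of the Pick matrix\<close>

lemma cmean_gen_nodal:
  assumes "g holomorphic_on cball 0 1"
  shows "cmean (\<lambda>\<zeta>. Re (poly nodal \<zeta> * g \<zeta>) * (cmod (gen y \<zeta>))\<^sup>2) = 0"
proof -
  note [continuous_intros] = holomorphic_cball_continuous_circle[OF assms]
    holomorphic_cball_continuous_circle[OF holomorphic_gen]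
  have "cmean (\<lambda>\<zeta>. Re (poly nodal \<zeta> * g \<zeta>) * (cmod (gen y \<zeta>))\<^sup>2) =
      cmean (\<lambda>\<zeta>. Re (poly nodal \<zeta> * (g \<zeta> * gen y \<zeta>) * cnj (gen y \<zeta>)))"
  proof (rule cmean_cong)
    fix \<zeta>
    have "poly nodal \<zeta> * (g \<zeta> * gen y \<zeta>) * cnj (gen y \<zeta>) =
        poly nodal \<zeta> * g \<zeta> * of_real ((cmod (gen y \<zeta>))\<^sup>2)"
      unfolding complex_norm_square by (simp add: mult_ac)
    then show "Re (poly nodal \<zeta> * g \<zeta>) * (cmod (gen y \<zeta>))\<^sup>2 =
        Re (poly nodal \<zeta> * (g \<zeta> * gen y \<zeta>) * cnj (gen y \<zeta>))"
      by (simp only: Re_complex_of_real times_complex.simps Im_complex_of_real)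
  qed
  also have "\<dots> = Re (cmean (\<lambda>\<zeta>. poly nodal \<zeta> * (g \<zeta> * gen y \<zeta>) * cnj (gen y \<zeta>)))"
    by (rule cmean_Re) (intro continuous_intros)
  also have "cmean (\<lambda>\<zeta>. poly nodal \<zeta> * (g \<zeta> * gen y \<zeta>) * cnj (gen y \<zeta>)) =
      cmean (\<lambda>\<zeta>. poly nodal \<zeta> * (g \<zeta> * gen y \<zeta>) * cnj (poly (gen_poly y) \<zeta> / tau \<zeta>))"
    by (rule cmean_cong) (simp add: gen_eq)
  also have "\<dots> = 0"
    by (rule cmean_nodal_orthogonal) (intro holomorphic_intros assms holomorphic_gen degree_gen_poly)+
  finally show ?thesis by simp
qed

text \<open>In the quadratic form the density \<open>2 * Re p\<close>, which may change sign, can be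
  replaced by the positive \<open>Re (mult_mod p u / u)\<close>: the two differ by the real part of
  \<open>nodal * g\<close>, which \<open>cmean_gen_nodal\<close> annihilates.\<close>

lemma pick_positive_definite:
  assumes nz: "\<And>\<zeta>. \<zeta> \<in> cball 0 1 \<Longrightarrow> ev u \<zeta> \<noteq> 0"
    and pos: "\<And>\<zeta>. \<zeta> \<in> circle \<Longrightarrow> 0 < Re (ev u \<zeta> * cnj (ev (mult_mod p u) \<zeta>))"
  shows "positive_definite (pick_matrix z idx (vdata p))"
  unfolding positive_definite_def
proof (intro conjI allI impI)
  show "adjoint_mat (pick_matrix z idx (vdata p)) = pick_matrix z idx (vdata p)"
    by (rule pick_matrix_hermitian[OF vdata_def])
next
  fix y :: "complex ^ 'i" assume y: "y \<noteq> 0"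
  let ?v = "mult_mod p u"
  obtain q1 where q1: "\<And>\<zeta>. ev ?v \<zeta> = 2 * ev p \<zeta> * ev u \<zeta> + poly nodal \<zeta> * poly q1 \<zeta>"
    using mult_mod_remainder by blast
  note [continuous_intros] = holomorphic_cball_continuous_circle[OF holomorphic_gen]
  define g where "g \<zeta> = poly q1 \<zeta> / ev u \<zeta>" for \<zeta>
  have g: "g holomorphic_on cball 0 1" unfolding g_def using nz by (intro holomorphic_intros) auto
  note [continuous_intros] = holomorphic_cball_continuous_circle[OF g]
  define I where "I \<zeta> = Re (ev ?v \<zeta> / ev u \<zeta>) * (cmod (gen y \<zeta>))\<^sup>2" for \<zeta>
  have cI: "continuous_on circle I" unfolding I_def using nz by (intro continuous_intros) auto
  have Re: "Re (ev ?v \<zeta> / ev u \<zeta>) > 0" if \<zeta>: "\<zeta> \<in> circle" for \<zeta>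
  proof -
    have "Re (ev ?v \<zeta> * cnj (ev u \<zeta>)) = Re (ev u \<zeta> * cnj (ev ?v \<zeta>))" by (simp add: mult.commute)
    moreover have "ev u \<zeta> \<noteq> 0" using nz[of \<zeta>] \<zeta> by auto
    moreover from this have "ev ?v \<zeta> / ev u \<zeta> = ev ?v \<zeta> * cnj (ev u \<zeta>) / of_real ((cmod (ev u \<zeta>))\<^sup>2)"
      unfolding complex_norm_square by simp
    ultimately show ?thesis
      using pos[OF \<zeta>] by (simp only: Re_divide_of_real) (intro divide_pos_pos, simp_all only: zero_less_power2 norm_eq_zero not_False_eq_True)
  qed
  have "Re (\<Sum>k\<in>UNIV. cnj (y $ k) * (pick_matrix z idx (vdata p) *v y) $ k) =
      cmean (\<lambda>\<zeta>. 2 * Re (ev p \<zeta>) * (cmod (gen y \<zeta>))\<^sup>2)"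
    unfolding cpoly_def by (rule pick_quadratic[OF vdata_def])
  also have "\<dots> = cmean (\<lambda>\<zeta>. I \<zeta> - Re (poly nodal \<zeta> * g \<zeta>) * (cmod (gen y \<zeta>))\<^sup>2)"
  proof (rule cmean_cong)
    fix \<zeta> assume "\<zeta> \<in> circle"
    then have "ev u \<zeta> \<noteq> 0" using nz[of \<zeta>] by auto
    then have "ev ?v \<zeta> / ev u \<zeta> = 2 * ev p \<zeta> + poly nodal \<zeta> * g \<zeta>"
      unfolding q1 g_def by (simp add: field_simps)
    then have "Re (ev ?v \<zeta> / ev u \<zeta>) = 2 * Re (ev p \<zeta>) + Re (poly nodal \<zeta> * g \<zeta>)"
      by simp
    then show "2 * Re (ev p \<zeta>) * (cmod (gen y \<zeta>))\<^sup>2 =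
        I \<zeta> - Re (poly nodal \<zeta> * g \<zeta>) * (cmod (gen y \<zeta>))\<^sup>2"
      unfolding I_def by (simp only: distrib_right)
  qed
  also have "\<dots> = cmean I"
    using cmean_gen_nodal[OF g] by (subst cmean_diff) (auto intro!: continuous_intros cI)
  also have "cmean I > 0"
  proof (rule ccontr)
    have I_ge: "0 \<le> I \<zeta>" if "\<zeta> \<in> circle" for \<zeta> unfolding I_def using Re[OF that] by simp
    assume "\<not> cmean I > 0"
    with cmean_nonneg[of I] I_ge have I0: "cmean I = 0" by force
    have "gen y \<zeta> = 0" if \<zeta>: "\<zeta> \<in> circle" for \<zeta>
    proof -
      have "I \<zeta> = 0" by (rule cmean_nonneg_eq_0[OF cI I_ge I0 \<zeta>])
      then show ?thesis using Re[OF \<zeta>] by (simp add: I_def)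
    qed
    then show False using gen_eq_0 y by blast
  qed
  finally show "0 < Re (\<Sum>k\<in>UNIV. cnj (y $ k) * (pick_matrix z idx (vdata p) *v y) $ k)" .
qed

text \<open>The vector representing \<open>u / tau\<close> is isotropic for the form. Multiplying
  the congruence by \<open>cnj u\<close>, rather than dividing by \<open>u\<close>, allows zeros of
  \<open>u\<close> on the circle.\<close>

lemma pick_not_positive_definite:
  assumes u: "u \<noteq> 0"
    and zero: "\<And>\<zeta>. \<zeta> \<in> circle \<Longrightarrow> Re (ev u \<zeta> * cnj (ev (mult_mod p u) \<zeta>)) = 0"
  shows "\<not> positive_definite (pick_matrix z idx (vdata p))"
proof
  assume pd: "positive_definite (pick_matrix z idx (vdata p))"
  let ?v = "mult_mod p u"
  obtain q1 where q1: "\<And>\<zeta>. ev ?v \<zeta> = 2 * ev p \<zeta> * ev u \<zeta> + poly nodal \<zeta> * poly q1 \<zeta>"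
    using mult_mod_remainder by blast
  obtain y where y: "\<And>\<zeta>. \<zeta> \<in> cball 0 1 \<Longrightarrow> gen y \<zeta> = poly (cp (vpoly u)) \<zeta> / tau \<zeta>"
    using gen_surj[of "cp (vpoly u)"] degree_vpoly[of u] by auto
  have tnz: "tau \<zeta> \<noteq> 0" if "\<zeta> \<in> circle" for \<zeta> using tau_nonzero that by auto
  have "y \<noteq> 0"
  proof
    assume "y = 0"
    then have "ev u \<zeta> = ev 0 \<zeta>" if "\<zeta> \<in> circle" for \<zeta>
      using y[of \<zeta>] tnz[OF that] that by (simp add: gen_def cpoly_def)
    then show False using ev_eq_on_circle u by blast
  qed
  with pd have "0 < Re (\<Sum>k\<in>UNIV. cnj (y $ k) * (pick_matrix z idx (vdata p) *v y) $ k)"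
    unfolding positive_definite_def by blast
  also have "\<dots> = cmean (\<lambda>\<zeta>. 2 * Re (ev p \<zeta>) * (cmod (gen y \<zeta>))\<^sup>2)"
    unfolding cpoly_def by (rule pick_quadratic[OF vdata_def])
  also have "\<dots> = cmean (\<lambda>\<zeta>. - Re (poly nodal \<zeta> * (poly q1 \<zeta> / tau \<zeta>) * cnj (poly (cp (vpoly u)) \<zeta> / tau \<zeta>)))"
  proof (rule cmean_cong)
    fix \<zeta> assume \<zeta>: "\<zeta> \<in> circle"
    define t where "t = (cmod (tau \<zeta>))\<^sup>2"
    have t: "complex_of_real t = tau \<zeta> * cnj (tau \<zeta>)" unfolding t_def by (rule complex_norm_square)
    have c: "of_real ((cmod (ev u \<zeta>))\<^sup>2) = ev u \<zeta> * cnj (ev u \<zeta>)" by (rule complex_norm_square)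
    have "Re (ev ?v \<zeta> * cnj (ev u \<zeta>)) = 0" using zero[OF \<zeta>] by (simp add: mult.commute)
    then have "2 * Re (ev p \<zeta> * of_real ((cmod (ev u \<zeta>))\<^sup>2)) = - Re (poly nodal \<zeta> * poly q1 \<zeta> * cnj (ev u \<zeta>))"
      unfolding q1 c by (simp add: algebra_simps)
    then have "2 * Re (ev p \<zeta>) * (cmod (ev u \<zeta>))\<^sup>2 = - Re (poly nodal \<zeta> * poly q1 \<zeta> * cnj (ev u \<zeta>))"
      by (simp add: mult.assoc)
    moreover have "(cmod (gen y \<zeta>))\<^sup>2 = (cmod (ev u \<zeta>))\<^sup>2 / t"
      using y[of \<zeta>] \<zeta> by (simp add: t_def norm_divide power_divide cpoly_def)
    moreover have "poly nodal \<zeta> * (poly q1 \<zeta> / tau \<zeta>) * cnj (poly (cp (vpoly u)) \<zeta> / tau \<zeta>) =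
       poly nodal \<zeta> * poly q1 \<zeta> * cnj (ev u \<zeta>) / of_real t"
      unfolding t cpoly_def by simp
    ultimately show "2 * Re (ev p \<zeta>) * (cmod (gen y \<zeta>))\<^sup>2 =
        - Re (poly nodal \<zeta> * (poly q1 \<zeta> / tau \<zeta>) * cnj (poly (cp (vpoly u)) \<zeta> / tau \<zeta>))"
      by (simp only: Re_divide_of_real) (metis minus_divide_left times_divide_eq_right)
  qed
  also have "\<dots> = - Re (cmean (\<lambda>\<zeta>. poly nodal \<zeta> * (poly q1 \<zeta> / tau \<zeta>) * cnj (poly (cp (vpoly u)) \<zeta> / tau \<zeta>)))"
    by (rule cmean_linear[OF bounded_linear_minus[OF bounded_linear_Re]]) (use tnz in \<open>intro continuous_intros; auto\<close>)
  also have "cmean (\<lambda>\<zeta>. poly nodal \<zeta> * (poly q1 \<zeta> / tau \<zeta>) * cnj (poly (cp (vpoly u)) \<zeta> / tau \<zeta>)) = 0"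
    using tau_nonzero degree_vpoly[of u] by (intro cmean_nodal_orthogonal holomorphic_intros) auto
  finally show False by simp
qed

end

section \<open>Coefficient vectors of positive real pairs\<close>

lemma has_fps_expansion_poly: "(\<lambda>x. poly q x) has_fps_expansion fps_of_poly q"
  for q :: "complex poly"
proof (induction q)
  case (pCons c q)
  have "(\<lambda>x. c + x * poly q x) has_fps_expansion fps_const c + fps_X * fps_of_poly q"
    by (intro fps_expansion_intros pCons.IH)
  then show ?case by (simp add: fps_of_poly_pCons mult.commute)
qed simp

lemma fps_mult_nth_eq_0:
  fixes H U :: "complex fps"
  assumes "\<And>k. k < l \<Longrightarrow> fps_nth H k = 0" "k < l"
  shows "fps_nth (H * U) k = 0"
  unfolding fps_mult_nth using assms by (intro sum.neutral) auto

lemma fps_mult_unit_nth_eq_0_iff: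
  fixes H U :: "complex fps"
  assumes "fps_nth U 0 \<noteq> 0"
  shows "(\<forall>k<l. fps_nth (H * U) k = 0) \<longleftrightarrow> (\<forall>k<l. fps_nth H k = 0)"
proof
  assume "\<forall>k<l. fps_nth (H * U) k = 0"
  then have "\<forall>k<l. fps_nth (H * U * inverse U) k = 0" using fps_mult_nth_eq_0[of l "H * U"] by blast
  moreover have "H * U * inverse U = H"
    using inverse_mult_eq_1'[OF assms] by (simp add: mult.assoc)
  ultimately show "\<forall>k<l. fps_nth H k = 0" by simp
qed (use fps_mult_nth_eq_0[of l H] in blast)

text \<open>In power series at \<open>a\<close>, \<open>B - 2 P A\<close> is twice (\<phi> minus
  \<open>P\<close>) times the series of \<open>A\<close>, which is a unit. Multiplication by a unit
  preserves vanishing of an initial segment of coefficients but not of single ones, hence the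
  quantifier inside both sides.\<close>

lemma higher_deriv_quotient_iff:
  fixes A B P :: "complex poly"
  assumes nz: "poly A a \<noteq> 0"
  defines "\<phi> \<equiv> \<lambda>\<zeta>. 1 / 2 * (poly B \<zeta> / poly A \<zeta>)"
  shows "(\<forall>k<l. (deriv ^^ k) \<phi> a / fact k = coeff (pcompose P [:a, 1:]) k) \<longleftrightarrow>
    (\<forall>k<l. coeff (pcompose (B - smult 2 (P * A)) [:a, 1:]) k = 0)"
proof -
  have "\<phi> analytic_on {a}"
    unfolding \<phi>_def using nz
    by (intro analytic_intros holomorphic_on_imp_analytic_at[of _ UNIV] holomorphic_poly) auto
  then have F: "(\<lambda>x. \<phi> (a + x)) has_fps_expansion fps_expansion \<phi> a" (is "_ has_fps_expansion ?F")
    by (rule analytic_at_imp_has_fps_expansion)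
  define T where "T = (\<lambda>q. fps_of_poly (pcompose q [:a, 1:]) :: complex fps)"
  have T: "(\<lambda>x. poly q (a + x)) has_fps_expansion T q" for q
    using has_fps_expansion_poly[of "pcompose q [:a, 1:]"] by (simp add: T_def poly_pcompose)
  have U0: "fps_nth (T A) 0 \<noteq> 0"
    using nz by (simp add: T_def poly_0_coeff_0[symmetric] poly_pcompose)
  have "(\<lambda>x. 2 * \<phi> (a + x) * poly A (a + x)) has_fps_expansion fps_const 2 * ?F * T A"
    by (intro fps_expansion_intros F T)
  moreover have "\<forall>\<^sub>F x in nhds 0. poly A (a + x) \<noteq> 0"
  proof -
    have "isCont (\<lambda>x. poly A (a + x)) 0" by (intro continuous_intros)
    then have "\<forall>\<^sub>F x in at 0. poly A (a + x) \<noteq> 0"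
      using nz by (auto simp: isCont_def intro: tendsto_imp_eventually_ne)
    then show ?thesis using nz by (simp add: eventually_nhds_conv_at)
  qed
  then have "\<forall>\<^sub>F x in nhds 0. 2 * \<phi> (a + x) * poly A (a + x) = poly B (a + x)"
    by eventually_elim (simp add: \<phi>_def)
  ultimately have "(\<lambda>x. poly B (a + x)) has_fps_expansion fps_const 2 * ?F * T A"
    by (subst (asm) has_fps_expansion_cong[OF _ refl])
  then have FB: "T B = fps_const 2 * ?F * T A"
    using fps_expansion_unique_complex[OF T] by blast
  have "T (B - smult 2 (P * A)) = T B - fps_const 2 * (T P * T A)"
    by (simp add: T_def pcompose_diff pcompose_smult pcompose_mult fps_of_poly_diff fps_of_poly_smult
        fps_of_poly_mult)
  also have "\<dots> = (fps_const 2 * (?F - T P)) * T A" unfolding FB by (simp add: algebra_simps)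
  finally have eq: "T (B - smult 2 (P * A)) = (fps_const 2 * (?F - T P)) * T A" .
  have "(\<forall>k<l. coeff (pcompose (B - smult 2 (P * A)) [:a, 1:]) k = 0) \<longleftrightarrow>
      (\<forall>k<l. fps_nth (T (B - smult 2 (P * A))) k = 0)" by (simp add: T_def)
  also have "\<dots> \<longleftrightarrow> (\<forall>k<l. fps_nth (fps_const 2 * (?F - T P)) k = 0)"
    unfolding eq by (rule fps_mult_unit_nth_eq_0_iff[OF U0])
  also have "\<dots> \<longleftrightarrow> (\<forall>k<l. (deriv ^^ k) \<phi> a / fact k = coeff (pcompose P [:a, 1:]) k)"
    by (simp add: T_def fps_expansion_def times_divide_eq_right[symmetric] del: times_divide_eq_right)
  finally show ?thesis by simp
qed

context pick_data
begin

lemma poly_of_vec_eq: "poly_of_vec n \<mu> idx u = rpoly u"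
  by (simp add: poly_of_vec_def rpoly_def rank_def)

lemma coeff_rpoly: "coeff (rpoly u) (n - rank i) = u $ i"
proof -
  have "n - rank i' = n - rank i \<longleftrightarrow> i' = i" for i'
    using rank_le[of i] rank_le[of i'] rank_eq_iff[of i' i] by linarith
  then show ?thesis by (simp add: rpoly_def coeff_sum if_distrib cong: if_cong)
qed

lemma rpoly_surj:
  assumes "degree p \<le> n" shows "rpoly (\<chi> i. coeff p (n - rank i)) = p"
proof (rule poly_eqI)
  fix k
  show "coeff (rpoly (\<chi> i. coeff p (n - rank i))) k = coeff p k"
  proof (cases "k \<le> n")
    case True
    then obtain i where "rank i = n - k" using rank_surj[of "n - k"] by auto
    then have "k = n - rank i" using True by simp
    then show ?thesis by (simp add: coeff_rpoly)
  next
    case False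
    then show ?thesis
      using assms degree_rpoly[of "\<chi> i. coeff p (n - rank i)"] by (simp add: coeff_eq_0)
  qed
qed

lemma coeff_rpoly_n: "coeff (rpoly u) n = u $ i0"
  using coeff_rpoly[of u i0] by simp

lemma degree_rpoly_eq: "u $ i0 \<noteq> 0 \<Longrightarrow> degree (rpoly u) = n"
  using degree_rpoly[of u] le_degree[of "rpoly u" n] by (simp add: coeff_rpoly_n)

text \<open>\<open>reflect_poly\<close> reverses with respect to the actual degree; this is
  \<open>n\<close> because \<open>u $ i0\<close> is the coefficient of the top power.\<close>

lemma reflect_rpoly: "u $ i0 \<noteq> 0 \<Longrightarrow> reflect_poly (rpoly u) = vpoly u"
proof (rule poly_eqI)
  fix k assume u: "u $ i0 \<noteq> 0"
  show "coeff (reflect_poly (rpoly u)) k = coeff (vpoly u) k"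
  proof (cases "k \<le> n")
    case True
    then obtain i where "rank i = k" using rank_surj by blast
    then show ?thesis using True coeff_rpoly[of u i] coeff_vpoly[of u i]
      by (simp add: coeff_reflect_poly degree_rpoly_eq[OF u])
  next
    case False
    then show ?thesis using degree_vpoly[of u]
      by (simp add: coeff_reflect_poly degree_rpoly_eq[OF u] coeff_eq_0 order_le_less_trans)
  qed
qed

lemma interpolant_rpoly:
  "u $ i0 = 1 \<Longrightarrow> v $ i0 = 1 \<Longrightarrow> interpolant (rpoly u) (rpoly v) \<zeta> = 1 / 2 * (ev v \<zeta> / ev u \<zeta>)"
  by (simp add: interpolant_def reflect_rpoly)

lemma schur_iff:
  "rpoly u \<in> schur_polys n \<longleftrightarrow> u $ i0 = 1 \<and> (\<forall>\<zeta>\<in>cball 0 1. ev u \<zeta> \<noteq> 0)"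
proof
  assume *: "rpoly u \<in> schur_polys n"
  then have u: "u $ i0 = 1" using coeff_rpoly_n[of u] by (auto simp: schur_polys_def)
  have "ev u \<zeta> \<noteq> 0" if \<zeta>: "\<zeta> \<in> cball 0 1" for \<zeta>
  proof (cases "\<zeta> = 0")
    case False
    show ?thesis
    proof
      assume "ev u \<zeta> = 0"
      then have "cpoly (rpoly u) (inverse \<zeta>) = 0" using cpoly_rpoly[of "inverse \<zeta>" u] False by simp
      then have "cmod (inverse \<zeta>) < 1" using * by (simp add: schur_polys_def)
      then have "1 < cmod \<zeta>" using False by (simp add: norm_inverse inverse_less_1_iff)
      then show False using \<zeta> by simp
    qed
  qed (simp add: ev_0 u)
  with u show "u $ i0 = 1 \<and> (\<forall>\<zeta>\<in>cball 0 1. ev u \<zeta> \<noteq> 0)" by blast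
next
  assume *: "u $ i0 = 1 \<and> (\<forall>\<zeta>\<in>cball 0 1. ev u \<zeta> \<noteq> 0)"
  have "cmod \<zeta> < 1" if "cpoly (rpoly u) \<zeta> = 0" for \<zeta>
  proof (rule ccontr)
    assume "\<not> cmod \<zeta> < 1"
    then have "\<zeta> \<noteq> 0" "inverse \<zeta> \<in> cball 0 1" by (auto simp: norm_inverse inverse_le_1_iff)
    then show False using that * cpoly_rpoly[of \<zeta> u] by simp
  qed
  then show "rpoly u \<in> schur_polys n"
    using * degree_rpoly_eq[of u] coeff_rpoly_n[of u] by (simp add: schur_polys_def)
qed

lemma spec_poly_eq_iff: "spec_poly u v = smult c (spec_poly s s) \<longleftrightarrow> spec u v = c *\<^sub>R spec s s"
proof
  assume "spec_poly u v = smult c (spec_poly s s)"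
  then show "spec u v = c *\<^sub>R spec s s" by (simp add: spec_def vec_eq_iff)
next
  assume *: "spec u v = c *\<^sub>R spec s s"
  have "cp (spec_poly u v) = cp (smult c (spec_poly s s))"
  proof (rule poly_eq_on_circle)
    fix \<zeta> assume \<zeta>: "\<zeta> \<in> circle"
    have "Re (ev u \<zeta> * cnj (ev v \<zeta>)) = c * Re (ev s \<zeta> * cnj (ev s \<zeta>))"
      using * \<zeta> unfolding spec_eq_scaled_iff complex_norm_square[symmetric] by simp
    then have "cpoly (spec_poly u v) \<zeta> = of_real c * cpoly (spec_poly s s) \<zeta>"
      unfolding cpoly_spec_poly_circle[OF \<zeta>] by (simp only: of_real_mult mult_ac)
    then show "poly (cp (spec_poly u v)) \<zeta> = poly (cp (smult c (spec_poly s s))) \<zeta>"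
      by (simp add: cpoly_def cp_smult)
  qed
  then show "spec_poly u v = smult c (spec_poly s s)" by simp
qed

lemma spectral_condition_iff:
  "spectral_condition (rpoly s) (rpoly u) (rpoly v) \<longleftrightarrow> (\<exists>c>0. spec u v = c *\<^sub>R spec s s)"
proof -
  have lhs: "cpoly (rpoly u) \<zeta> * cpoly (rpoly v) (inverse \<zeta>) + cpoly (rpoly v) \<zeta> * cpoly (rpoly u) (inverse \<zeta>)
      = inverse \<zeta> ^ n * cpoly (spec_poly u v) \<zeta>" if "\<zeta> \<noteq> 0" for u v \<zeta>
    unfolding spec_poly_def cpoly_add cpoly_mult using that cpoly_rpoly[of "inverse \<zeta>"]
    by (simp add: algebra_simps)
  have rhs: "2 * (complex_of_real \<rho>)\<^sup>2 * cpoly (rpoly s) \<zeta> * cpoly (rpoly s) (inverse \<zeta>) =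
      inverse \<zeta> ^ n * cpoly (smult (\<rho>\<^sup>2) (spec_poly s s)) \<zeta>" if "\<zeta> \<noteq> 0" for \<rho> \<zeta>
  proof -
    have "cpoly (smult (\<rho>\<^sup>2) (spec_poly s s)) \<zeta> = (of_real \<rho>)\<^sup>2 * cpoly (spec_poly s s) \<zeta>"
      by (simp add: cpoly_def cp_smult)
    then show ?thesis using lhs[OF that, of s s] by (simp add: algebra_simps)
  qed
  have "(\<forall>\<zeta>. \<zeta> \<noteq> 0 \<longrightarrow> cpoly (rpoly u) \<zeta> * cpoly (rpoly v) (inverse \<zeta>) + cpoly (rpoly v) \<zeta> * cpoly (rpoly u) (inverse \<zeta>)
      = 2 * (complex_of_real \<rho>)\<^sup>2 * cpoly (rpoly s) \<zeta> * cpoly (rpoly s) (inverse \<zeta>)) \<longleftrightarrow>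
      spec u v = \<rho>\<^sup>2 *\<^sub>R spec s s" (is "?L \<longleftrightarrow> _") for \<rho>
  proof -
    have "?L \<longleftrightarrow> (\<forall>\<zeta>. \<zeta> \<noteq> 0 \<longrightarrow> cpoly (spec_poly u v) \<zeta> = cpoly (smult (\<rho>\<^sup>2) (spec_poly s s)) \<zeta>)"
      using lhs rhs by auto
    also have "\<dots> \<longleftrightarrow> spec_poly u v = smult (\<rho>\<^sup>2) (spec_poly s s)"
    proof
      assume *: "\<forall>\<zeta>. \<zeta> \<noteq> 0 \<longrightarrow> cpoly (spec_poly u v) \<zeta> = cpoly (smult (\<rho>\<^sup>2) (spec_poly s s)) \<zeta>"
      have "cp (spec_poly u v) = cp (smult (\<rho>\<^sup>2) (spec_poly s s))"
        using * circle_nonzero by (intro poly_eq_on_circle) (auto simp: cpoly_def)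
      then show "spec_poly u v = smult (\<rho>\<^sup>2) (spec_poly s s)" by (simp only: cp_eq_iff)
    qed simp
    finally show ?thesis by (simp only: spec_poly_eq_iff)
  qed
  then have "spectral_condition (rpoly s) (rpoly u) (rpoly v) \<longleftrightarrow> (\<exists>\<rho>>0. spec u v = \<rho>\<^sup>2 *\<^sub>R spec s s)"
    unfolding spectral_condition_def by simp
  also have "\<dots> \<longleftrightarrow> (\<exists>c>0. spec u v = c *\<^sub>R spec s s)"
    by (metis real_sqrt_gt_0_iff real_sqrt_pow2 less_imp_le zero_less_power)
  finally show ?thesis .
qed

text \<open>The Schur property of the second polynomial and positive realness need not be imposed:
  the spectral equation makes \<open>Re (v / u)\<close> positive on the circle, the minimum
  principle extends this to the disc, and so \<open>v\<close> has no zeros there.\<close>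

lemma P_space_iff:
  "(rpoly u, rpoly v) \<in> P_space n \<and> spectral_condition (rpoly s) (rpoly u) (rpoly v) \<longleftrightarrow>
    u $ i0 = 1 \<and> v $ i0 = 1 \<and> (\<forall>\<zeta>\<in>cball 0 1. ev u \<zeta> \<noteq> 0) \<and> (\<exists>c>0. spec u v = c *\<^sub>R spec s s)"
  if s: "\<And>\<zeta>. \<zeta> \<in> circle \<Longrightarrow> ev s \<zeta> \<noteq> 0"
proof
  assume "(rpoly u, rpoly v) \<in> P_space n \<and> spectral_condition (rpoly s) (rpoly u) (rpoly v)"
  then show "u $ i0 = 1 \<and> v $ i0 = 1 \<and> (\<forall>\<zeta>\<in>cball 0 1. ev u \<zeta> \<noteq> 0) \<and> (\<exists>c>0. spec u v = c *\<^sub>R spec s s)"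
    by (auto simp: P_space_def schur_iff spectral_condition_iff)
next
  assume *: "u $ i0 = 1 \<and> v $ i0 = 1 \<and> (\<forall>\<zeta>\<in>cball 0 1. ev u \<zeta> \<noteq> 0) \<and> (\<exists>c>0. spec u v = c *\<^sub>R spec s s)"
  then obtain c where c: "c > 0" "spec u v = c *\<^sub>R spec s s" by blast
  have nz: "ev u \<zeta> \<noteq> 0" if "\<zeta> \<in> cball 0 1" for \<zeta> using * that by blast
  have hol: "(\<lambda>\<zeta>. ev v \<zeta> / ev u \<zeta>) holomorphic_on cball 0 1" using nz by (intro holomorphic_intros)
  have pos: "0 < Re (ev v \<zeta> / ev u \<zeta>)" if "\<zeta> \<in> cball 0 1" for \<zeta>
  proof (rule Re_pos_cball[OF hol _ that])
    fix \<zeta> assume \<zeta>: "\<zeta> \<in> circle"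
    have nz': "ev u \<zeta> \<noteq> 0" using nz[of \<zeta>] \<zeta> by auto
    have "Re (ev v \<zeta> * cnj (ev u \<zeta>)) = Re (ev u \<zeta> * cnj (ev v \<zeta>))" by (simp add: mult.commute)
    also have "\<dots> = c * (cmod (ev s \<zeta>))\<^sup>2" using c(2) \<zeta> unfolding spec_eq_scaled_iff by blast
    also have "\<dots> > 0" using c(1) s[OF \<zeta>] by simp
    finally have "Re (ev v \<zeta> * cnj (ev u \<zeta>)) > 0" .
    moreover have "ev v \<zeta> / ev u \<zeta> = ev v \<zeta> * cnj (ev u \<zeta>) / of_real ((cmod (ev u \<zeta>))\<^sup>2)"
      unfolding complex_norm_square using nz' by simp
    ultimately show "0 < Re (ev v \<zeta> / ev u \<zeta>)"
      using nz' by (simp only: Re_divide_of_real) (intro divide_pos_pos, simp_all only: zero_less_power2 norm_eq_zero not_False_eq_True)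
  qed
  have nzv: "\<forall>\<zeta>\<in>cball 0 1. ev v \<zeta> \<noteq> 0" using pos by (metis div_0 less_irrefl zero_complex.simps(1))
  have sch: "rpoly u \<in> schur_polys n" "rpoly v \<in> schur_polys n" using * nzv by (simp_all add: schur_iff)
  have op: "open {\<zeta>. 1 < cmod \<zeta>}" by (intro open_Collect_less continuous_intros)
  have "strictly_positive_real (\<lambda>\<zeta>. cpoly (rpoly v) \<zeta> / cpoly (rpoly u) \<zeta>)"
    unfolding strictly_positive_real_def analytic_on_open[OF op]
  proof (intro conjI allI impI)
    show "(\<lambda>\<zeta>. cpoly (rpoly v) \<zeta> / cpoly (rpoly u) \<zeta>) holomorphic_on {\<zeta>. 1 < cmod \<zeta>}"
      using sch(1) by (intro holomorphic_intros) (auto simp: schur_polys_def)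
    fix \<zeta> assume "1 < cmod \<zeta>"
    then have "\<zeta> \<noteq> 0" "inverse \<zeta> \<in> cball 0 1" by (auto simp: norm_inverse inverse_le_1_iff)
    then show "0 < Re (cpoly (rpoly v) \<zeta> / cpoly (rpoly u) \<zeta>)"
      using pos[of "inverse \<zeta>"] by (simp add: cpoly_rpoly)
  qed
  then show "(rpoly u, rpoly v) \<in> P_space n \<and> spectral_condition (rpoly s) (rpoly u) (rpoly v)"
    using sch c by (auto simp: P_space_def spectral_condition_iff)
qed

lemma data_of_interpolant_iff:
  assumes u: "u $ i0 = 1" "v $ i0 = 1" and nz: "\<And>\<zeta>. \<zeta> \<in> cball 0 1 \<Longrightarrow> ev u \<zeta> \<noteq> 0"
  shows "data_of z idx (interpolant (rpoly u) (rpoly v)) = vdata p \<longleftrightarrow> v = mult_mod p u"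
proof -
  define \<phi> where "\<phi> = (\<lambda>\<zeta>. 1 / 2 * (poly (cp (vpoly v)) \<zeta> / poly (cp (vpoly u)) \<zeta>))"
  let ?D = "cp (vpoly v) - smult 2 (cp (vpoly p) * cp (vpoly u))"
  have \<phi>: "interpolant (rpoly u) (rpoly v) = \<phi>"
    using interpolant_rpoly[OF u] by (simp add: \<phi>_def cpoly_def fun_eq_iff)
  have all: "(\<forall>i. Q (fst (idx i)) (snd (idx i))) \<longleftrightarrow> (\<forall>j\<le>m. \<forall>k<\<mu> j. Q j k)" for Q
  proof (intro iffI allI impI)
    fix j k assume "\<forall>i. Q (fst (idx i)) (snd (idx i))" "j \<le> m" "k < \<mu> j"
    then show "Q j k" using idx_inv[of j k] by (metis fst_conv snd_conv)
  next
    fix i assume "\<forall>j\<le>m. \<forall>k<\<mu> j. Q j k"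
    then show "Q (fst (idx i)) (snd (idx i))" using idx_in[of i] by (simp add: ordr_def)
  qed
  have "data_of z idx \<phi> = vdata p \<longleftrightarrow> (\<forall>i. (deriv ^^ snd (idx i)) \<phi> (z (fst (idx i))) / fact (snd (idx i)) =
      coeff (pcompose (cp (vpoly p)) [:z (fst (idx i)), 1:]) (snd (idx i)))"
    by (simp add: data_of_def vdata_def hdata_def vec_eq_iff node_def ordr_def case_prod_unfold Let_def)
  also have "\<dots> \<longleftrightarrow> (\<forall>j\<le>m. \<forall>k<\<mu> j. (deriv ^^ k) \<phi> (z j) / fact k = coeff (pcompose (cp (vpoly p)) [:z j, 1:]) k)"
    by (rule all)
  also have "\<dots> \<longleftrightarrow> (\<forall>j\<le>m. \<forall>k<\<mu> j. coeff (pcompose ?D [:z j, 1:]) k = 0)"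
  proof (rule all_cong)
    fix j assume "j \<le> m"
    then have "poly (cp (vpoly u)) (z j) \<noteq> 0"
      using nz[of "z j"] z_disc[of j] by (simp add: cpoly_def less_imp_le)
    from higher_deriv_quotient_iff[OF this] show
      "(\<forall>k<\<mu> j. (deriv ^^ k) \<phi> (z j) / fact k = coeff (pcompose (cp (vpoly p)) [:z j, 1:]) k) =
       (\<forall>k<\<mu> j. coeff (pcompose ?D [:z j, 1:]) k = 0)" unfolding \<phi>_def .
  qed
  also have "\<dots> \<longleftrightarrow> (\<forall>i. coeff (pcompose ?D [:z (fst (idx i)), 1:]) (snd (idx i)) = 0)"
    by (rule all[symmetric])
  also have "\<dots> \<longleftrightarrow> hdata ?D = 0"
    by (simp add: hdata_def vec_eq_iff node_def ordr_def)
  finally show ?thesis unfolding \<phi> mult_mod_iff hdata_eq_0_iff .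
qed

end

section \<open>The parametrization is a diffeomorphism\<close>

text \<open>Splitting off one linear factor with root in the disc at most doubles the coefficient
  bound and costs at most a factor \<open>cmod x - 1\<close> in the lower bound. Both bounds depend
  only on the degree, so they survive limits.\<close>

lemma monic_poly_bounds:
  fixes p :: "complex poly"
  assumes "lead_coeff p = 1" "\<And>\<zeta>. poly p \<zeta> = 0 \<Longrightarrow> cmod \<zeta> < 1"
  shows "cmod (coeff p k) \<le> 2 ^ degree p" "1 \<le> cmod x \<Longrightarrow> (cmod x - 1) ^ degree p \<le> cmod (poly p x)"
proof -
  have "(\<forall>k. cmod (coeff p k) \<le> 2 ^ N) \<and> (\<forall>x. 1 \<le> cmod x \<longrightarrow> (cmod x - 1) ^ N \<le> cmod (poly p x))"
    if "degree p = N" "lead_coeff p = 1" "\<And>\<zeta>. poly p \<zeta> = 0 \<Longrightarrow> cmod \<zeta> < 1" for N and p :: "complex poly"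
    using that
  proof (induction N arbitrary: p)
    case 0
    obtain c where p: "p = [:c:]" using "0.prems"(1) by (rule degree_eq_zeroE)
    have "c = 1" using "0.prems"(2) unfolding p by simp
    then show ?case unfolding p by (simp add: coeff_pCons split: nat.split)
  next
    case (Suc N)
    have "\<not> constant (poly p)" unfolding constant_degree Suc.prems(1) by simp
    from Fundamental_Theorem_Algebra.fundamental_theorem_of_algebra[OF this] obtain r where r: "poly p r = 0" ..
    then obtain q where q: "p = [:-r, 1:] * q" by (auto simp: poly_eq_0_iff_dvd)
    have "q \<noteq> 0" using Suc.prems(1) q by auto
    then have deg: "degree q = N" using Suc.prems(1) unfolding q by (subst (asm) degree_mult_eq) auto
    have lead: "lead_coeff q = 1" using Suc.prems(2) unfolding q lead_coeff_mult by simp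
    have IH: "(\<forall>k. cmod (coeff q k) \<le> 2 ^ N) \<and> (\<forall>x. 1 \<le> cmod x \<longrightarrow> (cmod x - 1) ^ N \<le> cmod (poly q x))"
      by (rule Suc.IH[OF deg lead]) (rule Suc.prems(3), simp add: q)
    have r1: "cmod r < 1" using Suc.prems(3) r by blast
    have "cmod (coeff p k) \<le> 2 ^ Suc N" for k
    proof -
      have "coeff p k = (if k = 0 then 0 else coeff q (k - 1)) - r * coeff q k"
        unfolding q by (cases k) simp_all
      then have "cmod (coeff p k) \<le> cmod (if k = 0 then 0 else coeff q (k - 1)) + cmod (r * coeff q k)"
        by (metis norm_triangle_ineq4)
      also have "\<dots> \<le> 2 ^ N + 1 * 2 ^ N"
        using IH r1 unfolding norm_mult by (intro add_mono mult_mono) auto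
      finally show ?thesis by simp
    qed
    moreover have "(cmod x - 1) ^ Suc N \<le> cmod (poly p x)" if "1 \<le> cmod x" for x
    proof -
      have "cmod x - 1 \<le> cmod (x - r)" using norm_triangle_ineq2[of x r] r1 by simp
      then have "(cmod x - 1) * (cmod x - 1) ^ N \<le> cmod (x - r) * cmod (poly q x)"
        using IH that by (intro mult_mono) auto
      moreover have "poly p x = (x - r) * poly q x" unfolding q by (simp add: algebra_simps)
      ultimately show ?thesis by (simp add: norm_mult)
    qed
    ultimately show ?case by blast
  qed
  from this[OF refl assms]
  show "cmod (coeff p k) \<le> 2 ^ degree p" "1 \<le> cmod x \<Longrightarrow> (cmod x - 1) ^ degree p \<le> cmod (poly p x)"
    by blast+
qed

section \<open>The data map for a fixed Schur polynomial\<close>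

locale pick_sigma = pick_data m n z \<mu> idx
  for m n z \<mu> and idx :: "'i::finite \<Rightarrow> nat \<times> nat" +
  fixes \<sigma> :: "real poly"
  assumes \<sigma>_schur: "\<sigma> \<in> schur_polys n"
begin

definition sv :: "real ^ 'i" where "sv = (\<chi> i. coeff \<sigma> (n - rank i))"

lemma rpoly_sv: "rpoly sv = \<sigma>"
  unfolding sv_def using \<sigma>_schur by (intro rpoly_surj) (simp add: schur_polys_def)

lemma sv_i0: "sv $ i0 = 1" and ev_sv: "\<zeta> \<in> cball 0 1 \<Longrightarrow> ev sv \<zeta> \<noteq> 0"
  using schur_iff[of sv] \<sigma>_schur rpoly_sv by auto

lemma ev_sv_circle: "\<zeta> \<in> circle \<Longrightarrow> ev sv \<zeta> \<noteq> 0"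
  using ev_sv by auto

definition sol :: "(real ^ 'i) \<times> (real ^ 'i) \<Rightarrow> bool" where
  "sol = (\<lambda>(u, v). u $ i0 = 1 \<and> v $ i0 = 1 \<and> (\<forall>\<zeta>\<in>cball 0 1. ev u \<zeta> \<noteq> 0)
     \<and> (\<exists>c>0. spec u v = c *\<^sub>R spec sv sv))"

abbreviation S :: "((real ^ 'i) \<times> (real ^ 'i)) set" where "S \<equiv> P_sigma_vec n \<mu> idx \<sigma>"

abbreviation W :: "(complex ^ 'i) set" where "W \<equiv> W_plus m z \<mu> idx"

definition F :: "(real ^ 'i) \<times> (real ^ 'i) \<Rightarrow> complex ^ 'i" where
  "F = (\<lambda>(u, v). data_of z idx (interpolant (poly_of_vec n \<mu> idx u) (poly_of_vec n \<mu> idx v)))"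

lemma P_sigma_iff: "(rpoly u, rpoly v) \<in> P_sigma n \<sigma> \<longleftrightarrow> sol (u, v)"
  using P_space_iff[OF ev_sv_circle, of u v] unfolding P_sigma_def rpoly_sv sol_def by simp

lemma S_iff: "(u, v) \<in> S \<longleftrightarrow> sol (u, v)"
  by (simp add: P_sigma_vec_def poly_of_vec_eq P_sigma_iff)

lemma F_eq_iff: "sol (u, v) \<Longrightarrow> F (u, v) = vdata p \<longleftrightarrow> v = mult_mod p u"
  unfolding F_def prod.case poly_of_vec_eq
  by (rule data_of_interpolant_iff) (auto simp: sol_def)

lemma sol_pos:
  assumes "sol (u, v)" "\<zeta> \<in> circle"
  shows "0 < Re (ev u \<zeta> * cnj (ev v \<zeta>))"
proof -
  obtain c where c: "c > 0" "spec u v = c *\<^sub>R spec sv sv" using assms by (auto simp: sol_def)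
  then have "Re (ev u \<zeta> * cnj (ev v \<zeta>)) = c * (cmod (ev sv \<zeta>))\<^sup>2"
    using assms(2) unfolding spec_eq_scaled_iff by blast
  then show ?thesis using c(1) ev_sv_circle[OF assms(2)] by simp
qed

definition mult_mat :: "real ^ 'i \<Rightarrow> real ^ 'i ^ 'i" where
  "mult_mat u = matrix (\<lambda>p. mult_mod p u)"

lemma mult_mat: "mult_mat u *v p = mult_mod p u"
proof -
  have "linear (\<lambda>p. mult_mod p u)"
    using bounded_bilinear.bounded_linear_left[OF bounded_bilinear_mult_mod] by (rule bounded_linear.linear)
  then show ?thesis unfolding mult_mat_def
    by (intro matrix_works) (simp add: linear_matrix_vector_mul_eq)
qed

text \<open>If \<open>nodal\<close> divides the product of \<open>p\<close> and \<open>u\<close>,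
  and \<open>u\<close> has no zeros at the nodes, then \<open>nodal\<close> divides
  \<open>p\<close>, which is impossible for a nonzero \<open>p\<close> of degree at most
  \<open>n\<close>.\<close>

lemma det_mult_mat:
  assumes "\<And>\<zeta>. \<zeta> \<in> cball 0 1 \<Longrightarrow> ev u \<zeta> \<noteq> 0"
  shows "det (mult_mat u) \<noteq> 0"
  unfolding det_nonzero_iff_injective mult_mat
proof safe
  fix p assume "mult_mod p u = 0"
  then have "nodal dvd cp (vpoly 0) - smult 2 (cp (vpoly p) * cp (vpoly u))"
    using mult_mod_iff[of 0 p u] by simp
  then have dvd: "nodal dvd cp (vpoly u) * cp (vpoly p)"
    by (simp add: dvd_smult_iff mult.commute)
  have "nodal dvd cp (vpoly p)"
    unfolding nodal_def
  proof (rule prod_linear_power_dvd)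
    fix j assume j: "j \<in> {..m}"
    then have "[:- z j, 1:] ^ \<mu> j dvd nodal" unfolding nodal_def by (intro dvd_prodI) auto
    then have "[:- z j, 1:] ^ \<mu> j dvd cp (vpoly u) * cp (vpoly p)" using dvd dvd_trans by blast
    moreover have "poly (cp (vpoly u)) (z j) \<noteq> 0"
      using assms[of "z j"] z_disc[of j] j by (simp add: cpoly_def less_imp_le)
    ultimately show "[:- z j, 1:] ^ \<mu> j dvd cp (vpoly p)" by (rule dvd_mult_linear_power)
  qed (use z_inj in auto)
  then have "cp (vpoly p) = 0" using degree_vpoly[of p] by (intro hdata_inj) (simp_all add: hdata_eq_0_iff)
  then show "p = 0" by simp
qed

text \<open>The Hermite polynomial recovered from the pair: \<open>F\<close> agrees with
  \<open>vdata\<close> after \<open>param\<close> on \<open>S\<close>, and unlike \<open>F\<close>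
  this is a solution of a linear system with coefficients linear in \<open>u\<close>.\<close>

definition param :: "(real ^ 'i) \<times> (real ^ 'i) \<Rightarrow> real ^ 'i" where
  "param = (\<lambda>(u, v). matrix_inv (mult_mat u) *v v)"

lemma mult_mod_param: "det (mult_mat u) \<noteq> 0 \<Longrightarrow> mult_mod (param (u, v)) u = v"
proof -
  assume "det (mult_mat u) \<noteq> 0"
  then have "\<exists>B. mult_mat u ** B = mat 1 \<and> B ** mult_mat u = mat 1"
    unfolding invertible_det_nz[symmetric] invertible_def .
  then have "mult_mat u ** matrix_inv (mult_mat u) = mat 1"
    unfolding matrix_inv_def by (rule someI2_ex) blast
  then show ?thesis
    unfolding mult_mat[symmetric] param_def by (simp add: matrix_vector_mul_assoc)
qed

lemma sol_param:
  assumes "sol (u, v)" shows "mult_mod (param (u, v)) u = v" "F (u, v) = vdata (param (u, v))"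
proof -
  show 1: "mult_mod (param (u, v)) u = v"
    using assms by (intro mult_mod_param det_mult_mat) (auto simp: sol_def)
  show "F (u, v) = vdata (param (u, v))" using F_eq_iff[OF assms] 1 by metis
qed

text \<open>The origin is a node, so the congruence modulo \<open>nodal\<close> is an equality at 0.
  With \<open>p $ i0 = 1 / 2\<close> it says that the two polynomials of a pair have equal leading
  coefficients.\<close>

lemma mult_mod_i0: "mult_mod p u $ i0 = 2 * p $ i0 * u $ i0"
proof -
  obtain h where h: "\<And>\<zeta>. ev (mult_mod p u) \<zeta> = 2 * ev p \<zeta> * ev u \<zeta> + poly nodal \<zeta> * poly h \<zeta>"
    using mult_mod_remainder by blast
  have "poly nodal 0 = 0"
    using \<mu>_pos[of 0] z_0 by (auto simp: nodal_def poly_prod intro!: prod_zero bexI[of _ 0])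
  then have "complex_of_real (mult_mod p u $ i0) = of_real (2 * p $ i0 * u $ i0)"
    using h[of 0] by (simp add: ev_0)
  then show ?thesis by (simp only: of_real_eq_iff)
qed

lemma vdata_i0: "vdata p $ i0 = of_real (p $ i0)"
proof -
  have "coeff (pcompose (cp (vpoly p)) [:0, 1:]) 0 = of_real (p $ i0)"
    using coeff_vpoly[of p i0] by simp
  then show ?thesis by (simp add: vdata_def hdata_def node_def ordr_def z_0)
qed

lemma entry_0: "entry idx w 0 0 = w $ i0"
  by (simp add: entry_def i0_def)

lemma W_iff: "w \<in> W \<longleftrightarrow> conj_sym w \<and> w $ i0 = 1 / 2 \<and> positive_definite (pick_matrix z idx w)"
  by (auto simp: W_plus_def data_vectors_def conj_sym_def entry_0)

lemma vdata_W_iff: "vdata p \<in> W \<longleftrightarrow> p $ i0 = 1 / 2 \<and> positive_definite (pick_matrix z idx (vdata p))"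
proof -
  have "complex_of_real (p $ i0) = 1 / 2 \<longleftrightarrow> p $ i0 = 1 / 2"
    by (metis of_real_1 of_real_divide of_real_eq_iff of_real_numeral)
  then show ?thesis
    unfolding W_iff vdata_i0 using conj_sym_hdata_cp[of "vpoly p"] by (simp add: vdata_def)
qed

lemma F_in_W: assumes "sol (u, v)" shows "F (u, v) \<in> W"
  unfolding sol_param(2)[OF assms] vdata_W_iff
proof
  let ?p = "param (u, v)"
  have eq: "mult_mod ?p u = v" by (rule sol_param(1)[OF assms])
  have "u $ i0 = 1" "v $ i0 = 1" using assms by (auto simp: sol_def)
  then show "?p $ i0 = 1 / 2" using mult_mod_i0[of ?p u] unfolding eq by simp
  show "positive_definite (pick_matrix z idx (vdata ?p))"
    by (rule pick_positive_definite[of u]) (use assms sol_pos[OF assms] in \<open>auto simp: eq sol_def\<close>)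
qed

lemma F_inj: "inj_on F S"
proof (rule inj_onI)
  fix x y assume "x \<in> S" "y \<in> S" "F x = F y"
  then obtain u1 v1 u2 v2 where xy: "x = (u1, v1)" "y = (u2, v2)" and sol: "sol (u1, v1)" "sol (u2, v2)"
    by (metis S_iff surj_pair)
  let ?p = "param (u1, v1)"
  have v: "v1 = mult_mod ?p u1" "v2 = mult_mod ?p u2"
    using sol_param[OF sol(1)] \<open>F x = F y\<close> F_eq_iff[OF sol(2), of ?p] by (auto simp: xy)
  from sol obtain c1 c2 where c: "c1 > 0" "c2 > 0" "spec u1 v1 = c1 *\<^sub>R spec sv sv" "spec u2 v2 = c2 *\<^sub>R spec sv sv"
    by (auto simp: sol_def)
  have "u1 = u2"
  proof (rule solution_unique[of _ _ c1 c2 sv ?p])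
    show "spec u1 (mult_mod ?p u1) = c1 *\<^sub>R spec sv sv" using c(3) v(1) by simp
    show "spec u2 (mult_mod ?p u2) = c2 *\<^sub>R spec sv sv" using c(4) v(2) by simp
  qed (use sol c ev_sv_circle in \<open>auto simp: sol_def\<close>)
  then show "x = y" using v xy by simp
qed

text \<open>One global extension serves all points: \<open>vdata\<close> after \<open>param\<close>,
  on the open set where \<open>mult_mat\<close> is invertible.\<close>

lemma smooth_F: "smooth_map S F"
  unfolding smooth_map_def
proof
  fix x assume "x \<in> S"
  let ?U = "{x :: (real ^ 'i) \<times> (real ^ 'i). det (mult_mat (fst x)) \<noteq> 0}"
  have Am: "Ck_on r (\<lambda>x :: (real ^ 'i) \<times> (real ^ 'i). mult_mat (fst x) $ i $ j) V" if "open V" for i j r V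
    using that unfolding mult_mat_def matrix_def vec_lambda_beta
    by (intro Ck_on_vec_nth Ck_on_bounded_bilinear[OF bounded_bilinear_mult_mod] Ck_on_const
        Ck_on_bounded_linear bounded_linear_fst)
  have "Ck_on 0 (\<lambda>x :: (real ^ 'i) \<times> (real ^ 'i). det (mult_mat (fst x))) UNIV" by (intro Ck_on_det Am) auto
  then have "open ?U" by (simp add: open_Collect_neq)
  have "Ck_on r (\<lambda>x. vdata (param x)) ?U" for r
  proof (rule Ck_on_bounded_linear_compose[where L = vdata and f = param, OF _ \<open>open ?U\<close>])
    show "bounded_linear vdata" using linear_vdata by (simp add: linear_conv_bounded_linear)
    show "Ck_on r param ?U"
    proof (rule Ck_on_linear_system[where A = "\<lambda>x. mult_mat (fst x)" and b = snd, OF \<open>open ?U\<close> Am[OF \<open>open ?U\<close>]])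
      show "Ck_on r snd ?U" by (intro Ck_on_bounded_linear \<open>open ?U\<close> bounded_linear_snd)
      fix x assume "x \<in> ?U"
      then show "det (mult_mat (fst x)) \<noteq> 0" "mult_mat (fst x) *v param x = snd x"
        using mult_mod_param[of "fst x" "snd x"] by (auto simp: mult_mat)
    qed
  qed
  then have sm: "smooth_on (\<lambda>x. vdata (param x)) ?U" using \<open>open ?U\<close> by (intro smooth_onI)
  have xU: "x \<in> ?U"
    using \<open>x \<in> S\<close> det_mult_mat[of "fst x"] by (cases x) (auto simp: S_iff sol_def)
  have eqF: "vdata (param y) = F y" if "y \<in> S" for y
    using that sol_param(2) by (cases y) (simp add: S_iff)
  show "\<exists>U g. x \<in> U \<and> smooth_on g U \<and> (\<forall>y\<in>S \<inter> U. g y = F y)"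
    by (intro exI conjI ballI, rule xU, rule sm) (simp add: eqF)
qed

section \<open>Local inverses of the data map\<close>

lemma norm_ev_diff: "\<zeta> \<in> cball 0 1 \<Longrightarrow> cmod (ev u \<zeta> - ev v \<zeta>) \<le> CARD('i) * norm (u - v)"
proof -
  assume \<zeta>: "\<zeta> \<in> cball 0 1"
  have "ev u \<zeta> - ev v \<zeta> = (\<Sum>i\<in>UNIV. of_real ((u - v) $ i) * \<zeta> ^ rank i)"
    by (simp add: ev_eq_sum sum_subtractf algebra_simps)
  also have "cmod \<dots> \<le> (\<Sum>i\<in>(UNIV :: 'i set). norm (u - v) * 1)"
  proof (rule order_trans[OF norm_sum], rule sum_mono)
    fix i
    have "cmod \<zeta> ^ rank i \<le> 1" using \<zeta> by (intro power_le_one) auto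
    moreover have "\<bar>(u - v) $ i\<bar> \<le> norm (u - v)" by (rule component_le_norm_cart)
    ultimately show "cmod (of_real ((u - v) $ i) * \<zeta> ^ rank i) \<le> norm (u - v) * 1"
      unfolding norm_mult norm_power norm_of_real by (intro mult_mono) auto
  qed
  finally show ?thesis by simp
qed

lemma open_nonvanishing: "open {u. \<forall>\<zeta>\<in>cball 0 1. ev u \<zeta> \<noteq> 0}"
  unfolding open_dist
proof (intro ballI)
  fix u assume "u \<in> {u. \<forall>\<zeta>\<in>cball 0 1. ev u \<zeta> \<noteq> 0}"
  then have nz: "\<And>\<zeta>. \<zeta> \<in> cball 0 1 \<Longrightarrow> ev u \<zeta> \<noteq> 0" by blast
  have "compact (cball 0 1 :: complex set)" "(cball 0 1 :: complex set) \<noteq> {}" by auto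
  moreover have "continuous_on (cball 0 1) (\<lambda>\<zeta>. cmod (ev u \<zeta>))" by (intro continuous_intros)
  ultimately obtain \<zeta>0 where \<zeta>0: "\<zeta>0 \<in> cball 0 1" "\<And>\<zeta>. \<zeta> \<in> cball 0 1 \<Longrightarrow> cmod (ev u \<zeta>0) \<le> cmod (ev u \<zeta>)"
    using continuous_attains_inf[of "cball 0 1 :: complex set" "\<lambda>\<zeta>. cmod (ev u \<zeta>)"] by blast
  \<comment> \<open>The minimum modulus on the disc divided by the Lipschitz constant of
    \<open>norm_ev_diff\<close>.\<close>
  define e where "e = cmod (ev u \<zeta>0) / CARD('i)"
  have "e > 0" using nz[OF \<zeta>0(1)] by (simp add: e_def)
  moreover have "v \<in> {u. \<forall>\<zeta>\<in>cball 0 1. ev u \<zeta> \<noteq> 0}" if v: "dist v u < e" for v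
  proof (intro CollectI ballI notI)
    fix \<zeta> assume \<zeta>: "\<zeta> \<in> cball 0 1" "ev v \<zeta> = 0"
    have "cmod (ev u \<zeta>0) \<le> cmod (ev v \<zeta> - ev u \<zeta>)" using \<zeta>0(2)[OF \<zeta>(1)] \<zeta>(2) by simp
    also have "\<dots> \<le> CARD('i) * norm (v - u)" by (rule norm_ev_diff[OF \<zeta>(1)])
    also have "\<dots> < CARD('i) * e" using v by (intro mult_strict_left_mono) (auto simp: dist_norm)
    also have "\<dots> = cmod (ev u \<zeta>0)" by (simp add: e_def)
    finally show False by simp
  qed
  ultimately show "\<exists>e>0. \<forall>v. dist v u < e \<longrightarrow> v \<in> {u. \<forall>\<zeta>\<in>cball 0 1. ev u \<zeta> \<noteq> 0}" by blast
qed

text \<open>The implicit function theorem is applied to the equation with right-hand side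
  \<open>spec sv sv\<close>, at \<open>u0 / sqrt c0\<close>. Rescaling its solution by
  \<open>k\<close>, so that the constant coefficient is 1, multiplies the right-hand side by
  \<open>k^2\<close>, and this is the required constant.\<close>

lemma local_inverse:
  assumes "sol (u0, v0)"
  obtains U g where "open U" "F (u0, v0) \<in> U" "smooth_on g U"
    "\<And>w. w \<in> W \<inter> U \<Longrightarrow> g w \<in> S \<and> F (g w) = w"
proof -
  define p0 where "p0 = param (u0, v0)"
  have v0: "mult_mod p0 u0 = v0" and F0: "F (u0, v0) = vdata p0"
    using sol_param[OF assms] by (simp_all add: p0_def)
  obtain c0 where c0: "c0 > 0" "spec u0 v0 = c0 *\<^sub>R spec sv sv" using assms by (auto simp: sol_def)
  define x0 where "x0 = (1 / sqrt c0) *\<^sub>R u0"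
  note bl = bounded_bilinear.scaleR_left bounded_bilinear.scaleR_right
  have M0: "mult_mod p0 x0 = (1 / sqrt c0) *\<^sub>R v0"
    unfolding x0_def bl(2)[OF bounded_bilinear_mult_mod] v0 ..
  have nz0: "ev x0 \<zeta> \<noteq> 0" if "\<zeta> \<in> cball 0 1" for \<zeta>
    using assms that c0(1) by (auto simp: x0_def ev_scaleR sol_def)
  have "spec x0 (mult_mod p0 x0) = spec sv sv"
    unfolding M0 unfolding x0_def spec_scaleR c0(2) using c0(1) by (simp add: field_simps)
  moreover have "h = 0" if "spec h (mult_mod p0 x0) + spec x0 (mult_mod p0 h) = 0" for h
  proof (rule linearized_solution_zero[OF nz0 _ that])
    fix \<zeta> assume \<zeta>: "\<zeta> \<in> circle"
    have "ev x0 \<zeta> * cnj (ev (mult_mod p0 x0) \<zeta>) = of_real (1 / c0) * (ev u0 \<zeta> * cnj (ev v0 \<zeta>))"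
      unfolding M0 unfolding x0_def ev_scaleR using c0(1) by (simp flip: of_real_mult)
    then have "Re (ev x0 \<zeta> * cnj (ev (mult_mod p0 x0) \<zeta>)) = 1 / c0 * Re (ev u0 \<zeta> * cnj (ev v0 \<zeta>))"
      by simp
    then show "0 < Re (ev x0 \<zeta> * cnj (ev (mult_mod p0 x0) \<zeta>))"
      using sol_pos[OF assms \<zeta>] c0(1) by (simp only:) (intro mult_pos_pos, auto)
  qed
  ultimately obtain V X where V: "open V" "p0 \<in> V" "X p0 = x0" and X: "smooth_on X V"
    and eq: "\<And>p. p \<in> V \<Longrightarrow> spec (X p) (mult_mod p (X p)) = spec sv sv"
    using smooth_implicit_function[OF bounded_bilinear_spec bounded_bilinear_mult_mod] by metis
  define V' where "V' = V \<inter> X -` {u. \<forall>\<zeta>\<in>cball 0 1. ev u \<zeta> \<noteq> 0}"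
  have "Ck_on 0 X V" using X by (simp add: smooth_on_def)
  then have oV': "open V'"
    unfolding V'_def using continuous_open_preimage[OF _ V(1) open_nonvanishing] by simp
  have Xi0: "X p $ i0 \<noteq> 0" if "p \<in> V'" for p
    using that ev_0[of "X p"] unfolding V'_def by force
  define G where "G = (\<lambda>p. (inverse (X p $ i0) *\<^sub>R X p, inverse (X p $ i0) *\<^sub>R mult_mod p (X p)))"
  have CX: "Ck_on r X V'" for r
    using X unfolding smooth_on_def V'_def by (auto intro: Ck_on_subset)
  have CG: "Ck_on r G V'" for r
    unfolding G_def using CX
    by (intro Ck_on_Pair Ck_on_scaleR Ck_on_inverse Ck_on_vec_nth oV' Xi0
        Ck_on_bounded_bilinear[OF bounded_bilinear_mult_mod] Ck_on_bounded_linear[OF oV' bounded_linear_ident])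
  \<comment> \<open>Open in the full complex space, where \<open>G\<close> after
    \<open>vdata_inv\<close> is smooth; being a section of \<open>F\<close> is claimed only on
    \<open>W\<close>, where \<open>vdata_inv\<close> is a genuine inverse.\<close>
  define U where "U = vdata_inv -` V'"
  have bl: "bounded_linear vdata_inv" using vdata_inv(1) by (simp add: linear_conv_bounded_linear)
  have oU: "open U" unfolding U_def
    using bl by (intro open_vimage oV' linear_continuous_on)
  have sm: "smooth_on (\<lambda>w. G (vdata_inv w)) U"
    by (intro smooth_onI oU Ck_on_compose_bounded_linear[OF bl oV' oU _ CG]) (auto simp: U_def)
  show ?thesis
  proof (rule that[OF oU _ sm])
    show "F (u0, v0) \<in> U"
      using V nz0 by (simp add: U_def F0 vdata_inv V'_def)
    fix w assume w: "w \<in> W \<inter> U"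
    define p where "p = vdata_inv w"
    have wp: "w = vdata p" using w by (simp add: p_def vdata_vdata_inv W_iff)
    have p: "p \<in> V'" using w by (simp add: U_def p_def)
    define k where "k = inverse (X p $ i0)"
    define u where "u = k *\<^sub>R X p"
    have k: "k \<noteq> 0" using Xi0[OF p] by (simp add: k_def)
    have G: "G p = (u, mult_mod p u)"
      by (simp add: G_def u_def k_def bounded_bilinear.scaleR_right[OF bounded_bilinear_mult_mod])
    have u0: "u $ i0 = 1" using Xi0[OF p] by (simp add: u_def k_def)
    have p_half: "p $ i0 = 1 / 2" using w vdata_W_iff wp by blast
    have "sol (u, mult_mod p u)"
      unfolding sol_def prod.case
    proof (intro conjI)
      show "u $ i0 = 1" by (rule u0)
      show "mult_mod p u $ i0 = 1" by (simp add: mult_mod_i0 p_half u0)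
      show "\<forall>\<zeta>\<in>cball 0 1. ev u \<zeta> \<noteq> 0" using p k by (simp add: u_def ev_scaleR V'_def)
      have "spec u (mult_mod p u) = k\<^sup>2 *\<^sub>R spec sv sv"
        unfolding u_def bounded_bilinear.scaleR_right[OF bounded_bilinear_mult_mod] spec_scaleR
        using eq[of p] p by (simp add: V'_def power2_eq_square)
      then show "\<exists>c>0. spec u (mult_mod p u) = c *\<^sub>R spec sv sv" using k by (intro exI[of _ "k\<^sup>2"]) simp
    qed
    then show "G (vdata_inv w) \<in> S \<and> F (G (vdata_inv w)) = w"
      unfolding p_def[symmetric] G S_iff using F_eq_iff[of u "mult_mod p u" p] wp by blast
  qed
qed

section \<open>Closedness of the image\<close>

lemma spec_sv_nonzero: "spec sv sv \<noteq> 0"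
proof
  assume "spec sv sv = 0"
  then have "spec sv sv = 0 *\<^sub>R spec sv sv" by simp
  then have "Re (ev sv 1 * cnj (ev sv 1)) = 0"
    unfolding spec_eq_scaled_iff by (auto dest: bspec[of _ _ 1])
  moreover have "Re (ev sv 1 * cnj (ev sv 1)) = (cmod (ev sv 1))\<^sup>2"
    unfolding complex_norm_square[symmetric] by simp
  ultimately show False using ev_sv[of 1] by simp
qed

text \<open>The last bound is \<open>monic_poly_bounds\<close> at the reflected point
  \<open>inverse \<zeta>\<close>, multiplied by \<open>cmod \<zeta> ^ n\<close>. It is the same for
  all solutions and so keeps zeros out of the open disc in the limit.\<close>

lemma sol_bounds:
  fixes u v :: "real ^ 'i"
  assumes "sol (u, v)"
  shows "\<bar>u $ i\<bar> \<le> 2 ^ n" "\<bar>v $ i\<bar> \<le> 2 ^ n"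
    "\<zeta> \<in> ball 0 1 \<Longrightarrow> (1 - cmod \<zeta>) ^ n \<le> cmod (ev u \<zeta>)"
proof -
  have sch: "rpoly u \<in> schur_polys n" "rpoly v \<in> schur_polys n"
    using assms P_sigma_iff[of u v] by (auto simp: P_sigma_def P_space_def)
  have b: "cmod (coeff (cp (rpoly u)) k) \<le> 2 ^ n"
    "1 \<le> cmod x \<Longrightarrow> (cmod x - 1) ^ n \<le> cmod (cpoly (rpoly u) x)"
    if "rpoly u \<in> schur_polys n" for u x k
    using monic_poly_bounds[of "cp (rpoly u)"] that by (auto simp: schur_polys_def cpoly_def)
  show "\<bar>u $ i\<bar> \<le> 2 ^ n" "\<bar>v $ i\<bar> \<le> 2 ^ n"
    using b(1)[OF sch(1), of "n - rank i"] b(1)[OF sch(2), of "n - rank i"] by (simp_all add: coeff_rpoly)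
  assume \<zeta>: "\<zeta> \<in> ball 0 1"
  show "(1 - cmod \<zeta>) ^ n \<le> cmod (ev u \<zeta>)"
  proof (cases "\<zeta> = 0")
    case True
    then show ?thesis using assms by (simp add: ev_0 sol_def)
  next
    case False
    then have "1 \<le> cmod (inverse \<zeta>)" using \<zeta> by (simp add: norm_inverse one_le_inverse_iff less_imp_le)
    from b(2)[OF sch(1) this]
    have "(cmod (inverse \<zeta>) - 1) ^ n \<le> cmod (inverse \<zeta>) ^ n * cmod (ev u \<zeta>)"
      using cpoly_rpoly[of "inverse \<zeta>" u] False by (simp add: norm_mult norm_power)
    then have "cmod \<zeta> ^ n * (cmod (inverse \<zeta>) - 1) ^ n \<le> cmod \<zeta> ^ n * (cmod (inverse \<zeta>) ^ n * cmod (ev u \<zeta>))"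
      by (intro mult_left_mono) auto
    then show ?thesis
      using False by (simp add: norm_inverse power_mult_distrib[symmetric] mult.assoc[symmetric] right_diff_distrib)
  qed
qed

lemma bounded_S: "bounded S"
proof -
  have "norm x \<le> 2 * (CARD('i) * 2 ^ n)" if xS: "x \<in> S" for x
  proof -
    obtain u v where x: "x = (u, v)" "sol (u, v)" using xS by (metis S_iff surj_pair)
    have "norm u \<le> (\<Sum>i\<in>(UNIV :: 'i set). 2 ^ n)" "norm v \<le> (\<Sum>i\<in>(UNIV :: 'i set). 2 ^ n)"
      by (rule order_trans[OF norm_le_l1_cart], rule sum_mono, rule sol_bounds(1,2)[OF x(2)])+
    moreover have "norm x \<le> norm u + norm v" unfolding x by (rule norm_Pair_le)
    ultimately show ?thesis by simp
  qed
  then show ?thesis unfolding bounded_iff by blast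
qed

text \<open>The spectral constant converges to some \<open>c \<ge> 0\<close>, and
  \<open>c = 0\<close> contradicts positivity of the limit data. Zeros on the circle are then
  excluded by \<open>c > 0\<close>, zeros inside by the uniform bound in
  \<open>sol_bounds\<close>.\<close>

lemma limit_of_solutions:
  assumes sol: "\<And>k :: nat. sol (u k, v k)" and lim: "u \<longlonglongrightarrow> a" "v \<longlonglongrightarrow> b"
    and p: "p \<longlonglongrightarrow> q" "\<And>k. v k = mult_mod (p k) (u k)" and q: "vdata q \<in> W"
  shows "sol (a, b)" "F (a, b) = vdata q"
proof -
  have "v \<longlonglongrightarrow> mult_mod q a"
    unfolding p(2)[abs_def] by (intro bounded_bilinear.tendsto[OF bounded_bilinear_mult_mod] p lim)
  then have b: "b = mult_mod q a" using lim(2) LIMSEQ_unique by blast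
  have ei: "(\<lambda>k. u k $ i0) \<longlonglongrightarrow> a $ i0" "(\<lambda>k. v k $ i0) \<longlonglongrightarrow> b $ i0" by (intro tendsto_intros lim)+
  have "(\<lambda>k. u k $ i0) = (\<lambda>k. 1)" "(\<lambda>k. v k $ i0) = (\<lambda>k. 1)" using sol by (auto simp: sol_def)
  with ei have ab0: "a $ i0 = 1" "b $ i0 = 1" by (simp_all add: LIMSEQ_const_iff)
  define c where "c = norm (spec a b) / norm (spec sv sv)"
  \<comment> \<open>Written as a quotient of norms, the existentially given constant becomes a
    continuous function of the pair, so its convergence follows.\<close>
  have sk: "spec (u k) (v k) = (norm (spec (u k) (v k)) / norm (spec sv sv)) *\<^sub>R spec sv sv" for k
  proof -
    obtain d where "d > 0" "spec (u k) (v k) = d *\<^sub>R spec sv sv" using sol[of k] by (auto simp: sol_def)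
    then show ?thesis using spec_sv_nonzero by (simp only: norm_scaleR) simp
  qed
  have sl: "(\<lambda>k. spec (u k) (v k)) \<longlonglongrightarrow> spec a b"
    by (intro bounded_bilinear.tendsto[OF bounded_bilinear_spec] lim)
  have "(\<lambda>k. (norm (spec (u k) (v k)) / norm (spec sv sv)) *\<^sub>R spec sv sv) \<longlonglongrightarrow> c *\<^sub>R spec sv sv"
    unfolding c_def using spec_sv_nonzero by (intro tendsto_intros sl) auto
  then have "(\<lambda>k. spec (u k) (v k)) \<longlonglongrightarrow> c *\<^sub>R spec sv sv" by (simp only: sk[symmetric])
  then have ab: "spec a b = c *\<^sub>R spec sv sv" using sl LIMSEQ_unique by blast
  have circ: "Re (ev a \<zeta> * cnj (ev b \<zeta>)) = c * (cmod (ev sv \<zeta>))\<^sup>2" if "\<zeta> \<in> circle" for \<zeta>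
    using ab that unfolding spec_eq_scaled_iff by blast
  have "c \<noteq> 0"
  proof
    assume "c = 0"
    then have "Re (ev a \<zeta> * cnj (ev (mult_mod q a) \<zeta>)) = 0" if "\<zeta> \<in> circle" for \<zeta>
      using circ[OF that] b by simp
    then have "\<not> positive_definite (pick_matrix z idx (vdata q))"
      using ab0 by (intro pick_not_positive_definite[of a]) auto
    then show False using q by (simp add: W_iff)
  qed
  then have c: "c > 0" unfolding c_def by (simp add: less_le)
  have "ev a \<zeta> \<noteq> 0" if \<zeta>: "\<zeta> \<in> cball 0 1" for \<zeta>
  proof (cases "\<zeta> \<in> circle")
    case True
    then show ?thesis using circ[OF True] c ev_sv_circle[OF True] by auto
  next
    case False
    then have \<zeta>': "\<zeta> \<in> ball 0 1" using \<zeta> by auto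
    have "(\<lambda>k. ev (u k) \<zeta>) \<longlonglongrightarrow> ev a \<zeta>"
      unfolding ev_eq_sum by (intro tendsto_intros lim)
    then have "(\<lambda>k. cmod (ev (u k) \<zeta>)) \<longlonglongrightarrow> cmod (ev a \<zeta>)" by (rule tendsto_norm)
    then have "(1 - cmod \<zeta>) ^ n \<le> cmod (ev a \<zeta>)"
      by (rule tendsto_lowerbound) (use sol_bounds(3)[OF sol \<zeta>'] in auto)
    moreover have "0 < (1 - cmod \<zeta>) ^ n" using \<zeta>' by simp
    ultimately show ?thesis by auto
  qed
  then show 1: "sol (a, b)" using ab0 ab c unfolding sol_def by auto
  show "F (a, b) = vdata q" using F_eq_iff[OF 1] b by blast
qed

text \<open>Boundedness of \<open>S\<close> provides a convergent subsequence of preimages. The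
  limit pair is a solution only because the limit data lie in \<open>W\<close>, so closedness is
  relative to \<open>W\<close>.\<close>

lemma closedin_image: "closedin (top_of_set W) (F ` S)"
  unfolding closedin_limpt
proof (intro conjI allI impI)
  show "F ` S \<subseteq> W"
  proof (rule image_subsetI)
    fix x assume "x \<in> S"
    then show "F x \<in> W" by (cases x) (simp only: S_iff F_in_W)
  qed
next
  fix w assume "w islimpt F ` S \<and> w \<in> W"
  then have w: "w \<in> W" and "\<exists>f. (\<forall>k. f k \<in> F ` S - {w}) \<and> f \<longlonglongrightarrow> w"
    by (simp_all only: islimpt_sequential)
  then obtain wk where wk: "\<forall>k. wk k \<in> F ` S - {w}" "wk \<longlonglongrightarrow> w" by (elim exE conjE)
  then have "\<forall>k. \<exists>y. y \<in> S \<and> wk k = F y" by (meson DiffD1 imageE)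
  from choice[OF this] obtain x where "\<forall>k. x k \<in> S \<and> wk k = F (x k)" ..
  then have x: "x k \<in> S" "wk k = F (x k)" for k by simp_all
  have "bounded (range x)" by (rule bounded_subset[OF bounded_S]) (use x(1) in auto)
  from bounded_imp_convergent_subsequence[OF this]
  obtain l r where r: "strict_mono r" "(x \<circ> r) \<longlonglongrightarrow> l" by blast
  define u v where "u = (\<lambda>k. fst (x (r k)))" and "v = (\<lambda>k. snd (x (r k)))"
  have xr: "x (r k) = (u k, v k)" for k by (simp add: u_def v_def)
  have sol: "sol (u k, v k)" for k using x(1)[of "r k"] unfolding xr S_iff .
  have lim: "u \<longlonglongrightarrow> fst l" "v \<longlonglongrightarrow> snd l"
    unfolding u_def v_def using tendsto_fst[OF r(2)] tendsto_snd[OF r(2)] by (simp_all add: o_def)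
  have p: "vdata_inv (wk (r k)) = param (u k, v k)" for k
    unfolding x(2) xr sol_param(2)[OF sol] by (rule vdata_inv(2))
  have v: "v k = mult_mod (vdata_inv (wk (r k))) (u k)" for k
    unfolding p by (rule sol_param(1)[OF sol, symmetric])
  have vw: "vdata (vdata_inv w) = w" using w by (intro vdata_vdata_inv) (simp only: W_iff)
  have "(\<lambda>k. wk (r k)) \<longlonglongrightarrow> w" using LIMSEQ_subseq_LIMSEQ[OF wk(2) r(1)] by (simp add: o_def)
  then have lp: "(\<lambda>k. vdata_inv (wk (r k))) \<longlonglongrightarrow> vdata_inv w"
    using vdata_inv(1) by (intro bounded_linear.tendsto[of vdata_inv]) (simp_all add: linear_conv_bounded_linear)
  have "vdata (vdata_inv w) \<in> W" unfolding vw by (rule w)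
  from limit_of_solutions[OF sol lim lp v this, unfolded vw]
  have "(fst l, snd l) \<in> S" "F (fst l, snd l) = w" by (simp_all only: S_iff)
  then show "w \<in> F ` S" by (intro image_eqI[of w F "(fst l, snd l)"]) (simp_all only:)
qed

lemma openin_image: "openin (top_of_set W) (F ` S)"
proof (subst openin_subopen, intro ballI)
  fix w assume "w \<in> F ` S"
  then obtain u v where uv: "sol (u, v)" "w = F (u, v)" using S_iff by (metis imageE surj_pair)
  obtain U g where U: "open U" "F (u, v) \<in> U" "\<And>w. w \<in> W \<inter> U \<Longrightarrow> g w \<in> S \<and> F (g w) = w"
    using local_inverse[OF uv(1)] by metis
  have "W \<inter> U \<subseteq> F ` S" using U(3) by (metis imageI subsetI)
  moreover have "openin (top_of_set W) (W \<inter> U)" using U(1) by (simp add: openin_open_Int)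
  moreover have "w \<in> W \<inter> U" using U(2) uv F_in_W by auto
  ultimately show "\<exists>T. openin (top_of_set W) T \<and> w \<in> T \<and> T \<subseteq> F ` S" by blast
qed

text \<open>For each fixed vector \<open>y\<close> the Pick form is linear in \<open>p\<close>, so
  positivity is an intersection of half-spaces and \<open>P\<close> is convex; \<open>W\<close> is
  its linear image.\<close>

lemma connected_W: "connected W"
proof -
  define J where "J y p = cmean (\<lambda>\<zeta>. 2 * Re (ev p \<zeta>) * (cmod (gen y \<zeta>))\<^sup>2)" for y p
  note [continuous_intros] = holomorphic_cball_continuous_circle[OF holomorphic_gen]
  have J: "J y (s *\<^sub>R p + t *\<^sub>R q) = s * J y p + t * J y q" for y p q s t
  proof -
    have e: "ev (s *\<^sub>R p + t *\<^sub>R q) \<zeta> = of_real s * ev p \<zeta> + of_real t * ev q \<zeta>" for \<zeta>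
      by (simp add: cpoly_def vpoly_add vpoly_scaleR cp_add cp_smult)
    have "J y (s *\<^sub>R p + t *\<^sub>R q) = cmean (\<lambda>\<zeta>. s *\<^sub>R (2 * Re (ev p \<zeta>) * (cmod (gen y \<zeta>))\<^sup>2)
        + t *\<^sub>R (2 * Re (ev q \<zeta>) * (cmod (gen y \<zeta>))\<^sup>2))"
      unfolding J_def e by (rule cmean_cong) (simp add: algebra_simps)
    also have "\<dots> = s * J y p + t * J y q"
      unfolding J_def
      by (subst cmean_add, (intro continuous_intros)+, (subst cmean_linear[OF bounded_linear_scaleR_right], intro continuous_intros)+) simp
    finally show ?thesis .
  qed
  define P where "P = {p. p $ i0 = 1 / 2 \<and> (\<forall>y. y \<noteq> 0 \<longrightarrow> 0 < J y p)}"
  have "convex P"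
    unfolding convex_def
  proof (intro ballI allI impI)
    fix p q s t assume *: "p \<in> P" "q \<in> P" "0 \<le> (s :: real)" "0 \<le> (t :: real)" "s + t = 1"
    have "0 < J y (s *\<^sub>R p + t *\<^sub>R q)" if "y \<noteq> 0" for y
    proof -
      have "0 < J y p" "0 < J y q" using * that by (auto simp: P_def)
      then show ?thesis
        unfolding J using *(3-5) by (cases "s = 0") (auto intro!: add_pos_nonneg)
    qed
    moreover have "(s *\<^sub>R p + t *\<^sub>R q) $ i0 = 1 / 2"
    proof -
      have "p $ i0 = 1 / 2" "q $ i0 = 1 / 2" using *(1,2) by (simp_all only: P_def mem_Collect_eq)
      then have "(s *\<^sub>R p + t *\<^sub>R q) $ i0 = (s + t) / 2"
        by (simp only: vector_add_component vector_scaleR_component) simp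
      then show ?thesis using *(5) by simp
    qed
    ultimately show "s *\<^sub>R p + t *\<^sub>R q \<in> P" by (simp add: P_def)
  qed
  moreover have "W = vdata ` P"
  proof -
    have iff: "vdata p \<in> W \<longleftrightarrow> p \<in> P" for p
      by (simp only: vdata_W_iff positive_definite_def pick_quadratic[OF vdata_def] simp_thms
          pick_matrix_hermitian[OF vdata_def] cpoly_def[symmetric] P_def J_def mem_Collect_eq)
    show ?thesis
    proof (intro equalityI subsetI)
      fix w assume w: "w \<in> W"
      then have e: "vdata (vdata_inv w) = w" by (intro vdata_vdata_inv) (simp only: W_iff)
      with w iff[of "vdata_inv w"] have "vdata_inv w \<in> P" by simp
      then show "w \<in> vdata ` P" using e by (metis imageI)
    next
      fix w assume "w \<in> vdata ` P"
      then show "w \<in> W" using iff by auto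
    qed
  qed
  moreover have "continuous_on P vdata"
    using linear_vdata by (intro linear_continuous_on) (simp add: linear_conv_bounded_linear)
  ultimately show ?thesis using connected_continuous_image[OF _ convex_connected] by simp
qed

section \<open>Bijectivity, smooth inverse and the unique interpolant\<close>

lemma F_bij: "bij_betw F S W"
proof -
  have "spec sv sv = 1 *\<^sub>R spec sv sv" by simp
  then have "sol (sv, sv)" using sv_i0 ev_sv unfolding sol_def by (auto intro: exI[of _ 1])
  then have "F ` S \<noteq> {}" using S_iff by blast
  then have "F ` S = W"
    using connected_W closedin_image openin_image unfolding connected_clopen by blast
  then show ?thesis using F_inj by (simp add: bij_betw_def)
qed

lemma smooth_inverse: "smooth_map W (inv_into S F)"
  unfolding smooth_map_def
proof
  fix w assume w: "w \<in> W"
  then obtain u v where uv: "sol (u, v)" "w = F (u, v)"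
    using F_bij S_iff unfolding bij_betw_def by (metis imageE surj_pair)
  obtain U g where U: "open U" "F (u, v) \<in> U" "smooth_on g U" "\<And>w. w \<in> W \<inter> U \<Longrightarrow> g w \<in> S \<and> F (g w) = w"
    using local_inverse[OF uv(1)] by metis
  have "g y = inv_into S F y" if "y \<in> W \<inter> U" for y
    using U(4)[OF that] inv_into_f_f[OF F_inj, of "g y"] by simp
  then show "\<exists>U g. w \<in> U \<and> smooth_on g U \<and> (\<forall>y\<in>W \<inter> U. g y = inv_into S F y)"
    using U(2) uv(2) by (intro exI[of _ U] exI[of _ g] conjI ballI U(3)) simp_all
qed

lemma diffeomorphism_F: "diffeomorphism S W F"
  unfolding diffeomorphism_def using F_bij smooth_F smooth_inverse by blast

lemma interpolates_iff: "interpolates m z \<mu> idx w \<phi> \<longleftrightarrow> data_of z idx \<phi> = w"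
proof
  assume "interpolates m z \<mu> idx w \<phi>"
  then have "data_of z idx \<phi> $ i = w $ i" for i
    using idx_in[of i] inv_idx[of i]
    by (simp add: interpolates_def data_of_def entry_def case_prod_unfold ordr_def)
  then show "data_of z idx \<phi> = w" by (simp add: vec_eq_iff)
next
  assume "data_of z idx \<phi> = w"
  then show "interpolates m z \<mu> idx w \<phi>"
    by (auto simp: interpolates_def data_of_def entry_def idx_inv)
qed

lemma unique_interpolant:
  assumes w: "w \<in> W"
  shows "\<exists>!(a, b). (a, b) \<in> P_sigma n \<sigma> \<and> interpolates m z \<mu> idx w (interpolant a b) \<and>
    spectral_condition \<sigma> a b"
proof -
  have iff: "(a, b) \<in> P_sigma n \<sigma> \<and> interpolates m z \<mu> idx w (interpolant a b) \<and> spectral_condition \<sigma> a b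
      \<longleftrightarrow> (\<exists>u v. a = rpoly u \<and> b = rpoly v \<and> (u, v) \<in> S \<and> F (u, v) = w)" for a b
  proof
    assume *: "(a, b) \<in> P_sigma n \<sigma> \<and> interpolates m z \<mu> idx w (interpolant a b) \<and> spectral_condition \<sigma> a b"
    then have "degree a \<le> n" "degree b \<le> n" by (auto simp: P_sigma_def P_space_def schur_polys_def)
    then obtain u v where "a = rpoly u" "b = rpoly v" using rpoly_surj by metis
    with * show "\<exists>u v. a = rpoly u \<and> b = rpoly v \<and> (u, v) \<in> S \<and> F (u, v) = w"
      by (auto simp: interpolates_iff S_iff P_sigma_iff F_def poly_of_vec_eq)
  next
    assume "\<exists>u v. a = rpoly u \<and> b = rpoly v \<and> (u, v) \<in> S \<and> F (u, v) = w"
    then show "(a, b) \<in> P_sigma n \<sigma> \<and> interpolates m z \<mu> idx w (interpolant a b) \<and> spectral_condition \<sigma> a b"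
      by (auto simp: interpolates_iff S_iff P_sigma_iff[symmetric] F_def poly_of_vec_eq) (simp add: P_sigma_def)
  qed
  obtain u v where uv: "(u, v) \<in> S" "F (u, v) = w"
    using F_bij w unfolding bij_betw_def by (metis imageE surj_pair)
  show ?thesis
  proof (rule ex1I[of _ "(rpoly u, rpoly v)"])
    show "case (rpoly u, rpoly v) of (a, b) \<Rightarrow> (a, b) \<in> P_sigma n \<sigma> \<and>
        interpolates m z \<mu> idx w (interpolant a b) \<and> spectral_condition \<sigma> a b"
      unfolding prod.case iff using uv by blast
    fix x assume "case x of (a, b) \<Rightarrow> (a, b) \<in> P_sigma n \<sigma> \<and>
        interpolates m z \<mu> idx w (interpolant a b) \<and> spectral_condition \<sigma> a b"
    then obtain u' v' where "x = (rpoly u', rpoly v')" "(u', v') \<in> S" "F (u', v') = w"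
      unfolding case_prod_unfold iff prod.collapse by (metis prod.collapse)
    then show "x = (rpoly u, rpoly v)" using inj_onD[OF F_inj, of "(u', v')" "(u, v)"] uv by auto
  qed
qed

end

theorem theorem1:
  fixes m n :: nat
    and z :: "nat \<Rightarrow> complex"
    and \<mu> :: "nat \<Rightarrow> nat"
    and idx :: "'i::finite \<Rightarrow> nat \<times> nat"
    and \<sigma> :: "real poly"
  assumes "z 0 = 0"
    and "inj_on z {..m}"
    and "\<And>j. j \<le> m \<Longrightarrow> cmod (z j) < 1"
    and "\<And>j. j \<le> m \<Longrightarrow> 1 \<le> \<mu> j"
    and "\<And>j. j \<le> m \<Longrightarrow> \<exists>j'\<le>m. z j' = cnj (z j) \<and> \<mu> j' = \<mu> j"
    and "n = (\<Sum>j\<le>m. \<mu> j) - 1"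
    and "bij_betw idx UNIV (index_set m \<mu>)"
    and "\<sigma> \<in> schur_polys n"
  shows "(\<forall>w \<in> W_plus m z \<mu> idx.
            \<exists>!(a, b). (a, b) \<in> P_sigma n \<sigma> \<and>
              interpolates m z \<mu> idx w (interpolant a b) \<and>
              spectral_condition \<sigma> a b)
         \<and> diffeomorphism (P_sigma_vec n \<mu> idx \<sigma>) (W_plus m z \<mu> idx)
            (\<lambda>(u, v). data_of z idx
               (interpolant (poly_of_vec n \<mu> idx u) (poly_of_vec n \<mu> idx v)))"
proof -
  interpret pick_sigma m n z \<mu> idx \<sigma>
    by unfold_locales (fact assms)+
  show ?thesis
    using unique_interpolant diffeomorphism_F unfolding F_def by blast
qed

end
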